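(* Let $\alpha\in(0,1)\setminus\{\tfrac12,\tfrac14,\tfrac16,\ldots\}$ and let $\Gamma^{\pm}$ be the processes defined in the context. 1. The real-time real-valued process $(\Gamma_t,t\in\mathbb{R})$ defined as $\Gamma_t=2\operatorname{Re}\Gamma^+_t=\Gamma^+_t+\Gamma^-_t$ has the same law as the two-sided fractional Brownian motion $(B_t,t\in\mathbb{R})$ with Hurst exponent $\alpha$. 2. Let $t\in\mathbb{R}$. Then, with probability 1, $$2\operatorname{Re}\Gamma^+_z=\Gamma^+_z+\Gamma^-_{\bar z}\to\Gamma_t$$ as $z\in\Pi^+$ goes to $t$ along any path in the closed upper half-plane. More precisely, there is a constant $C$ such that $$\mathbb{E}\big[|2\operatorname{Re}\Gamma^+_z-\Gamma_t|^2\big]\le C|z-t|^{2\alpha}.$$ Hence the real-valued process $z\mapsto 2\operatorname{Re}\Gamma_z^+$, $z\in\Pi^+$, has an $(\alpha-\varepsilon)$-Hölder continuous version for every $\varepsilon>0$.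
   Context: $\Pi^+=\{z\in\mathbb{C}:\operatorname{Im}z>0\}$, and $\bar\Pi^+$ is its closure. Powers $z^\beta$ ($z\in\mathbb{C}\setminus\mathbb{R}_-$) use the principal logarithm, and $(x)_k=x(x+1)\cdots(x+k-1)$. For $k\ge0$, $$f_k(z)=2^{\alpha-1}\sqrt{\tfrac{\alpha(1-2\alpha)}{2\cos\pi\alpha}}\sqrt{\tfrac{(2-2\alpha)_k}{k!}}\left(\tfrac{z+i}{2i}\right)^{2\alpha-2}\left(\tfrac{z-i}{z+i}\right)^k.$$ Let $\xi_k^1,\xi_k^2$ ($k\ge0$) be independent centered real Gaussian variables with variance $\frac12$ and $\xi_k^\pm=\xi_k^1\pm i\xi_k^2$ (so $\mathbb{E}[\xi_k^+\xi_k^-]=1$). The process $\Gamma'^+_z=\sum_{k\ge0}f_k(z)\xi_k^+$, $z\in\Pi^+$, is a.s. analytic on $\Pi^+$, and $\Gamma'^-_{\bar z}=\overline{\Gamma'^+_z}$; one has $\mathbb{E}[\Gamma'^+_z\Gamma'^+_w]=0$ and $\mathbb{E}[\Gamma'^+_z\Gamma'^-_{\bar w}]=\frac{\alpha(1-2\alpha)}{2\cos\pi\alpha}(-i(z-\bar w))^{2\alpha-2}$. For $z\in\bar\Pi^+$, $\Gamma^+_z=\int_\gamma\Gamma'^+_u\,du$, where $\gamma:(0,1)\to\Pi^+$ is any continuous path with endpoints $\gamma(0)=0$, $\gamma(1)=z$ (integral up to the boundary understood in the $L^2$ sense), and $\Gamma^-_{\bar z}=\overline{\Gamma^+_z}$.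 Two-sided fractional Brownian motion with Hurst exponent $\alpha$ is the centered Gaussian process with covariance $\mathbb{E}[B_sB_t]=\frac12(|s|^{2\alpha}+|t|^{2\alpha}-|t-s|^{2\alpha})$. *)

theory Defs
  imports "HOL-Probability.Probability" "HOL-Complex_Analysis.Complex_Analysis"
begin

definition uhp :: "complex set" where
  "uhp = {z. Im z > 0}"

definition f_coeff :: "real \<Rightarrow> nat \<Rightarrow> complex \<Rightarrow> complex" where
  "f_coeff \<alpha> k z =
     complex_of_real (2 powr (\<alpha> - 1) * sqrt (\<alpha> * (1 - 2 * \<alpha>) / (2 * cos (pi * \<alpha>)))
                      * sqrt (pochhammer (2 - 2 * \<alpha>) k / fact k))
     * ((z + \<i>) / (2 * \<i>)) powr complex_of_real (2 * \<alpha> - 2)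
     * ((z - \<i>) / (z + \<i>)) ^ k"

text \<open>The second parameter of \<^const>\<open>normal_density\<close> is the standard deviation.\<close>

definition gaussian_noise :: "'a measure \<Rightarrow> (nat \<Rightarrow> 'a \<Rightarrow> real) \<Rightarrow> (nat \<Rightarrow> 'a \<Rightarrow> real) \<Rightarrow> bool" where
  "gaussian_noise M \<xi>1 \<xi>2 \<longleftrightarrow>
     prob_space M \<and>
     (\<forall>k. distributed M lborel (\<xi>1 k) (normal_density 0 (sqrt (1/2)))) \<and>
     (\<forall>k. distributed M lborel (\<xi>2 k) (normal_density 0 (sqrt (1/2)))) \<and>
     prob_space.indep_vars M (\<lambda>_. borel) (case_sum \<xi>1 \<xi>2) (UNIV :: (nat + nat) set)"

definition Gamma'_plus ::
  "real \<Rightarrow> (nat \<Rightarrow> 'a \<Rightarrow> real) \<Rightarrow> (nat \<Rightarrow> 'a \<Rightarrow> real) \<Rightarrow> complex \<Rightarrow> 'a \<Rightarrow> complex" where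
  "Gamma'_plus \<alpha> \<xi>1 \<xi>2 z \<omega> = (\<Sum>k. f_coeff \<alpha> k z * (complex_of_real (\<xi>1 k \<omega>) + \<i> * complex_of_real (\<xi>2 k \<omega>)))"

text \<open>The integral of a function \<open>g\<close>, holomorphic on the open set \<open>S\<close>, along a path \<open>p\<close> in \<open>S\<close>
  that is merely continuous. The library's \<^const>\<open>contour_integral\<close> needs a derivative of the path, so
  \<open>p\<close> is replaced by a piecewise \<open>C\<^sup>1\<close> path homotopic to it in \<open>S\<close> with the same endpoints; by
  Cauchy's theorem the value does not depend on the choice.\<close>

definition hol_path_integral ::
  "complex set \<Rightarrow> (real \<Rightarrow> complex) \<Rightarrow> (complex \<Rightarrow> complex) \<Rightarrow> complex" where
  "hol_path_integral S p g =
     (THE I. \<exists>q. valid_path q \<and> homotopic_paths S p q \<and> (g has_contour_integral I) q)"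

text \<open>\<open>X\<close> is the integral of the random function \<open>g\<close> along \<open>\<gamma>\<close>, whose endpoints may lie on the
  boundary of \<open>S\<close>, in the \<open>L\<^sup>2\<close> sense: the integrals along \<open>\<gamma>\<close> restricted to \<open>[a, b]\<close>
  converge to \<open>X\<close> in mean square as \<open>a\<close> decreases to 0 and \<open>b\<close> increases to 1.\<close>

definition is_L2_path_integral ::
  "'a measure \<Rightarrow> complex set \<Rightarrow> (real \<Rightarrow> complex) \<Rightarrow> (complex \<Rightarrow> 'a \<Rightarrow> complex) \<Rightarrow> ('a \<Rightarrow> complex) \<Rightarrow> bool"
where
  "is_L2_path_integral M S \<gamma> g X \<longleftrightarrow>
     X \<in> borel_measurable M \<and>
     ((\<lambda>(a, b). \<integral>\<^sup>+\<omega>. ennreal ((norm (hol_path_integral S (subpath a b \<gamma>) (\<lambda>u. g u \<omega>) - X \<omega>))\<^sup>2) \<partial>M)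
        \<longlongrightarrow> 0) (at_right 0 \<times>\<^sub>F at_left 1)"

text \<open>\<open>\<Gamma>\<close> is the process \<open>\<Gamma>\<^sup>+\<close> on the closed upper half-plane. The first conjunct of the
  definition determines each \<open>\<Gamma> z\<close> up to a null event depending on \<open>z\<close>. The second one selects the
  usual version inside the half-plane: almost surely, the increments of \<open>\<Gamma>\<close> there are, for all paths
  at once, the pathwise integrals of \<open>\<Gamma>'\<^sup>+\<close>. Nothing is required of the boundary values jointly.
  A single path from 0 to \<open>z\<close> is asked for, so that what is proved about all such \<open>\<Gamma>\<close> holds
  whichever paths are used.\<close>

definition is_Gamma_plus ::
  "'a measure \<Rightarrow> real \<Rightarrow> (nat \<Rightarrow> 'a \<Rightarrow> real) \<Rightarrow> (nat \<Rightarrow> 'a \<Rightarrow> real) \<Rightarrow> (complex \<Rightarrow> 'a \<Rightarrow> complex) \<Rightarrow> bool"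
where
  "is_Gamma_plus M \<alpha> \<xi>1 \<xi>2 \<Gamma> \<longleftrightarrow>
     (\<forall>z\<in>closure uhp. \<exists>\<gamma>. path \<gamma> \<and> pathstart \<gamma> = 0 \<and> pathfinish \<gamma> = z \<and> \<gamma> ` {0<..<1} \<subseteq> uhp \<and>
        is_L2_path_integral M uhp \<gamma> (Gamma'_plus \<alpha> \<xi>1 \<xi>2) (\<Gamma> z)) \<and>
     (AE \<omega> in M. \<forall>p. path p \<and> path_image p \<subseteq> uhp \<longrightarrow>
        \<Gamma> (pathfinish p) \<omega> - \<Gamma> (pathstart p) \<omega>
          = hol_path_integral uhp p (\<lambda>u. Gamma'_plus \<alpha> \<xi>1 \<xi>2 u \<omega>))"

text \<open>\<open>\<Gamma>\<^sup>-\<close> lives on the closed lower half-plane.\<close>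

definition Gamma_minus :: "(complex \<Rightarrow> 'a \<Rightarrow> complex) \<Rightarrow> complex \<Rightarrow> 'a \<Rightarrow> complex" where
  "Gamma_minus \<Gamma> w \<omega> = cnj (\<Gamma> (cnj w) \<omega>)"

definition Gamma_real :: "(complex \<Rightarrow> 'a \<Rightarrow> complex) \<Rightarrow> real \<Rightarrow> 'a \<Rightarrow> real" where
  "Gamma_real \<Gamma> t \<omega> = 2 * Re (\<Gamma> (complex_of_real t) \<omega>)"

text \<open>Gaussian in the wide sense, constants included; needed since \<open>B\<^sub>0 = 0\<close> for the
  fractional Brownian motion.\<close>

definition gaussian_rv :: "'a measure \<Rightarrow> ('a \<Rightarrow> real) \<Rightarrow> bool" where
  "gaussian_rv M X \<longleftrightarrow>
     X \<in> borel_measurable M \<and>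
     ((\<exists>\<mu> \<sigma>. \<sigma> > 0 \<and> distributed M lborel X (normal_density \<mu> \<sigma>)) \<or> (\<exists>\<mu>. AE \<omega> in M. X \<omega> = \<mu>))"

definition gaussian_process :: "'a measure \<Rightarrow> ('t \<Rightarrow> 'a \<Rightarrow> real) \<Rightarrow> bool" where
  "gaussian_process M X \<longleftrightarrow>
     prob_space M \<and> (\<forall>I c. finite I \<longrightarrow> gaussian_rv M (\<lambda>\<omega>. \<Sum>t\<in>I. c t * X t \<omega>))"

definition fractional_brownian_motion :: "'a measure \<Rightarrow> real \<Rightarrow> (real \<Rightarrow> 'a \<Rightarrow> real) \<Rightarrow> bool" where
  "fractional_brownian_motion M \<alpha> B \<longleftrightarrow>
     gaussian_process M B \<and>
     (\<forall>t. prob_space.expectation M (B t) = 0) \<and>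
     (\<forall>s t. prob_space.expectation M (\<lambda>\<omega>. B s \<omega> * B t \<omega>)
        = (\<bar>s\<bar> powr (2 * \<alpha>) + \<bar>t\<bar> powr (2 * \<alpha>) - \<bar>t - s\<bar> powr (2 * \<alpha>)) / 2)"

definition process_law :: "'a measure \<Rightarrow> ('t \<Rightarrow> 'a \<Rightarrow> real) \<Rightarrow> ('t \<Rightarrow> real) measure" where
  "process_law M X = distr M (PiM UNIV (\<lambda>_. borel)) (\<lambda>\<omega> t. X t \<omega>)"

text \<open>Hoelder continuity on bounded subsets of \<open>S\<close>. The constant cannot be uniform over an unbounded
  \<open>S\<close> (the increments of fractional Brownian motion over intervals of length 1 are unbounded). The
  bounded sets need not be compact subsets of \<open>S\<close>: they may come arbitrarily close to its boundary.\<close>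

definition hoelder_on :: "complex set \<Rightarrow> real \<Rightarrow> (complex \<Rightarrow> real) \<Rightarrow> bool" where
  "hoelder_on S \<beta> h \<longleftrightarrow>
     (\<forall>R. \<exists>K. \<forall>z\<in>S. \<forall>w\<in>S. norm z \<le> R \<and> norm w \<le> R \<longrightarrow> \<bar>h z - h w\<bar> \<le> K * norm (z - w) powr \<beta>)"

definition is_version_on ::
  "'a measure \<Rightarrow> complex set \<Rightarrow> (complex \<Rightarrow> 'a \<Rightarrow> real) \<Rightarrow> (complex \<Rightarrow> 'a \<Rightarrow> real) \<Rightarrow> bool" where
  "is_version_on M S Y X \<longleftrightarrow>
     (\<forall>z\<in>S. Y z \<in> borel_measurable M \<and> (AE \<omega> in M. Y z \<omega> = X z \<omega>))"

end

theory Submission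
  imports Defs
begin

text \<open>The real part of \<open>\<Gamma>\<^sup>+\<close> is a centered Gaussian process with an explicit covariance, and every claim is read
off from that covariance. Write \<open>P(u, v) = -(-i(u - cnj v))\<^sup>2\<^sup>\<alpha> / (4 cos \<pi>\<alpha>)\<close>, the function
\<open>kernel_primitive\<close>. By the binomial series \<open>\<Sum>\<^sub>k f\<^sub>k(u) cnj (f\<^sub>k(v))\<close> is the mixed derivative of \<open>P\<close> in \<open>u\<close> and
\<open>cnj v\<close> (\<open>f_coeff_kernel\<close>). On compact subsets of the half-plane the \<open>f\<^sub>k\<close> decay geometrically, so the series
may be integrated term by term in both variables: the sums \<open>\<Sum>\<^sub>k g\<^sub>k(w, z) cnj (g\<^sub>k(w', z'))\<close> of the increments
\<open>g\<^sub>k(w, z) = \<integral>\<^sub>w\<^sup>z f\<^sub>k\<close> are second differences of \<open>P\<close> (\<open>f_increment_kernel\<close>). The function \<open>P\<close>, unlike the kernel,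
is continuous up to the boundary, and on the real line its real part is \<open>-|t - s|\<^sup>2\<^sup>\<alpha> / 4\<close>; this is where the
covariance of fractional Brownian motion comes from.

The randomness enters through characteristic functions. A real linear combination of increments of
\<open>2 Re \<Gamma>\<^sup>+\<close> inside the half-plane is almost surely the sum of a series of independent Gaussian variables.
Centered Gaussian laws with convergent variances are stable under almost sure and \<open>L\<^sup>1\<close> limits, so the
combination is Gaussian, and it remains so when the end points of the increments move to the boundary
(\<open>Gamma_combination_centered_gaussian\<close>). Equality of laws follows since characteristic functions determine
the law of a process (\<open>process_law_eqI\<close>).

For the regularity, the variance of \<open>2 Re (\<Gamma>\<^sub>z - \<Gamma>\<^sub>w)\<close> is a second difference of \<open>P\<close> and hence at most
\<open>C |z - w|\<^sup>2\<^sup>\<alpha>\<close> (\<open>kernel_primitive_increment_bound\<close>). All even moments of a Gaussian variable are controlled by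
its variance, so the Kolmogorov-Chentsov criterion (\<open>kolmogorov_chentsov_plane\<close>) gives a version that is
Hoelder continuous up to the boundary. Inside the half-plane the process is itself almost surely
continuous and therefore coincides there with this version, which yields the limit at a boundary point.\<close>

section \<open>Powers on the right half-plane and the primitive of the kernel\<close>

text \<open>If \<open>u\<close> is at distance of the order of \<open>|u - v|\<close> from the origin, both powers are already small enough. Otherwise
the segment from \<open>u\<close> to \<open>v\<close> stays away from the origin, and the bound \<open>q (|u| / 2)\<^sup>q\<^sup>-\<^sup>1\<close> for the derivative on it
is at most \<open>|u - v|\<^sup>q\<^sup>-\<^sup>1\<close>, because the exponent is nonpositive.\<close>

lemma powr_right_half_plane_hoelder:
  fixes u v :: complex and q :: real
  assumes q: "0 < q" "q \<le> 1" and u: "Re u > 0" and v: "Re v > 0"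
  shows "norm (u powr of_real q - v powr of_real q) \<le> 5 * norm (u - v) powr q"
proof (cases "norm u \<le> 2 * norm (u - v)")
  case True
  have nv: "norm v \<le> 3 * norm (u - v)"
    using True norm_triangle_ineq2[of v u] by (simp add: norm_minus_commute)
  have pw: "c powr q \<le> c" if "c \<ge> 1" for c :: real
    using powr_mono[of q 1 c] that q by simp
  have "norm (u powr of_real q - v powr of_real q) \<le> norm u powr q + norm v powr q"
    by (rule order_trans[OF norm_triangle_ineq4]) (simp add: norm_powr_real_powr')
  also have "\<dots> \<le> (2 * norm (u - v)) powr q + (3 * norm (u - v)) powr q"
    using True nv q by (intro add_mono powr_mono2) auto
  also have "\<dots> = (2 powr q + 3 powr q) * norm (u - v) powr q"
    by (simp add: powr_mult algebra_simps)
  also have "\<dots> \<le> 5 * norm (u - v) powr q"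
    using pw[of 2] pw[of 3] by (intro mult_right_mono) auto
  finally show ?thesis .
next
  case False
  then have far: "norm u > 2 * norm (u - v)" by simp
  show ?thesis
  proof (cases "u = v")
    case ne: False
    let ?B = "q * (norm u / 2) powr (q - 1)"
    have seg: "Re x > 0 \<and> norm x \<ge> norm u / 2" if "x \<in> closed_segment u v" for x
    proof
      have "convex {z. Re z > 0}" by (rule convex_halfspace_Re_gt)
      then have "closed_segment u v \<subseteq> {z. Re z > 0}"
        using u v by (intro closed_segment_subset) auto
      then show "Re x > 0" using that by auto
      have "norm (x - u) \<le> norm (u - v)"
        using segment_bound1[OF that] by (simp add: norm_minus_commute)
      then show "norm x \<ge> norm u / 2"
        using far norm_triangle_ineq2[of u x] by (simp add: norm_minus_commute)
    qed
    have "norm (u powr of_real q - v powr of_real q) \<le> ?B * norm (u - v)"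
    proof (rule field_differentiable_bound[where S = "closed_segment u v"
          and f' = "\<lambda>x. of_real q * x powr (of_real q - 1)"])
      fix x assume x: "x \<in> closed_segment u v"
      from seg[OF x] have "x \<notin> \<real>\<^sub>\<le>\<^sub>0" by (auto simp: complex_nonpos_Reals_iff)
      then show "((\<lambda>x. x powr of_real q) has_field_derivative of_real q * x powr (of_real q - 1))
          (at x within closed_segment u v)"
        by (rule has_field_derivative_at_within[OF has_field_derivative_powr])
      have "norm (x powr (of_real q - 1)) = norm x powr (q - 1)"
        by (subst norm_powr_real_powr') auto
      also have "\<dots> \<le> (norm u / 2) powr (q - 1)"
        using seg[OF x] u q by (intro powr_mono2') auto
      finally show "norm (of_real q * x powr (of_real q - 1)) \<le> ?B"
        using q by (simp add: norm_mult mult_left_mono)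
    qed auto
    also have "\<dots> \<le> norm (u - v) powr (q - 1) * norm (u - v)"
    proof (intro mult_right_mono)
      have "(norm u / 2) powr (q - 1) \<le> norm (u - v) powr (q - 1)"
        using far ne q by (intro powr_mono2') auto
      then show "?B \<le> norm (u - v) powr (q - 1)"
        using q mult_mono[of q 1 "(norm u / 2) powr (q - 1)" "norm (u - v) powr (q - 1)"] by simp
    qed auto
    also have "\<dots> = norm (u - v) powr q"
      using ne powr_add[of "norm (u - v)" "q - 1" 1] by simp
    finally show ?thesis by (smt (verit) powr_ge_zero)
  qed auto
qed

text \<open>For \<open>p \<le> 1\<close> this is twice the Hoelder estimate. For \<open>p > 1\<close> a first difference does not suffice, but the
derivative of \<open>x \<mapsto> (x + a)\<^sup>p - x\<^sup>p\<close> is a first difference of the power \<open>p - 1 < 1\<close>, to which the Hoelder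
estimate applies.\<close>

lemma powr_right_half_plane_second_difference:
  fixes u a b :: complex and p h :: real
  assumes p: "0 < p" "p < 2" and h: "norm a = h" "norm b = h"
    and pos: "Re u > 0" "Re (u + a) > 0" "Re (u + b) > 0" "Re (u + a + b) > 0"
  shows "norm ((u + a + b) powr of_real p - (u + a) powr of_real p
               - (u + b) powr of_real p + u powr of_real p) \<le> 10 * h powr p"
proof (cases "p \<le> 1")
  case True
  have "norm ((u + a + b) powr of_real p - (u + a) powr of_real p) \<le> 5 * h powr p"
    using powr_right_half_plane_hoelder[OF p(1) True, of "u + a + b" "u + a"] pos h by simp
  moreover have "norm ((u + b) powr of_real p - u powr of_real p) \<le> 5 * h powr p"
    using powr_right_half_plane_hoelder[OF p(1) True, of "u + b" u] pos h by simp
  ultimately show ?thesis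
    using norm_triangle_ineq4[of "(u + a + b) powr of_real p - (u + a) powr of_real p"
        "(u + b) powr of_real p - u powr of_real p"]
    by (simp add: algebra_simps)
next
  case False
  have h0: "h \<ge> 0" using h by auto
  let ?S = "{x. Re x > 0} \<inter> {x. Re x > - Re a}"
  have cS: "convex ?S" by (intro convex_Int convex_halfspace_Re_gt)
  let ?f = "\<lambda>x. (x + a) powr of_real p - x powr of_real p"
  have "norm (?f (u + b) - ?f u) \<le> (p * (5 * h powr (p - 1))) * norm (u + b - u)"
  proof (rule field_differentiable_bound[OF cS, where
        f' = "\<lambda>x. of_real p * (x + a) powr (of_real p - 1) - of_real p * x powr (of_real p - 1)"])
    fix x assume x: "x \<in> ?S"
    then have nr: "x \<notin> \<real>\<^sub>\<le>\<^sub>0" "x + a \<notin> \<real>\<^sub>\<le>\<^sub>0" by (auto simp: complex_nonpos_Reals_iff)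
    show "(?f has_field_derivative of_real p * (x + a) powr (of_real p - 1)
          - of_real p * x powr (of_real p - 1)) (at x within ?S)"
      using nr by (auto intro!: derivative_eq_intros)
    have "norm ((x + a) powr of_real (p - 1) - x powr of_real (p - 1)) \<le> 5 * h powr (p - 1)"
      using powr_right_half_plane_hoelder[of "p - 1" "x + a" x] p False x h by auto
    then have "p * norm ((x + a) powr of_real (p - 1) - x powr of_real (p - 1))
        \<le> p * (5 * h powr (p - 1))"
      using p by (intro mult_left_mono) auto
    then show "norm (of_real p * (x + a) powr (of_real p - 1) - of_real p * x powr (of_real p - 1))
        \<le> p * (5 * h powr (p - 1))"
      using p by (simp add: norm_mult flip: right_diff_distrib)
  qed (use pos in auto)
  also have "\<dots> = p * 5 * h powr p"
    using h h0 powr_add[of h "p - 1" 1] False by (cases "h = 0") auto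
  also have "\<dots> \<le> 10 * h powr p" using p by (intro mult_right_mono) auto
  finally show ?thesis by (simp add: algebra_simps)
qed

lemma continuous_on_powr_closed_right_half_plane:
  fixes p :: real
  assumes "0 < p"
  shows "continuous_on {z. Re z \<ge> 0} (\<lambda>z. z powr complex_of_real p)"
  unfolding continuous_on_eq_continuous_within
proof -
  show "\<forall>x\<in>{z. Re z \<ge> 0}. continuous (at x within {z. Re z \<ge> 0}) (\<lambda>z. z powr complex_of_real p)"
  proof
    fix x assume x: "x \<in> {z. Re z \<ge> 0}"
    show "continuous (at x within {z. Re z \<ge> 0}) (\<lambda>z. z powr complex_of_real p)"
    proof (cases "x = 0")
      case True
      have "((\<lambda>z::complex. norm z powr p) \<longlongrightarrow> 0) (at 0 within {z. Re z \<ge> 0})"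
        using assms by (intro tendsto_zero_powrI[OF _ tendsto_const]) (auto intro!: tendsto_norm_zero)
      then have "((\<lambda>z. norm (z powr complex_of_real p)) \<longlongrightarrow> 0) (at 0 within {z. Re z \<ge> 0})"
        by (simp add: norm_powr_real_powr')
      then show ?thesis
        using True by (simp add: continuous_within tendsto_norm_zero_iff)
    next
      case False
      then have "x \<notin> \<real>\<^sub>\<le>\<^sub>0"
        using x by (auto simp: complex_nonpos_Reals_iff complex_eq_iff)
      then have "isCont (\<lambda>z. z powr complex_of_real p) x"
        by (rule DERIV_isCont[OF has_field_derivative_powr])
      then show ?thesis by (rule continuous_at_imp_continuous_at_within)
    qed
  qed
qed

lemma closure_uhp: "closure uhp = {z. Im z \<ge> 0}"
  using closure_halfspace_gt[of "\<i>" 0] by (simp add: uhp_def inner_complex_def)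

lemma open_uhp: "open uhp" and convex_uhp: "convex uhp"
  unfolding uhp_def by (rule open_halfspace_Im_gt convex_halfspace_Im_gt)+

text \<open>The division by \<open>cos (pi * \<alpha>)\<close> gives 0 for \<open>\<alpha> = 1/2\<close>, in agreement with the constant of \<^const>\<open>f_coeff\<close>, which
then vanishes too.\<close>

definition kernel_primitive :: "real \<Rightarrow> complex \<Rightarrow> complex \<Rightarrow> complex" where
  "kernel_primitive \<alpha> u v =
     of_real (- 1 / (4 * cos (pi * \<alpha>))) * (- \<i> * (u - cnj v)) powr of_real (2 * \<alpha>)"

lemma continuous_on_kernel_primitive:
  assumes "0 < \<alpha>"
  shows "continuous_on (closure uhp \<times> closure uhp) (\<lambda>(u, v). kernel_primitive \<alpha> u v)"
  unfolding kernel_primitive_def case_prod_unfold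
  by (intro continuous_intros
      continuous_on_compose2[OF continuous_on_powr_closed_right_half_plane[of "2 * \<alpha>"]])
    (use assms in \<open>auto simp: closure_uhp\<close>)

lemma tendsto_kernel_primitive:
  assumes "0 < \<alpha>" "(f \<longlongrightarrow> u) F" "(g \<longlongrightarrow> v) F" "u \<in> closure uhp" "v \<in> closure uhp"
    "\<forall>\<^sub>F x in F. f x \<in> uhp" "\<forall>\<^sub>F x in F. g x \<in> uhp"
  shows "((\<lambda>x. kernel_primitive \<alpha> (f x) (g x)) \<longlongrightarrow> kernel_primitive \<alpha> u v) F"
proof -
  have "((\<lambda>x. (f x, g x)) \<longlongrightarrow> (u, v)) F" by (intro tendsto_intros assms)
  moreover have "\<forall>\<^sub>F x in F. (f x, g x) \<in> closure uhp \<times> closure uhp"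
    using assms(6,7) by eventually_elim (use closure_subset in auto)
  ultimately show ?thesis
    using continuous_on_tendsto_compose[OF continuous_on_kernel_primitive[OF assms(1)]] assms(4,5)
    by fastforce
qed

text \<open>The four arguments \<open>-i(z - cnj w)\<close>, \<open>-i(z - cnj z)\<close>, \<open>-i(w - cnj w)\<close>, \<open>-i(w - cnj z)\<close> are the vertices of a
parallelogram in the right half-plane whose sides have length \<open>|z - w|\<close>. The estimate is proved in the open
half-plane and carried to the closure by shifting both points upwards by \<open>1 / (n + 1)\<close>.\<close>

lemma kernel_primitive_increment_bound:
  assumes \<alpha>: "0 < \<alpha>" "\<alpha> < 1" and z: "z \<in> closure uhp" and w: "w \<in> closure uhp"
  shows "norm (kernel_primitive \<alpha> z z + kernel_primitive \<alpha> w w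
               - kernel_primitive \<alpha> z w - kernel_primitive \<alpha> w z)
         \<le> 10 / (4 * \<bar>cos (pi * \<alpha>)\<bar>) * norm (z - w) powr (2 * \<alpha>)"
proof -
  let ?P = "kernel_primitive \<alpha>"
  have interior: "norm (?P z z + ?P w w - ?P z w - ?P w z)
      \<le> 10 / (4 * \<bar>cos (pi * \<alpha>)\<bar>) * norm (z - w) powr (2 * \<alpha>)"
    if zw: "z \<in> uhp" "w \<in> uhp" for z w
  proof -
    let ?p = "complex_of_real (2 * \<alpha>)" and ?u = "- \<i> * (z - cnj w)"
    let ?a = "- \<i> * (cnj w - cnj z)" and ?b = "- \<i> * (w - z)"
    let ?E = "(?u + ?a + ?b) powr ?p - (?u + ?a) powr ?p - (?u + ?b) powr ?p + ?u powr ?p"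
    have E: "norm ?E \<le> 10 * norm (z - w) powr (2 * \<alpha>)"
    proof (rule powr_right_half_plane_second_difference)
      show "norm ?a = norm (z - w)"
        by (metis complex_cnj_diff complex_mod_cnj norm_ii norm_minus_cancel norm_minus_commute
            norm_mult mult_1)
    qed (use \<alpha> zw in \<open>auto simp: uhp_def norm_mult norm_minus_commute\<close>)
    have s: "?u + ?a = - \<i> * (z - cnj z)" "?u + ?b = - \<i> * (w - cnj w)"
      "?u + ?a + ?b = - \<i> * (w - cnj z)" by (simp_all add: algebra_simps)
    have "?P z z + ?P w w - ?P z w - ?P w z = of_real (1 / (4 * cos (pi * \<alpha>))) * ?E"
      unfolding s kernel_primitive_def by (simp add: algebra_simps)
    then have "norm (?P z z + ?P w w - ?P z w - ?P w z) = 1 / (4 * \<bar>cos (pi * \<alpha>)\<bar>) * norm ?E"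
      by (simp add: norm_mult norm_divide)
    also have "\<dots> \<le> 1 / (4 * \<bar>cos (pi * \<alpha>)\<bar>) * (10 * norm (z - w) powr (2 * \<alpha>))"
      using E by (intro mult_left_mono) auto
    finally show ?thesis by simp
  qed
  let ?s = "\<lambda>n. \<i> * complex_of_real (1 / real (Suc n))"
  have lim: "(\<lambda>n. x + ?s n) \<longlonglongrightarrow> x" for x
    using tendsto_add[OF tendsto_const[of x] tendsto_mult[OF tendsto_const[of "\<i>"]
          tendsto_of_real[OF LIMSEQ_inverse_real_of_nat]]]
    by (simp add: divide_inverse)
  have up: "\<forall>\<^sub>F n in sequentially. x + ?s n \<in> uhp" if "x \<in> closure uhp" for x
    using that by (intro always_eventually) (simp add: closure_uhp, simp add: uhp_def add_nonneg_pos)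
  note T = tendsto_kernel_primitive[OF \<alpha>(1) lim lim _ _ up up]
  have "(\<lambda>n. norm (?P (z + ?s n) (z + ?s n) + ?P (w + ?s n) (w + ?s n) - ?P (z + ?s n) (w + ?s n)
        - ?P (w + ?s n) (z + ?s n))) \<longlonglongrightarrow> norm (?P z z + ?P w w - ?P z w - ?P w z)"
    using z w by (intro tendsto_intros T)
  then show ?thesis
  proof (rule tendsto_upperbound)
    show "\<forall>\<^sub>F n in sequentially. norm (?P (z + ?s n) (z + ?s n) + ?P (w + ?s n) (w + ?s n)
        - ?P (z + ?s n) (w + ?s n) - ?P (w + ?s n) (z + ?s n))
        \<le> 10 / (4 * \<bar>cos (pi * \<alpha>)\<bar>) * norm (z - w) powr (2 * \<alpha>)"
      using up[OF z] up[OF w]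
    proof eventually_elim
      case (elim n)
      then show ?case using interior[OF elim] by simp
    qed
  qed simp
qed

section \<open>The kernel as a binomial series\<close>

text \<open>The three arguments add up to less than \<open>3\<pi>/2\<close> in absolute value and the argument of the product is less than
\<open>\<pi>/2\<close>, so the two logarithms cannot differ by a nonzero multiple of \<open>2\<pi>i\<close>.\<close>

lemma powr_mult_right_half_plane:
  fixes a b c p :: complex
  assumes pos: "Re a > 0" "Re b > 0" "Re c > 0" "Re (a * b * c) > 0"
  shows "a powr p * b powr p * c powr p = (a * b * c) powr p"
proof -
  have nz: "a \<noteq> 0" "b \<noteq> 0" "c \<noteq> 0" using pos by auto
  let ?L = "Ln a + Ln b + Ln c"
  have "exp ?L = exp (Ln (a * b * c))" using nz by (simp add: exp_add)
  then obtain n :: int where n: "?L = Ln (a * b * c) + (of_int (2 * n) * pi) * \<i>"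
    unfolding exp_eq by blast
  have "\<bar>Im (Ln a)\<bar> < pi / 2" "\<bar>Im (Ln b)\<bar> < pi / 2" "\<bar>Im (Ln c)\<bar> < pi / 2"
    "\<bar>Im (Ln (a * b * c))\<bar> < pi / 2"
    using pos nz Re_Ln_pos_lt by auto
  moreover have "Im (Ln a) + Im (Ln b) + Im (Ln c) = Im (Ln (a * b * c)) + of_int (2 * n) * pi"
    using arg_cong[OF n, of Im] by simp
  ultimately have "\<bar>of_int (2 * n) * pi\<bar> < 2 * pi" by linarith
  then have "\<bar>real_of_int n\<bar> < 1" by (simp add: abs_mult)
  then have "n = 0" by linarith
  then have "?L = Ln (a * b * c)" using n by simp
  then have "exp (p * Ln (a * b * c)) = exp (p * ?L)" by simp
  also have "\<dots> = exp (p * Ln a) * exp (p * Ln b) * exp (p * Ln c)"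
    by (simp add: exp_add distrib_left)
  finally show ?thesis using nz by (simp add: powr_def)
qed

lemma cayley_norm_less_1: "norm ((z - \<i>) / (z + \<i>)) < 1" if "z \<in> uhp"
proof -
  have "(norm (z - \<i>))\<^sup>2 < (norm (z + \<i>))\<^sup>2"
    using that unfolding uhp_def cmod_power2 by (simp add: power2_eq_square algebra_simps)
  then have "norm (z - \<i>) < norm (z + \<i>)" by (rule power_less_imp_less_base) simp
  then show ?thesis by (simp add: norm_divide divide_less_eq_1)
qed

lemma kernel_constant_nonneg:
  assumes "0 < \<alpha>" "\<alpha> < 1"
  shows "\<alpha> * (1 - 2 * \<alpha>) / (2 * cos (pi * \<alpha>)) \<ge> 0"
proof (cases "\<alpha> \<le> 1/2")
  case True
  then have "cos (pi * \<alpha>) \<ge> 0"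
    using assms mult_left_mono[of \<alpha> "1/2" pi] mult_nonneg_nonneg[of pi \<alpha>]
    by (intro cos_ge_zero) (use pi_ge_zero in linarith)+
  then show ?thesis using True assms by simp
next
  case False
  have "pi * (1 - \<alpha>) \<le> pi * (1/2)" "0 \<le> pi * (1 - \<alpha>)"
    using False assms by (intro mult_left_mono mult_nonneg_nonneg; simp)+
  then have "cos (pi * (1 - \<alpha>)) \<ge> 0" by (intro cos_ge_zero) (use pi_ge_zero in linarith)+
  moreover have "cos (pi * (1 - \<alpha>)) = - cos (pi * \<alpha>)" by (simp add: right_diff_distrib cos_diff)
  ultimately show ?thesis
    using False assms by (intro divide_nonpos_nonpos mult_nonneg_nonpos) auto
qed

lemma f_coeff_holomorphic: "f_coeff \<alpha> k holomorphic_on uhp"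
proof -
  have "(z + \<i>) / (2 * \<i>) \<notin> \<real>\<^sub>\<le>\<^sub>0" if "z \<in> uhp" for z
    using that by (auto simp: uhp_def complex_nonpos_Reals_iff Re_divide field_simps)
  moreover have "z + \<i> \<noteq> 0" if "z \<in> uhp" for z
    using that by (auto simp: uhp_def complex_eq_iff)
  ultimately show ?thesis unfolding f_coeff_def by (intro holomorphic_intros) auto
qed

lemma pochhammer_div_fact_le:
  fixes x :: real
  assumes "0 \<le> x" "x \<le> 2"
  shows "0 \<le> pochhammer x k / fact k" "pochhammer x k / fact k \<le> real (k + 1)"
proof -
  have "0 \<le> pochhammer x k \<and> pochhammer x k \<le> fact (Suc k)"
  proof (induction k)
    case (Suc k)
    then show ?case
      using assms mult_mono[of "pochhammer x k" "fact (Suc k)" "x + real k" "2 + real k"]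
      by (auto simp: pochhammer_Suc algebra_simps)
  qed simp
  then show "0 \<le> pochhammer x k / fact k" "pochhammer x k / fact k \<le> real (k + 1)"
    by (auto simp: divide_le_eq)
qed

text \<open>The Cayley transform maps a compact set of the half-plane into a disc of radius \<open>s < 1\<close>. The factor
\<open>sqrt ((2 - 2\<alpha>)\<^sub>k / k!)\<close> grows at most linearly, which is absorbed by enlarging \<open>s\<close> to \<open>r = (s + 1) / 2\<close>.\<close>

lemma f_coeff_geometric_bound:
  assumes \<alpha>: "0 < \<alpha>" "\<alpha> < 1" and C: "compact C" "C \<subseteq> uhp"
  obtains B r where "0 \<le> B" "0 < r" "r < 1"
    "\<And>k z. z \<in> C \<Longrightarrow> norm (f_coeff \<alpha> k z) \<le> B * r ^ k"
proof -
  let ?c = "2 powr (\<alpha> - 1) * sqrt (\<alpha> * (1 - 2 * \<alpha>) / (2 * cos (pi * \<alpha>)))"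
  let ?A = "\<lambda>z. ((z + \<i>) / (2 * \<i>)) powr complex_of_real (2 * \<alpha> - 2)"
  let ?q = "\<lambda>z. norm ((z - \<i>) / (z + \<i>))"
  have nz: "z + \<i> \<noteq> 0" if "z \<in> C" for z
    using that C by (auto simp: uhp_def complex_eq_iff)
  have "(z + \<i>) / (2 * \<i>) \<notin> \<real>\<^sub>\<le>\<^sub>0" if "z \<in> C" for z
    using that C by (auto simp: uhp_def complex_nonpos_Reals_iff Re_divide field_simps)
  then have "?A holomorphic_on C" by (intro holomorphic_intros) auto
  then have "bounded (?A ` C)"
    using C by (intro compact_imp_bounded compact_continuous_image holomorphic_on_imp_continuous_on)
  then obtain A where A: "A > 0" "\<And>z. z \<in> C \<Longrightarrow> norm (?A z) \<le> A"
    unfolding bounded_pos by blast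
  obtain s where s: "0 < s" "s < 1" "\<And>z. z \<in> C \<Longrightarrow> ?q z \<le> s"
  proof (cases "C = {}")
    case False
    have "continuous_on C ?q" using nz by (intro continuous_intros) auto
    then obtain x where "x \<in> C" "\<And>z. z \<in> C \<Longrightarrow> ?q z \<le> ?q x"
      using continuous_attains_sup[OF C(1) False] by blast
    with cayley_norm_less_1[of x] C show ?thesis
      by (intro that[of "max (1/2) (?q x)"]) (auto intro: max.coboundedI2)
  qed (use that[of "1/2"] in auto)
  define r where "r = (s + 1) / 2"
  have r: "0 < r" "r < 1" "s / r < 1" "0 < s / r" using s by (auto simp: r_def)
  have "(\<lambda>k. real k * (s / r) ^ k + (s / r) ^ k) \<longlonglongrightarrow> 0 + 0"
    using r by (intro tendsto_add powser_times_n_limit_0[where 'a=real, simplified] LIMSEQ_realpow_zero) (use s in auto)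
  then have "Bseq (\<lambda>k. real k * (s / r) ^ k + (s / r) ^ k)"
    by (intro convergent_imp_Bseq) (auto simp: convergent_def)
  then obtain D where D: "D > 0" "\<And>k. \<bar>real k * (s / r) ^ k + (s / r) ^ k\<bar> \<le> D"
    by (auto elim: BseqE)
  have D': "real (k + 1) * s ^ k \<le> D * r ^ k" for k
  proof -
    have "real (k + 1) * (s / r) ^ k \<le> D" using D(2)[of k] by (simp add: algebra_simps)
    then have "real (k + 1) * (s / r) ^ k * r ^ k \<le> D * r ^ k"
      using r by (intro mult_right_mono) auto
    then show ?thesis using r by (simp add: power_divide)
  qed
  have "norm (f_coeff \<alpha> k z) \<le> (\<bar>?c\<bar> * A * D) * r ^ k" if z: "z \<in> C" for k z
  proof -
    let ?s = "sqrt (pochhammer (2 - 2 * \<alpha>) k / fact k)"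
    have P: "0 \<le> pochhammer (2 - 2 * \<alpha>) k / fact k"
      "pochhammer (2 - 2 * \<alpha>) k / fact k \<le> real (k + 1)"
      using pochhammer_div_fact_le[of "2 - 2 * \<alpha>" k] \<alpha> by auto
    have "real (k + 1) \<le> (real (k + 1))\<^sup>2" by (rule self_le_power) auto
    then have S: "0 \<le> ?s" "?s \<le> real (k + 1)"
      using P by (auto intro!: real_le_lsqrt)
    have "norm (f_coeff \<alpha> k z) = \<bar>?c\<bar> * ?s * norm (?A z) * ?q z ^ k"
      using P(1) unfolding f_coeff_def norm_mult norm_power norm_of_real abs_mult by simp
    also have "\<dots> \<le> \<bar>?c\<bar> * real (k + 1) * A * s ^ k"
      using S A(1) A(2)[OF z] s(3)[OF z] by (intro mult_mono power_mono) auto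
    also have "\<dots> = (\<bar>?c\<bar> * A) * (real (k + 1) * s ^ k)" by simp
    also have "\<dots> \<le> (\<bar>?c\<bar> * A) * (D * r ^ k)"
      using D' A(1) by (intro mult_left_mono) auto
    finally show ?thesis by simp
  qed
  with r A D show ?thesis by (intro that[of "\<bar>?c\<bar> * A * D" r]) auto
qed

text \<open>With \<open>a = (z + i) / 2i\<close>, \<open>b = cnj ((w + i) / 2i)\<close> and \<open>\<zeta>\<close> the product of the Cayley transforms of \<open>z\<close> and \<open>cnj w\<close>, the
binomial series gives \<open>a\<^sup>p b\<^sup>p (1 - \<zeta>)\<^sup>p\<close> for \<open>p = 2\<alpha> - 2\<close>. The three factors have positive real part and
product \<open>-i(z - cnj w) / 2\<close>, so the powers may be multiplied; the factors \<open>2\<^sup>\<alpha>\<^sup>-\<^sup>1\<close> in \<^const>\<open>f_coeff\<close> cancel the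
power of \<open>1/2\<close>.\<close>

lemma f_coeff_kernel:
  assumes \<alpha>: "0 < \<alpha>" "\<alpha> < 1" and z: "z \<in> uhp" and w: "w \<in> uhp"
  shows "(\<lambda>k. f_coeff \<alpha> k z * cnj (f_coeff \<alpha> k w)) sums
    (of_real (\<alpha> * (1 - 2 * \<alpha>) / (2 * cos (pi * \<alpha>))) * (- \<i> * (z - cnj w)) powr of_real (2 * \<alpha> - 2))"
proof -
  let ?c = "\<alpha> * (1 - 2 * \<alpha>) / (2 * cos (pi * \<alpha>))"
  let ?p = "complex_of_real (2 * \<alpha> - 2)"
  define a where "a = (z + \<i>) / (2 * \<i>)"
  define b where "b = cnj ((w + \<i>) / (2 * \<i>))"
  define \<zeta> where "\<zeta> = (z - \<i>) / (z + \<i>) * cnj ((w - \<i>) / (w + \<i>))"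
  define po where "po k = pochhammer (2 - 2 * \<alpha>) k / fact k" for k
  have nz: "z + \<i> \<noteq> 0" "cnj w - \<i> \<noteq> 0" "w + \<i> \<noteq> 0"
    using z w by (auto simp: uhp_def complex_eq_iff)
  have n1: "norm \<zeta> < 1"
    using mult_strict_mono'[OF cayley_norm_less_1[OF z] cayley_norm_less_1[OF w]]
    unfolding \<zeta>_def norm_mult complex_mod_cnj by simp
  have "(\<lambda>k. (?p gchoose k) * (- \<zeta>) ^ k) sums (1 + (- \<zeta>)) powr ?p"
    using n1 by (intro gen_binomial_complex) simp
  moreover have "(?p gchoose k) * (- \<zeta>) ^ k = of_real (po k) * \<zeta> ^ k" for k
  proof -
    have "- ?p = complex_of_real (2 - 2 * \<alpha>)" by simp
    then show ?thesis
      unfolding gbinomial_pochhammer po_def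
      by (simp only: pochhammer_of_real) (simp add: power_minus[of \<zeta>])
  qed
  ultimately have bin: "(\<lambda>k. of_real (po k) * \<zeta> ^ k) sums (1 - \<zeta>) powr ?p" by simp
  have Re: "Re a > 0" "Re b > 0" "Re (1 - \<zeta>) > 0"
    using z w n1 abs_Re_le_cmod[of \<zeta>]
    by (auto simp: a_def b_def uhp_def Re_divide power2_eq_square)
  have ab: "a * b * (1 - \<zeta>) = - \<i> * (z - cnj w) / 2"
  proof -
    define D where "D = (z + \<i>) * (cnj w - \<i>)"
    have D: "D \<noteq> 0" using nz by (simp add: D_def)
    have "1 - \<zeta> = (D - (z - \<i>) * (cnj w + \<i>)) / D"
      using D by (simp add: \<zeta>_def D_def diff_divide_distrib[of "(z + \<i>) * (cnj w - \<i>)"])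
    moreover have "D - (z - \<i>) * (cnj w + \<i>) = - \<i> * (z - cnj w) * 2"
      by (simp add: D_def algebra_simps)
    moreover have "a * b = D / 4" by (simp add: a_def b_def D_def, simp add: algebra_simps)
    ultimately have "a * b * (1 - \<zeta>) = D / 4 * (- \<i> * (z - cnj w) * 2 / D)"
      by (simp only:)
    also have "\<dots> = - \<i> * (z - cnj w) / 2" using D by (simp add: field_simps)
    finally show ?thesis .
  qed
  have "a powr ?p * b powr ?p * (1 - \<zeta>) powr ?p = (a * b * (1 - \<zeta>)) powr ?p"
  proof (rule powr_mult_right_half_plane[OF Re])
    show "Re (a * b * (1 - \<zeta>)) > 0" using z w unfolding ab by (simp add: uhp_def)
  qed
  also have "\<dots> = (of_real (1/2) * (- \<i> * (z - cnj w))) powr ?p" unfolding ab by simp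
  also have "\<dots> = of_real (1/2) powr ?p * (- \<i> * (z - cnj w)) powr ?p"
    using z w by (intro powr_times_real_left) (auto simp: uhp_def)
  also have "complex_of_real (1/2) powr ?p = of_real ((1/2) powr (2 * \<alpha> - 2))"
    by (subst powr_of_real) auto
  also have "(1/2::real) powr (2 * \<alpha> - 2) = 1 / (2 powr (\<alpha> - 1))\<^sup>2"
    by (simp add: powr_divide power2_eq_square flip: powr_add)
  finally have prod: "a powr ?p * b powr ?p * (1 - \<zeta>) powr ?p
      = of_real (1 / (2 powr (\<alpha> - 1))\<^sup>2) * (- \<i> * (z - cnj w)) powr ?p" .
  have summand: "f_coeff \<alpha> k z * cnj (f_coeff \<alpha> k w)
      = of_real ((2 powr (\<alpha> - 1))\<^sup>2 * ?c) * (a powr ?p * b powr ?p) * (of_real (po k) * \<zeta> ^ k)" for k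
  proof -
    have c: "cnj (((w + \<i>) / (2 * \<i>)) powr ?p) = b powr ?p"
      unfolding b_def using w by (subst cnj_powr) (auto simp: uhp_def Re_divide)
    let ?C = "2 powr (\<alpha> - 1) * sqrt ?c * sqrt (po k)"
    have "?C * ?C = (2 powr (\<alpha> - 1))\<^sup>2 * (sqrt ?c * sqrt ?c) * (sqrt (po k) * sqrt (po k))"
      by (simp only: power2_eq_square mult_ac)
    also have "sqrt ?c * sqrt ?c = ?c" by (simp only: real_sqrt_mult_self abs_of_nonneg[OF kernel_constant_nonneg[OF \<alpha>]])
    also have "sqrt (po k) * sqrt (po k) = po k"
      using pochhammer_div_fact_le(1)[of "2 - 2 * \<alpha>" k] \<alpha>
      by (simp only: real_sqrt_mult_self po_def abs_of_nonneg)
    finally have C: "complex_of_real ?C * complex_of_real ?C = of_real ((2 powr (\<alpha> - 1))\<^sup>2 * ?c * po k)"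
      by (metis of_real_mult)
    have "f_coeff \<alpha> k z = of_real ?C * a powr ?p * ((z - \<i>) / (z + \<i>)) ^ k"
      by (simp only: f_coeff_def a_def po_def)
    moreover have "cnj (f_coeff \<alpha> k w) = of_real ?C * b powr ?p * cnj ((w - \<i>) / (w + \<i>)) ^ k"
      by (simp only: f_coeff_def po_def complex_cnj_mult complex_cnj_power complex_cnj_complex_of_real c)
    ultimately have "f_coeff \<alpha> k z * cnj (f_coeff \<alpha> k w)
        = (of_real ?C * of_real ?C) * (a powr ?p * b powr ?p) * \<zeta> ^ k"
      by (simp only: \<zeta>_def power_mult_distrib mult_ac)
    then show ?thesis unfolding C by simp
  qed
  have "(\<lambda>k. f_coeff \<alpha> k z * cnj (f_coeff \<alpha> k w)) sums
      (of_real ((2 powr (\<alpha> - 1))\<^sup>2 * ?c) * (a powr ?p * b powr ?p) * (1 - \<zeta>) powr ?p)"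
    unfolding summand by (intro sums_mult bin)
  also have "of_real ((2 powr (\<alpha> - 1))\<^sup>2 * ?c) * (a powr ?p * b powr ?p) * (1 - \<zeta>) powr ?p
      = of_real ((2 powr (\<alpha> - 1))\<^sup>2 * ?c) * (a powr ?p * b powr ?p * (1 - \<zeta>) powr ?p)" by simp
  also have "\<dots> = of_real ((2 powr (\<alpha> - 1))\<^sup>2 * ?c * (1 / (2 powr (\<alpha> - 1))\<^sup>2)) * (- \<i> * (z - cnj w)) powr ?p"
    unfolding prod by simp
  also have "(2 powr (\<alpha> - 1))\<^sup>2 * ?c * (1 / (2 powr (\<alpha> - 1))\<^sup>2) = ?c" by simp
  finally show ?thesis .
qed

section \<open>Termwise integration along paths\<close>

lemma sums_contour_integral_linepath:
  assumes S: "convex S" "a \<in> S" "b \<in> S"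
    and cont: "\<And>k. continuous_on S (f k)"
    and bound: "\<And>k x. x \<in> closed_segment a b \<Longrightarrow> norm (f k x) \<le> m k" and "summable m"
    and deriv: "\<And>x. x \<in> S \<Longrightarrow> (F has_field_derivative (\<Sum>k. f k x)) (at x within S)"
  shows "(\<lambda>k. contour_integral (linepath a b) (f k)) sums (F b - F a)"
proof -
  have seg: "closed_segment a b \<subseteq> S" using S by (simp add: closed_segment_subset)
  have "uniform_limit (closed_segment a b) (\<lambda>n x. \<Sum>k<n. f k x) (\<lambda>x. \<Sum>k. f k x) sequentially"
    using bound \<open>summable m\<close> by (rule Weierstrass_m_test)
  then obtain J where J: "((\<lambda>x. \<Sum>k. f k x) has_contour_integral J) (linepath a b)"
    "(\<lambda>k. contour_integral (linepath a b) (f k)) sums J"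
    using contour_integral_sums_linepath continuous_on_subset[OF cont seg] by blast
  have "((\<lambda>x. \<Sum>k. f k x) has_contour_integral F b - F a) (linepath a b)"
    using contour_integral_primitive[OF deriv, of "linepath a b"] seg by simp
  with J show ?thesis using has_contour_integral_unique by blast
qed

lemma DERIV_cmult_powr:
  fixes g :: "complex \<Rightarrow> complex"
  assumes "(g has_field_derivative g') (at x within S)" "g x \<notin> \<real>\<^sub>\<le>\<^sub>0"
  shows "((\<lambda>x. c * g x powr s) has_field_derivative c * (s * g x powr (s - 1) * g')) (at x within S)"
  by (rule DERIV_cmult[OF DERIV_chain2[where f = "\<lambda>z. z powr s" and g = g,
          OF has_field_derivative_powr[OF assms(2)] assms(1)]])

definition f_increment :: "real \<Rightarrow> nat \<Rightarrow> complex \<Rightarrow> complex \<Rightarrow> complex" where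
  "f_increment \<alpha> k w z = contour_integral (linepath w z) (f_coeff \<alpha> k)"

lemma f_coeff_contour_integrable:
  assumes "w \<in> uhp" "z \<in> uhp"
  shows "f_coeff \<alpha> k contour_integrable_on linepath w z"
proof (rule contour_integrable_continuous_linepath)
  show "continuous_on (closed_segment w z) (f_coeff \<alpha> k)"
    using assms holomorphic_on_imp_continuous_on[OF f_coeff_holomorphic]
      closed_segment_subset[OF _ _ convex_uhp] continuous_on_subset by metis
qed

lemma f_increment_geometric_bound:
  assumes \<alpha>: "0 < \<alpha>" "\<alpha> < 1" and zw: "w \<in> uhp" "z \<in> uhp"
  obtains B r where "0 \<le> B" "0 < r" "r < 1" "\<And>k. norm (f_increment \<alpha> k w z) \<le> B * r ^ k"
proof -
  have seg: "closed_segment w z \<subseteq> uhp" using zw convex_uhp by (simp add: closed_segment_subset)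
  obtain B r where B: "0 \<le> B" "0 < r" "r < 1"
    "\<And>k u. u \<in> closed_segment w z \<Longrightarrow> norm (f_coeff \<alpha> k u) \<le> B * r ^ k"
    using f_coeff_geometric_bound[OF \<alpha> _ seg] by auto
  have "norm (f_increment \<alpha> k w z) \<le> B * r ^ k * norm (z - w)" for k
    unfolding f_increment_def
    by (intro contour_integral_bound_linepath f_coeff_contour_integrable zw B(4)) (use B in auto)
  with B show ?thesis by (intro that[of "B * norm (z - w)" r]) (auto simp: mult_ac)
qed

text \<open>The kernel is integrated first in the variable \<open>u\<close>, with primitive \<open>Q\<close>, and then, after complex conjugation,
which makes the summands holomorphic in the second variable, in \<open>v\<close>. Both times the geometric bounds
justify the interchange of sum and integral.\<close>

lemma f_increment_kernel:
  assumes \<alpha>: "0 < \<alpha>" "\<alpha> < 1"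
    and zw: "z \<in> uhp" "w \<in> uhp" and zw': "z' \<in> uhp" "w' \<in> uhp"
  shows "(\<lambda>k. f_increment \<alpha> k w z * cnj (f_increment \<alpha> k w' z')) sums
    (kernel_primitive \<alpha> z z' - kernel_primitive \<alpha> z w' - kernel_primitive \<alpha> w z'
      + kernel_primitive \<alpha> w w')"
proof -
  let ?\<kappa> = "- 1 / (4 * cos (pi * \<alpha>))"
  let ?K = "\<lambda>u v. of_real (\<alpha> * (1 - 2 * \<alpha>) / (2 * cos (pi * \<alpha>)))
      * (- \<i> * (u - cnj v)) powr of_real (2 * \<alpha> - 2)"
  define Q where "Q u v = of_real (2 * \<alpha> * ?\<kappa>) * \<i> * (- \<i> * (u - cnj v)) powr of_real (2 * \<alpha> - 1)"
    for u v
  have nr: "- \<i> * (u - cnj v) \<notin> \<real>\<^sub>\<le>\<^sub>0" if "u \<in> uhp" "v \<in> uhp" for u v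
    using that by (auto simp: uhp_def complex_nonpos_Reals_iff)
  have contf: "continuous_on uhp (f_coeff \<alpha> k)" for k
    by (rule holomorphic_on_imp_continuous_on[OF f_coeff_holomorphic])
  have seg: "closed_segment a b \<subseteq> uhp" if "a \<in> uhp" "b \<in> uhp" for a b
    using that convex_uhp by (simp add: closed_segment_subset)
  have first: "(\<lambda>k. f_increment \<alpha> k w z * cnj (f_coeff \<alpha> k v)) sums (Q z v - Q w v)"
    if v: "v \<in> uhp" for v
  proof -
    let ?C = "closed_segment w z \<union> {v}"
    obtain B r where B: "0 \<le> B" "0 < r" "r < 1" "\<And>k u. u \<in> ?C \<Longrightarrow> norm (f_coeff \<alpha> k u) \<le> B * r ^ k"
      using f_coeff_geometric_bound[OF \<alpha>(1,2), of ?C] seg[OF zw(2,1)] v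
      by (metis Un_subset_iff compact_Un compact_segment compact_sing empty_subsetI insert_subset)
    have "(\<lambda>k. contour_integral (linepath w z) (\<lambda>u. f_coeff \<alpha> k u * cnj (f_coeff \<alpha> k v)))
        sums (Q z v - Q w v)"
    proof (rule sums_contour_integral_linepath[OF convex_uhp zw(2,1)])
      show "continuous_on uhp (\<lambda>u. f_coeff \<alpha> k u * cnj (f_coeff \<alpha> k v))" for k
        by (intro continuous_intros contf)
      show "norm (f_coeff \<alpha> k x * cnj (f_coeff \<alpha> k v)) \<le> (B * r ^ k) * (B * r ^ k)"
        if "x \<in> closed_segment w z" for k x
        unfolding norm_mult complex_mod_cnj using B that by (intro mult_mono) auto
      have "(\<lambda>k. (B * r ^ k) * (B * r ^ k)) = (\<lambda>k. (B * B) * (r * r) ^ k)"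
        by (simp add: power_mult_distrib mult_ac)
      moreover have "r * r < 1" using B mult_strict_mono'[of r 1 r 1] by simp
      ultimately show "summable (\<lambda>k. (B * r ^ k) * (B * r ^ k))"
        using B by (auto intro!: summable_mult summable_geometric)
      fix u assume u: "u \<in> uhp"
      have "(\<Sum>k. f_coeff \<alpha> k u * cnj (f_coeff \<alpha> k v)) = ?K u v"
        using f_coeff_kernel[OF \<alpha>(1,2) u v] by (rule sums_unique[symmetric])
      moreover have "((\<lambda>u. Q u v) has_field_derivative
          of_real (2 * \<alpha> * ?\<kappa>) * \<i> * (of_real (2 * \<alpha> - 1) * (- \<i> * (u - cnj v)) powr (of_real (2 * \<alpha> - 1) - 1) * (- \<i>)))
          (at u within uhp)"
        unfolding Q_def
        by (rule DERIV_cmult_powr[where g = "\<lambda>u. - \<i> * (u - cnj v)", OF _ nr[OF u v]]) (auto intro!: derivative_eq_intros)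
      moreover have "of_real (2 * \<alpha> * ?\<kappa>) * \<i> * (of_real (2 * \<alpha> - 1) * (- \<i> * (u - cnj v)) powr (of_real (2 * \<alpha> - 1) - 1) * (- \<i>)) = ?K u v"
      proof -
        have e: "complex_of_real (2 * \<alpha> - 1) - 1 = of_real (2 * \<alpha> - 2)" by simp
        have c: "2 * \<alpha> * ?\<kappa> * (2 * \<alpha> - 1) = \<alpha> * (1 - 2 * \<alpha>) / (2 * cos (pi * \<alpha>))"
          by (cases "cos (pi * \<alpha>) = 0") (simp_all add: field_simps)
        have "of_real a * \<i> * (of_real b * X * (- \<i>)) = of_real (a * b) * X" for a b :: real and X
          by (simp add: algebra_simps)
        from this[of "2 * \<alpha> * ?\<kappa>" "2 * \<alpha> - 1"] show ?thesis unfolding e c .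
      qed
      ultimately show "((\<lambda>u. Q u v) has_field_derivative (\<Sum>k. f_coeff \<alpha> k u * cnj (f_coeff \<alpha> k v)))
          (at u within uhp)"
        by (simp only:)
    qed
    moreover have "contour_integral (linepath w z) (\<lambda>u. f_coeff \<alpha> k u * cnj (f_coeff \<alpha> k v))
        = f_increment \<alpha> k w z * cnj (f_coeff \<alpha> k v)" for k
      unfolding f_increment_def
      by (intro contour_integral_rmul f_coeff_contour_integrable zw)
    ultimately show ?thesis by simp
  qed
  let ?R = "\<lambda>v. cnj (kernel_primitive \<alpha> z v) - cnj (kernel_primitive \<alpha> w v)"
  obtain B r where B: "0 \<le> B" "0 < r" "r < 1"
    "\<And>k u. u \<in> closed_segment w' z' \<Longrightarrow> norm (f_coeff \<alpha> k u) \<le> B * r ^ k"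
    using f_coeff_geometric_bound[OF \<alpha>(1,2) _ seg[OF zw'(2,1)]] by auto
  obtain B' r' where B': "0 \<le> B'" "0 < r'" "r' < 1"
    "\<And>k. norm (f_increment \<alpha> k w z) \<le> B' * r' ^ k"
    using f_increment_geometric_bound[OF \<alpha>(1,2) zw(2,1)] by auto
  have "(\<lambda>k. contour_integral (linepath w' z') (\<lambda>v. cnj (f_increment \<alpha> k w z) * f_coeff \<alpha> k v))
      sums (?R z' - ?R w')"
  proof (rule sums_contour_integral_linepath[OF convex_uhp zw'(2,1)])
    show "continuous_on uhp (\<lambda>v. cnj (f_increment \<alpha> k w z) * f_coeff \<alpha> k v)" for k
      by (intro continuous_intros contf)
    show "norm (cnj (f_increment \<alpha> k w z) * f_coeff \<alpha> k x) \<le> (B' * r' ^ k) * (B * 1 ^ k)"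
      if "x \<in> closed_segment w' z'" for k x
    proof -
      have "B * r ^ k \<le> B * 1 ^ k" using B by (intro mult_left_mono power_mono) auto
      then show ?thesis
        unfolding norm_mult complex_mod_cnj using B(1) B' B(4)[OF that]
        by (intro mult_mono) (auto intro: order_trans)
    qed
    show "summable (\<lambda>k. (B' * r' ^ k) * (B * 1 ^ k))"
      using B' by (auto intro!: summable_mult summable_mult2 summable_geometric)
    fix v assume v: "v \<in> uhp"
    have D: "((\<lambda>v. cnj (kernel_primitive \<alpha> u v)) has_field_derivative cnj (Q u v)) (at v within uhp)"
      if u: "u \<in> uhp" for u
    proof -
      have conj: "cnj ((- \<i> * (u - cnj v)) powr of_real p) = (\<i> * (cnj u - v)) powr of_real p"
        if "v \<in> uhp" for v p
        using u that by (subst cnj_powr) (auto simp: uhp_def)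
      have P: "cnj (kernel_primitive \<alpha> u v) = of_real ?\<kappa> * (\<i> * (cnj u - v)) powr of_real (2 * \<alpha>)"
        if "v \<in> uhp" for v
        unfolding kernel_primitive_def complex_cnj_mult conj[OF that] by simp
      have nr': "\<i> * (cnj u - v) \<notin> \<real>\<^sub>\<le>\<^sub>0"
        using u v by (auto simp: uhp_def complex_nonpos_Reals_iff)
      have "((\<lambda>v. of_real ?\<kappa> * (\<i> * (cnj u - v)) powr of_real (2 * \<alpha>)) has_field_derivative
          of_real ?\<kappa> * (of_real (2 * \<alpha>) * (\<i> * (cnj u - v)) powr (of_real (2 * \<alpha>) - 1) * (- \<i>)))
          (at v within uhp)"
        by (rule DERIV_cmult_powr[where g = "\<lambda>v. \<i> * (cnj u - v)", OF _ nr']) (auto intro!: derivative_eq_intros)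
      also have "of_real ?\<kappa> * (of_real (2 * \<alpha>) * (\<i> * (cnj u - v)) powr (of_real (2 * \<alpha>) - 1) * (- \<i>))
          = cnj (Q u v)"
      proof -
        have e: "complex_of_real (2 * \<alpha>) - 1 = of_real (2 * \<alpha> - 1)" by simp
        show ?thesis
          unfolding Q_def complex_cnj_mult conj[OF v] e by simp
      qed
      finally show ?thesis
        by (rule has_field_derivative_transform_within[OF _ zero_less_one v]) (simp add: P)
    qed
    have "(\<lambda>k. cnj (f_increment \<alpha> k w z * cnj (f_coeff \<alpha> k v))) sums cnj (Q z v - Q w v)"
      using first[OF v] by (simp only: sums_cnj)
    then have "(\<Sum>k. cnj (f_increment \<alpha> k w z) * f_coeff \<alpha> k v) = cnj (Q z v) - cnj (Q w v)"
      by (simp add: sums_iff)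
    then show "(?R has_field_derivative (\<Sum>k. cnj (f_increment \<alpha> k w z) * f_coeff \<alpha> k v)) (at v within uhp)"
      using D[OF zw(1)] D[OF zw(2)] by (auto intro: DERIV_diff)
  qed
  moreover have "contour_integral (linepath w' z') (\<lambda>v. cnj (f_increment \<alpha> k w z) * f_coeff \<alpha> k v)
      = cnj (f_increment \<alpha> k w z) * f_increment \<alpha> k w' z'" for k
    unfolding f_increment_def[of _ _ w' z']
    by (intro contour_integral_lmul f_coeff_contour_integrable zw')
  ultimately have "(\<lambda>k. cnj (f_increment \<alpha> k w z * cnj (f_increment \<alpha> k w' z'))) sums
      cnj (kernel_primitive \<alpha> z z' - kernel_primitive \<alpha> w z' - (kernel_primitive \<alpha> z w' - kernel_primitive \<alpha> w w'))"
    by simp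
  then show ?thesis unfolding sums_cnj by (simp add: algebra_simps)
qed

text \<open>In a convex set every path is homotopic to the segment with the same end points, so the definite
description in \<^const>\<open>hol_path_integral\<close> denotes something; by the primitive the value is the same for all
homotopic paths.\<close>

lemma hol_path_integral_eq_primitive:
  assumes S: "convex S" and p: "path p" "path_image p \<subseteq> S"
    and F: "\<And>x. x \<in> S \<Longrightarrow> (F has_field_derivative g x) (at x within S)"
  shows "hol_path_integral S p g = F (pathfinish p) - F (pathstart p)"
  unfolding hol_path_integral_def
proof (rule the_equality)
  let ?q = "linepath (pathstart p) (pathfinish p)"
  have in_S: "p t \<in> S" if "t \<in> {0..1}" for t using p that by (auto simp: path_image_def)
  have q_S: "?q t \<in> S" if "t \<in> {0..1}" for t
    using that in_S[of 0] in_S[of 1] S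
    by (auto simp: linepath_def pathstart_def pathfinish_def convex_alt)
  have "homotopic_paths S p ?q"
    using p(1) in_S q_S S by (intro homotopic_paths_linear closed_segment_subset) auto
  moreover have "path_image ?q \<subseteq> S" using q_S by (auto simp: path_image_def)
  then have "(g has_contour_integral F (pathfinish p) - F (pathstart p)) ?q"
    using contour_integral_primitive[OF F, of ?q] by simp
  ultimately show "\<exists>q. valid_path q \<and> homotopic_paths S p q
      \<and> (g has_contour_integral F (pathfinish p) - F (pathstart p)) q"
    using valid_path_linepath by blast
next
  fix I assume "\<exists>q. valid_path q \<and> homotopic_paths S p q \<and> (g has_contour_integral I) q"
  then obtain q where q: "valid_path q" "homotopic_paths S p q" "(g has_contour_integral I) q" by blast
  then have "(g has_contour_integral F (pathfinish q) - F (pathstart q)) q"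
    using contour_integral_primitive[OF F q(1)] homotopic_paths_imp_subset by blast
  then show "I = F (pathfinish p) - F (pathstart p)"
    using q homotopic_paths_imp_pathstart homotopic_paths_imp_pathfinish has_contour_integral_unique
    by metis
qed

text \<open>This is applied with the noise as \<open>c\<close>: subexponential growth of the coefficients is all that is needed for
\<open>\<Gamma>'\<^sup>+\<close> to be holomorphic and for its increments to be given by the termwise integrals.\<close>

lemma f_coeff_series_primitive:
  fixes c :: "nat \<Rightarrow> complex"
  assumes \<alpha>: "0 < \<alpha>" "\<alpha> < 1"
    and c: "\<And>r. 0 < r \<Longrightarrow> r < 1 \<Longrightarrow> summable (\<lambda>k. norm (c k) * r ^ k)"
  obtains F where
    "\<And>u. u \<in> uhp \<Longrightarrow> (F has_field_derivative (\<Sum>k. f_coeff \<alpha> k u * c k)) (at u within uhp)"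
    "\<And>w z. w \<in> uhp \<Longrightarrow> z \<in> uhp \<Longrightarrow> (\<lambda>k. f_increment \<alpha> k w z * c k) sums (F z - F w)"
proof -
  let ?G = "\<lambda>u. \<Sum>k. f_coeff \<alpha> k u * c k"
  have majorant: "\<exists>m. summable m \<and> (\<forall>k. \<forall>u\<in>C. norm (f_coeff \<alpha> k u * c k) \<le> m k)"
    if C: "compact C" "C \<subseteq> uhp" for C
  proof -
    obtain B r where B: "0 \<le> B" "0 < r" "r < 1" "\<And>k u. u \<in> C \<Longrightarrow> norm (f_coeff \<alpha> k u) \<le> B * r ^ k"
      using f_coeff_geometric_bound[OF \<alpha> C] by auto
    have "norm (f_coeff \<alpha> k u * c k) \<le> B * (norm (c k) * r ^ k)" if "u \<in> C" for k u
      using mult_right_mono[OF B(4)[OF that, of k], of "norm (c k)"] by (simp add: norm_mult mult_ac)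
    then show ?thesis using c[OF B(2,3)] by (intro exI[of _ "\<lambda>k. B * (norm (c k) * r ^ k)"]) auto
  qed
  have "?G holomorphic_on uhp"
  proof (rule holomorphic_uniform_sequence[OF open_uhp, of "\<lambda>n u. \<Sum>k<n. f_coeff \<alpha> k u * c k"])
    show "(\<lambda>u. \<Sum>k<n. f_coeff \<alpha> k u * c k) holomorphic_on uhp" for n
      by (intro holomorphic_intros f_coeff_holomorphic)
    fix x assume "x \<in> uhp"
    then obtain d where d: "0 < d" "cball x d \<subseteq> uhp"
      using open_uhp open_contains_cball by blast
    obtain m where m: "summable m" "\<forall>k. \<forall>u\<in>cball x d. norm (f_coeff \<alpha> k u * c k) \<le> m k"
      using majorant[OF compact_cball d(2)] by blast
    have "uniform_limit (cball x d) (\<lambda>n u. \<Sum>k<n. f_coeff \<alpha> k u * c k) ?G sequentially"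
      using m by (intro Weierstrass_m_test) auto
    with d show "\<exists>d>0. cball x d \<subseteq> uhp
        \<and> uniform_limit (cball x d) (\<lambda>n u. \<Sum>k<n. f_coeff \<alpha> k u * c k) ?G sequentially" by blast
  qed
  then obtain F where F: "\<And>u. u \<in> uhp \<Longrightarrow> (F has_field_derivative ?G u) (at u within uhp)"
    using holomorphic_convex_primitive'[OF convex_uhp open_uhp] by blast
  show ?thesis
  proof (rule that[OF F])
    fix w z assume wz: "w \<in> uhp" "z \<in> uhp"
    obtain m where m: "summable m" "\<forall>k. \<forall>u\<in>closed_segment w z. norm (f_coeff \<alpha> k u * c k) \<le> m k"
      using majorant[OF compact_segment closed_segment_subset[OF wz convex_uhp]] by blast
    have "(\<lambda>k. contour_integral (linepath w z) (\<lambda>u. f_coeff \<alpha> k u * c k)) sums (F z - F w)"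
    proof (rule sums_contour_integral_linepath[OF convex_uhp wz])
      show "continuous_on uhp (\<lambda>u. f_coeff \<alpha> k u * c k)" for k
        by (intro continuous_intros holomorphic_on_imp_continuous_on f_coeff_holomorphic)
    qed (use m F in auto)
    moreover have "contour_integral (linepath w z) (\<lambda>u. f_coeff \<alpha> k u * c k)
        = f_increment \<alpha> k w z * c k" for k
      unfolding f_increment_def by (intro contour_integral_rmul f_coeff_contour_integrable wz)
    ultimately show "(\<lambda>k. f_increment \<alpha> k w z * c k) sums (F z - F w)" by simp
  qed
qed

section \<open>Centered Gaussian variables through their characteristic function\<close>

text \<open>The characteristic function covers the degenerate case \<open>v = 0\<close> and passes to limits, which densities do not.
The variance \<open>v\<close> is automatically nonnegative, since characteristic functions are bounded by 1.\<close>

definition centered_gaussian :: "'a measure \<Rightarrow> ('a \<Rightarrow> real) \<Rightarrow> real \<Rightarrow> bool" where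
  "centered_gaussian M X v \<longleftrightarrow> X \<in> borel_measurable M \<and>
     (\<forall>\<theta>. (\<integral>\<omega>. iexp (\<theta> * X \<omega>) \<partial>M) = complex_of_real (exp (- (v * \<theta>\<^sup>2) / 2)))"

lemma centered_gaussianD:
  assumes "centered_gaussian M X v"
  shows "X \<in> borel_measurable M" "(\<integral>\<omega>. iexp (\<theta> * X \<omega>) \<partial>M) = complex_of_real (exp (- (v * \<theta>\<^sup>2) / 2))"
  using assms by (auto simp: centered_gaussian_def)

lemma char_distr_eq:
  assumes "X \<in> borel_measurable M"
  shows "char (distr M borel X) \<theta> = (\<integral>\<omega>. iexp (\<theta> * X \<omega>) \<partial>M)"
  using assms unfolding char_def by (intro integral_distr) auto

lemma norm_iexp_diff_le: "norm (iexp a - iexp b) \<le> \<bar>a - b\<bar>"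
proof -
  have "iexp a - iexp b = iexp b * (iexp (a - b) - 1)"
    by (simp add: algebra_simps flip: exp_add)
  then have "norm (iexp a - iexp b) = norm (iexp (a - b) - 1)" by (simp add: norm_mult)
  also have "\<dots> \<le> \<bar>a - b\<bar>" using iexp_approx1[of "a - b" 0] by simp
  finally show ?thesis .
qed

context prob_space begin

lemma centered_gaussian_cong_AE:
  assumes "centered_gaussian M X v" "Y \<in> borel_measurable M" "AE \<omega> in M. X \<omega> = Y \<omega>"
  shows "centered_gaussian M Y v"
  unfolding centered_gaussian_def
proof (intro conjI allI)
  fix \<theta>
  note centered_gaussianD(1)[OF assms(1), measurable] and assms(2)[measurable]
  have "(\<integral>\<omega>. iexp (\<theta> * Y \<omega>) \<partial>M) = (\<integral>\<omega>. iexp (\<theta> * X \<omega>) \<partial>M)"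
    by (rule integral_cong_AE) (use assms(3) in auto)
  then show "(\<integral>\<omega>. iexp (\<theta> * Y \<omega>) \<partial>M) = complex_of_real (exp (- (v * \<theta>\<^sup>2) / 2))"
    using centered_gaussianD(2)[OF assms(1)] by simp
qed (rule assms)

lemma centered_gaussian_nonneg:
  assumes "centered_gaussian M X v"
  shows "0 \<le> v"
proof -
  have "norm (\<integral>\<omega>. iexp (1 * X \<omega>) \<partial>M) \<le> 1"
    using real_distribution.cmod_char_le_1[OF real_distribution_distr[OF centered_gaussianD(1)[OF assms]], of 1]
    unfolding char_distr_eq[OF centered_gaussianD(1)[OF assms]] .
  then show ?thesis unfolding centered_gaussianD(2)[OF assms] by simp
qed

lemma normal_imp_centered_gaussian:
  assumes D: "distributed M lborel X (normal_density 0 \<sigma>)" and \<sigma>: "\<sigma> > 0"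
  shows "centered_gaussian M X (\<sigma>\<^sup>2)"
proof -
  have X: "X \<in> borel_measurable M" using distributed_measurable[OF D] by simp
  have S: "distributed M lborel (\<lambda>\<omega>. X \<omega> / \<sigma>) std_normal_density"
    using normal_standard_normal_convert[OF \<sigma>, of X 0] D by simp
  have "(\<integral>\<omega>. iexp (\<theta> * X \<omega>) \<partial>M) = complex_of_real (exp (- (\<sigma>\<^sup>2 * \<theta>\<^sup>2) / 2))" for \<theta>
  proof -
    have "(\<integral>\<omega>. iexp (\<theta> * X \<omega>) \<partial>M) = (\<integral>\<omega>. iexp ((\<theta> * \<sigma>) * (X \<omega> / \<sigma>)) \<partial>M)"
      using \<sigma> by simp
    also have "\<dots> = char (distr M borel (\<lambda>\<omega>. X \<omega> / \<sigma>)) (\<theta> * \<sigma>)"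
      using X by (subst char_distr_eq) auto
    also have "distr M borel (\<lambda>\<omega>. X \<omega> / \<sigma>) = std_normal_distribution"
      using distributed_distr_eq_density[OF S] by (metis distr_cong sets_lborel)
    finally show ?thesis
      by (simp add: char_std_normal_distribution power_mult_distrib mult.commute)
  qed
  with X show ?thesis by (simp add: centered_gaussian_def)
qed

lemma centered_gaussian_imp_normal:
  assumes G: "centered_gaussian M X v" and v: "v > 0"
  shows "distributed M lborel X (normal_density 0 (sqrt v))"
proof -
  note X = centered_gaussianD(1)[OF G]
  let ?N = "density lborel (normal_density 0 (sqrt v))"
  interpret N: prob_space ?N using v by (intro prob_space_normal_density) simp
  have rN: "real_distribution ?N"
    by (simp add: real_distribution_def real_distribution_axioms_def N.prob_space_axioms)
  have "distributed ?N lborel (\<lambda>x. x) (normal_density 0 (sqrt v))"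
    by (auto simp: distributed_def intro: distr_id2)
  then have GN: "centered_gaussian ?N (\<lambda>x. x) v"
    using N.normal_imp_centered_gaussian[of "\<lambda>x. x" "sqrt v"] v by simp
  have "distr M borel X = ?N"
  proof (rule Levy_uniqueness[OF real_distribution_distr[OF X] rN], rule ext)
    fix \<theta>
    show "char (distr M borel X) \<theta> = char ?N \<theta>"
      unfolding char_distr_eq[OF X] centered_gaussianD(2)[OF G]
      unfolding char_def centered_gaussianD(2)[OF GN] ..
  qed
  moreover have "distr M lborel X = distr M borel X" by (rule distr_cong) auto
  ultimately show ?thesis using X by (simp add: distributed_def)
qed

lemma centered_gaussian_0_imp_AE_0:
  assumes G: "centered_gaussian M X 0"
  shows "AE \<omega> in M. X \<omega> = 0"
proof -
  note X = centered_gaussianD(1)[OF G]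
  interpret R: prob_space "return borel (0::real)" by (rule prob_space_return) simp
  have "distr M borel X = return borel 0"
  proof (rule Levy_uniqueness[OF real_distribution_distr[OF X]])
    show "real_distribution (return borel 0)"
      by (simp add: real_distribution_def real_distribution_axioms_def R.prob_space_axioms)
    show "char (distr M borel X) = char (return borel 0)"
    proof
      fix \<theta>
      have "char (return borel 0) \<theta> = 1" unfolding char_def by (subst integral_return) auto
      then show "char (distr M borel X) \<theta> = char (return borel 0) \<theta>"
        unfolding char_distr_eq[OF X] centered_gaussianD(2)[OF G] by simp
    qed
  qed
  moreover have "AE x in return borel (0::real). x = 0" by (subst AE_return) auto
  ultimately have "AE x in distr M borel X. x = 0" by (simp only:)
  then show ?thesis using X by (subst (asm) AE_distr_iff) auto
qed

lemma centered_gaussian_imp_gaussian_rv: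
  assumes "centered_gaussian M X v"
  shows "gaussian_rv M X"
proof (cases "v = 0")
  case True
  then show ?thesis using centered_gaussian_0_imp_AE_0 assms centered_gaussianD(1)[OF assms]
    unfolding gaussian_rv_def by blast
next
  case False
  then have "v > 0" using centered_gaussian_nonneg[OF assms] by simp
  then show ?thesis
    using centered_gaussian_imp_normal[OF assms] centered_gaussianD(1)[OF assms]
    unfolding gaussian_rv_def by (intro conjI disjI1 exI[of _ 0] exI[of _ "sqrt v"]) auto
qed

lemma centered_gaussian_even_moment:
  assumes G: "centered_gaussian M X v"
  shows "integrable M (\<lambda>\<omega>. X \<omega> ^ (2 * k))"
    and "expectation (\<lambda>\<omega>. X \<omega> ^ (2 * k)) = v ^ k * (fact (2 * k) / (2 ^ k * fact k))"
proof -
  note X[measurable] = centered_gaussianD(1)[OF G]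
  have "integrable M (\<lambda>\<omega>. X \<omega> ^ (2 * k))
      \<and> expectation (\<lambda>\<omega>. X \<omega> ^ (2 * k)) = v ^ k * (fact (2 * k) / (2 ^ k * fact k))"
  proof (cases "v = 0")
    case True
    then have "AE \<omega> in M. X \<omega> = 0" using G centered_gaussian_0_imp_AE_0 by simp
    then have AE: "AE \<omega> in M. X \<omega> ^ (2 * k) = 0 ^ (2 * k)" by eventually_elim simp
    have "integrable M (\<lambda>\<omega>. X \<omega> ^ (2 * k)) \<longleftrightarrow> integrable M (\<lambda>\<omega>. 0 ^ (2 * k) :: real)"
      by (rule integrable_cong_AE) (use AE in auto)
    moreover have "expectation (\<lambda>\<omega>. X \<omega> ^ (2 * k)) = expectation (\<lambda>\<omega>. 0 ^ (2 * k))"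
      by (rule integral_cong_AE) (use AE in auto)
    ultimately show ?thesis using True by (cases k) (auto simp: prob_space)
  next
    case False
    then have v: "v > 0" using centered_gaussian_nonneg[OF G] by simp
    note D = centered_gaussian_imp_normal[OF G v]
    have B: "has_bochner_integral lborel (\<lambda>x. normal_density 0 (sqrt v) x * x ^ (2 * k))
        (fact (2 * k) / ((2 / v) ^ k * fact k))"
      using normal_moment_even[of "sqrt v" 0 k] v by simp
    have "integrable M (\<lambda>\<omega>. X \<omega> ^ (2 * k))"
      using distributed_integrable[OF D, of "\<lambda>x. x ^ (2 * k)"] B
      by (auto simp: has_bochner_integral_iff)
    moreover have "expectation (\<lambda>\<omega>. X \<omega> ^ (2 * k)) = fact (2 * k) / ((2 / v) ^ k * fact k)"
      using distributed_integral[OF D, of "\<lambda>x. x ^ (2 * k)"] B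
      by (auto simp: has_bochner_integral_iff)
    ultimately show ?thesis using v by (simp add: power_divide field_simps)
  qed
  then show "integrable M (\<lambda>\<omega>. X \<omega> ^ (2 * k))"
    "expectation (\<lambda>\<omega>. X \<omega> ^ (2 * k)) = v ^ k * (fact (2 * k) / (2 ^ k * fact k))" by auto
qed

lemma centered_gaussian_variance:
  assumes G: "centered_gaussian M X v"
  shows "integrable M (\<lambda>\<omega>. (X \<omega>)\<^sup>2)" "expectation (\<lambda>\<omega>. (X \<omega>)\<^sup>2) = v"
  using centered_gaussian_even_moment[OF G, of 1] by simp_all

lemma centered_gaussian_expectation:
  assumes G: "centered_gaussian M X v"
  shows "expectation X = 0"
proof (cases "v = 0")
  case True
  then have "AE \<omega> in M. X \<omega> = 0" using G centered_gaussian_0_imp_AE_0 by simp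
  then have "expectation X = expectation (\<lambda>_. 0)"
    by (intro integral_cong_AE centered_gaussianD(1)[OF G]) auto
  then show ?thesis by simp
next
  case False
  then have v: "v > 0" using centered_gaussian_nonneg[OF G] by simp
  have "(\<integral>x. normal_density 0 (sqrt v) x * x \<partial>lborel) = 0"
    using integral_normal_moment_nz_1[of "sqrt v" 0] v by simp
  then show ?thesis
    using distributed_integral[OF centered_gaussian_imp_normal[OF G v], of "\<lambda>x. x"] by simp
qed

lemma gaussian_rv_imp_centered_gaussian:
  assumes G: "gaussian_rv M X" and E: "expectation X = 0"
  shows "centered_gaussian M X (expectation (\<lambda>\<omega>. (X \<omega>)\<^sup>2))"
proof -
  have X[measurable]: "X \<in> borel_measurable M" using G by (simp add: gaussian_rv_def)
  consider (normal) \<mu> \<sigma> where "\<sigma> > 0" "distributed M lborel X (normal_density \<mu> \<sigma>)"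
    | (const) \<mu> where "AE \<omega> in M. X \<omega> = \<mu>"
    using G unfolding gaussian_rv_def by blast
  then show ?thesis
  proof cases
    case normal
    have "(\<integral>x. normal_density \<mu> \<sigma> x * x \<partial>lborel) = expectation X"
      using distributed_integral[OF normal(2), of "\<lambda>x. x"] by simp
    then have "\<mu> = 0" using integral_normal_moment_nz_1[OF normal(1), of \<mu>] E by simp
    then have "centered_gaussian M X (\<sigma>\<^sup>2)" using normal_imp_centered_gaussian normal by simp
    then show ?thesis using centered_gaussian_variance(2) by simp
  next
    case const
    then have "expectation X = expectation (\<lambda>_. \<mu>)" by (intro integral_cong_AE) auto
    then have "\<mu> = 0" using E by (simp add: prob_space)
    then have z: "AE \<omega> in M. X \<omega> = 0" using const by simp
    have "centered_gaussian M (\<lambda>_. 0) 0" by (simp add: centered_gaussian_def prob_space)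
    then have "centered_gaussian M X 0" by (rule centered_gaussian_cong_AE) (use z in auto)
    then show ?thesis using centered_gaussian_variance(2) by simp
  qed
qed

lemma centered_gaussian_scale:
  assumes "centered_gaussian M X v"
  shows "centered_gaussian M (\<lambda>\<omega>. c * X \<omega>) (c\<^sup>2 * v)"
  using centered_gaussianD(1)[OF assms] centered_gaussianD(2)[OF assms, of "\<theta> * c" for \<theta>]
  by (simp add: centered_gaussian_def power_mult_distrib mult_ac)

lemma centered_gaussian_indep_sum:
  assumes "indep_vars (\<lambda>_. borel) X I" "finite I" "\<And>i. i \<in> I \<Longrightarrow> centered_gaussian M (X i) (v i)"
  shows "centered_gaussian M (\<lambda>\<omega>. \<Sum>i\<in>I. X i \<omega>) (\<Sum>i\<in>I. v i)"
proof -
  note X = centered_gaussianD(1)[OF assms(3)]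
  have S: "(\<lambda>\<omega>. \<Sum>i\<in>I. X i \<omega>) \<in> borel_measurable M" using X by (rule borel_measurable_sum)
  have "(\<integral>\<omega>. iexp (\<theta> * (\<Sum>i\<in>I. X i \<omega>)) \<partial>M) = complex_of_real (exp (- ((\<Sum>i\<in>I. v i) * \<theta>\<^sup>2) / 2))" for \<theta>
  proof -
    have "(\<integral>\<omega>. iexp (\<theta> * (\<Sum>i\<in>I. X i \<omega>)) \<partial>M) = (\<Prod>i\<in>I. char (distr M borel (X i)) \<theta>)"
      using char_distr_sum[OF assms(1), of \<theta>] unfolding char_distr_eq[OF S] .
    also have "\<dots> = (\<Prod>i\<in>I. complex_of_real (exp (- (v i * \<theta>\<^sup>2) / 2)))"
      by (intro prod.cong refl) (simp only: char_distr_eq[OF X] centered_gaussianD(2)[OF assms(3)])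
    also have "\<dots> = complex_of_real (exp (\<Sum>i\<in>I. - (v i * \<theta>\<^sup>2) / 2))"
      by (simp add: exp_sum[OF assms(2)])
    also have "(\<Sum>i\<in>I. - (v i * \<theta>\<^sup>2) / 2) = - ((\<Sum>i\<in>I. v i) * \<theta>\<^sup>2) / 2"
      by (simp add: sum_divide_distrib sum_distrib_right sum_negf)
    finally show ?thesis .
  qed
  with S show ?thesis by (simp add: centered_gaussian_def)
qed

lemma centered_gaussian_LIMSEQ_AE:
  assumes G: "\<And>n. centered_gaussian M (X n) (v n)" and Y: "Y \<in> borel_measurable M"
    and lim: "AE \<omega> in M. (\<lambda>n. X n \<omega>) \<longlonglongrightarrow> Y \<omega>" and v: "v \<longlonglongrightarrow> v'"
  shows "centered_gaussian M Y v'"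
  unfolding centered_gaussian_def
proof (intro conjI allI)
  fix \<theta>
  note [measurable] = centered_gaussianD(1)[OF G] Y
  have "(\<lambda>n. \<integral>\<omega>. iexp (\<theta> * X n \<omega>) \<partial>M) \<longlonglongrightarrow> (\<integral>\<omega>. iexp (\<theta> * Y \<omega>) \<partial>M)"
  proof (rule integral_dominated_convergence[where w = "\<lambda>_. 1"])
    show "AE \<omega> in M. (\<lambda>n. iexp (\<theta> * X n \<omega>)) \<longlonglongrightarrow> iexp (\<theta> * Y \<omega>)"
      using lim by eventually_elim (intro tendsto_intros)
  qed auto
  moreover have "(\<lambda>n. \<integral>\<omega>. iexp (\<theta> * X n \<omega>) \<partial>M) \<longlonglongrightarrow> complex_of_real (exp (- (v' * \<theta>\<^sup>2) / 2))"
    unfolding centered_gaussianD(2)[OF G] by (intro tendsto_intros v) auto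
  ultimately show "(\<integral>\<omega>. iexp (\<theta> * Y \<omega>) \<partial>M) = complex_of_real (exp (- (v' * \<theta>\<^sup>2) / 2))"
    by (rule LIMSEQ_unique)
qed (rule Y)

text \<open>The map \<open>x \<mapsto> e\<^sup>i\<^sup>\<theta>\<^sup>x\<close> is Lipschitz with constant \<open>|\<theta>|\<close>, so \<open>L\<^sup>1\<close> convergence implies convergence of the
characteristic functions. Written as an integral, the \<open>L\<^sup>1\<close> distance is subadditive, which suits linear combinations.\<close>

lemma centered_gaussian_LIMSEQ_L1:
  assumes G: "\<And>n. centered_gaussian M (X n) (v n)" and Y: "Y \<in> borel_measurable M"
    and lim: "(\<lambda>n. \<integral>\<^sup>+\<omega>. ennreal \<bar>X n \<omega> - Y \<omega>\<bar> \<partial>M) \<longlonglongrightarrow> 0" and v: "v \<longlonglongrightarrow> v'"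
  shows "centered_gaussian M Y v'"
  unfolding centered_gaussian_def
proof (intro conjI allI)
  fix \<theta>
  note [measurable] = centered_gaussianD(1)[OF G] Y
  let ?c = "\<lambda>Z. \<integral>\<omega>. iexp (\<theta> * Z \<omega>) \<partial>M"
  have int: "integrable M (\<lambda>\<omega>. iexp (\<theta> * Z \<omega>))" if "Z \<in> borel_measurable M" for Z
    using that by (intro integrable_iexp) auto
  have b: "ennreal (norm (?c (X n) - ?c Y)) \<le> ennreal \<bar>\<theta>\<bar> * (\<integral>\<^sup>+\<omega>. ennreal \<bar>X n \<omega> - Y \<omega>\<bar> \<partial>M)" for n
  proof -
    have "?c (X n) - ?c Y = (\<integral>\<omega>. iexp (\<theta> * X n \<omega>) - iexp (\<theta> * Y \<omega>) \<partial>M)"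
      by (rule Bochner_Integration.integral_diff[symmetric]) (intro int; measurable)+
    moreover have "integrable M (\<lambda>\<omega>. iexp (\<theta> * X n \<omega>) - iexp (\<theta> * Y \<omega>))"
      by (intro Bochner_Integration.integrable_diff int) measurable
    from integral_norm_bound_ennreal[OF this]
    have "ennreal (norm (\<integral>\<omega>. iexp (\<theta> * X n \<omega>) - iexp (\<theta> * Y \<omega>) \<partial>M))
        \<le> (\<integral>\<^sup>+\<omega>. ennreal (norm (iexp (\<theta> * X n \<omega>) - iexp (\<theta> * Y \<omega>))) \<partial>M)" .
    ultimately have "ennreal (norm (?c (X n) - ?c Y))
        \<le> (\<integral>\<^sup>+\<omega>. ennreal (norm (iexp (\<theta> * X n \<omega>) - iexp (\<theta> * Y \<omega>))) \<partial>M)"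
      by (simp only:)
    also have "\<dots> \<le> (\<integral>\<^sup>+\<omega>. ennreal \<bar>\<theta>\<bar> * ennreal \<bar>X n \<omega> - Y \<omega>\<bar> \<partial>M)"
    proof (rule nn_integral_mono)
      fix \<omega>
      show "ennreal (norm (iexp (\<theta> * X n \<omega>) - iexp (\<theta> * Y \<omega>))) \<le> ennreal \<bar>\<theta>\<bar> * ennreal \<bar>X n \<omega> - Y \<omega>\<bar>"
        using norm_iexp_diff_le[of "\<theta> * X n \<omega>" "\<theta> * Y \<omega>"]
        by (simp add: ennreal_mult[symmetric] abs_mult[symmetric] algebra_simps del: of_real_mult)
    qed
    also have "\<dots> = ennreal \<bar>\<theta>\<bar> * (\<integral>\<^sup>+\<omega>. ennreal \<bar>X n \<omega> - Y \<omega>\<bar> \<partial>M)"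
      by (rule nn_integral_cmult) measurable
    finally show ?thesis .
  qed
  have "(\<lambda>n. ennreal \<bar>\<theta>\<bar> * (\<integral>\<^sup>+\<omega>. ennreal \<bar>X n \<omega> - Y \<omega>\<bar> \<partial>M)) \<longlonglongrightarrow> ennreal \<bar>\<theta>\<bar> * 0"
    by (intro ennreal_tendsto_cmult lim) auto
  then have upper: "(\<lambda>n. ennreal \<bar>\<theta>\<bar> * (\<integral>\<^sup>+\<omega>. ennreal \<bar>X n \<omega> - Y \<omega>\<bar> \<partial>M)) \<longlonglongrightarrow> ennreal 0"
    by simp
  have "(\<lambda>n. ennreal (norm (?c (X n) - ?c Y))) \<longlonglongrightarrow> ennreal 0"
  proof (rule tendsto_sandwich[OF _ _ tendsto_const upper])
    show "\<forall>\<^sub>F n in sequentially. ennreal 0 \<le> ennreal (norm (?c (X n) - ?c Y))" by simp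
    show "\<forall>\<^sub>F n in sequentially. ennreal (norm (?c (X n) - ?c Y))
        \<le> ennreal \<bar>\<theta>\<bar> * (\<integral>\<^sup>+\<omega>. ennreal \<bar>X n \<omega> - Y \<omega>\<bar> \<partial>M)"
      using b by (intro always_eventually allI)
  qed
  then have "(\<lambda>n. norm (?c (X n) - ?c Y)) \<longlonglongrightarrow> 0" by (subst (asm) tendsto_ennreal_iff) auto
  then have "(\<lambda>n. ?c (X n)) \<longlonglongrightarrow> ?c Y" by (simp add: tendsto_norm_zero_iff LIM_zero_iff)
  moreover have "(\<lambda>n. ?c (X n)) \<longlonglongrightarrow> complex_of_real (exp (- (v' * \<theta>\<^sup>2) / 2))"
    unfolding centered_gaussianD(2)[OF G] by (intro tendsto_intros v) auto
  ultimately show "?c Y = complex_of_real (exp (- (v' * \<theta>\<^sup>2) / 2))" by (rule LIMSEQ_unique)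
qed (rule Y)

lemma L2_tendsto_0_imp_L1:
  fixes d :: "nat \<Rightarrow> 'a \<Rightarrow> 'b :: {second_countable_topology, real_normed_vector}"
  assumes d[measurable]: "\<And>n. d n \<in> borel_measurable M"
    and lim: "(\<lambda>n. \<integral>\<^sup>+\<omega>. ennreal ((norm (d n \<omega>))\<^sup>2) \<partial>M) \<longlonglongrightarrow> 0"
  shows "(\<lambda>n. \<integral>\<^sup>+\<omega>. ennreal (norm (d n \<omega>)) \<partial>M) \<longlonglongrightarrow> 0"
proof (rule order_tendstoI)
  fix e :: ennreal assume e: "e > 0"
  then have "e\<^sup>2 > 0" by (simp add: zero_less_iff_neq_zero)
  then have "\<forall>\<^sub>F n in sequentially. (\<integral>\<^sup>+\<omega>. ennreal ((norm (d n \<omega>))\<^sup>2) \<partial>M) < e\<^sup>2"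
    using lim by (rule order_tendstoD(2)[rotated])
  then show "\<forall>\<^sub>F n in sequentially. (\<integral>\<^sup>+\<omega>. ennreal (norm (d n \<omega>)) \<partial>M) < e"
  proof eventually_elim
    case (elim n)
    have "(\<integral>\<^sup>+\<omega>. ennreal (norm (d n \<omega>)) * 1 \<partial>M)\<^sup>2
        \<le> (\<integral>\<^sup>+\<omega>. (ennreal (norm (d n \<omega>)))\<^sup>2 \<partial>M) * (\<integral>\<^sup>+\<omega>. 1\<^sup>2 \<partial>M)"
      by (rule Cauchy_Schwarz_nn_integral) measurable
    also have "\<dots> = (\<integral>\<^sup>+\<omega>. ennreal ((norm (d n \<omega>))\<^sup>2) \<partial>M)"
      by (simp add: emeasure_space_1 ennreal_power)
    also note elim
    finally have "(\<integral>\<^sup>+\<omega>. ennreal (norm (d n \<omega>)) \<partial>M)\<^sup>2 < e\<^sup>2" by simp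
    then show ?case using power_mono[of e _ 2] by (metis leD leI zero_le)
  qed
qed simp

end

section \<open>Increments of the process as Gaussian series\<close>

lemma gaussian_noiseD:
  assumes "gaussian_noise M \<xi>1 \<xi>2"
  shows "prob_space M" "centered_gaussian M (\<xi>1 k) (1/2)" "centered_gaussian M (\<xi>2 k) (1/2)"
    "prob_space.indep_vars M (\<lambda>_. borel) (case_sum \<xi>1 \<xi>2) UNIV"
proof -
  show P: "prob_space M" and "prob_space.indep_vars M (\<lambda>_. borel) (case_sum \<xi>1 \<xi>2) UNIV"
    using assms by (auto simp: gaussian_noise_def)
  show "centered_gaussian M (\<xi>1 k) (1/2)" "centered_gaussian M (\<xi>2 k) (1/2)"
    using assms prob_space.normal_imp_centered_gaussian[OF P, of _ "sqrt (1/2)"]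
    by (auto simp: gaussian_noise_def)
qed

definition complex_noise :: "(nat \<Rightarrow> 'a \<Rightarrow> real) \<Rightarrow> (nat \<Rightarrow> 'a \<Rightarrow> real) \<Rightarrow> nat \<Rightarrow> 'a \<Rightarrow> complex" where
  "complex_noise \<xi>1 \<xi>2 k \<omega> = complex_of_real (\<xi>1 k \<omega>) + \<i> * complex_of_real (\<xi>2 k \<omega>)"

lemma complex_noise_measurable:
  assumes "gaussian_noise M \<xi>1 \<xi>2"
  shows "complex_noise \<xi>1 \<xi>2 k \<in> borel_measurable M"
proof -
  note [measurable] = gaussian_noiseD(2,3)[OF assms, THEN centered_gaussianD(1)]
  show ?thesis unfolding complex_noise_def[abs_def] by measurable
qed

text \<open>Since \<open>Re (a (\<xi>\<^sup>1 + i\<xi>\<^sup>2)) = Re a \<xi>\<^sup>1 - Im a \<xi>\<^sup>2\<close> has variance \<open>|a|\<^sup>2 / 2\<close>, each partial sum is a sum over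
\<open>{..<n} <+> {..<n}\<close> of independent Gaussian variables, and the series is their almost sure limit.\<close>

lemma noise_series_centered_gaussian:
  fixes a :: "nat \<Rightarrow> complex"
  assumes noise: "gaussian_noise M \<xi>1 \<xi>2" and X: "X \<in> borel_measurable M"
    and conv: "AE \<omega> in M. (\<lambda>k. Re (a k * complex_noise \<xi>1 \<xi>2 k \<omega>)) sums X \<omega>"
    and var: "(\<lambda>k. (norm (a k))\<^sup>2) sums s"
  shows "centered_gaussian M X (s / 2)"
proof -
  note N = gaussian_noiseD[OF noise]
  interpret prob_space M by (rule N(1))
  let ?\<xi> = "case_sum \<xi>1 \<xi>2" and ?b = "case_sum (\<lambda>k. Re (a k)) (\<lambda>k. - Im (a k))"
  show ?thesis
  proof (rule centered_gaussian_LIMSEQ_AE[OF _ X])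
    fix n :: nat
    let ?I = "{..<n} <+> {..<n}"
    have "indep_vars (\<lambda>_. borel) (\<lambda>i \<omega>. ?b i * ?\<xi> i \<omega>) ?I"
      by (rule indep_vars_compose2[OF indep_vars_subset[OF N(4)], where Y = "\<lambda>i x. ?b i * x"]) auto
    then have "centered_gaussian M (\<lambda>\<omega>. \<Sum>i\<in>?I. ?b i * ?\<xi> i \<omega>) (\<Sum>i\<in>?I. (?b i)\<^sup>2 * (1/2))"
    proof (rule centered_gaussian_indep_sum)
      show "centered_gaussian M (\<lambda>\<omega>. ?b i * ?\<xi> i \<omega>) ((?b i)\<^sup>2 * (1/2))" for i
        by (rule centered_gaussian_scale) (use N(2,3) in \<open>auto split: sum.split\<close>)
    qed auto
    moreover have "(\<Sum>i\<in>?I. ?b i * ?\<xi> i \<omega>) = (\<Sum>k<n. Re (a k * complex_noise \<xi>1 \<xi>2 k \<omega>))" for \<omega>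
      by (simp add: sum.Plus complex_noise_def sum_subtractf sum_negf)
    moreover have "(\<Sum>i\<in>?I. (?b i)\<^sup>2 * (1/2)) = (\<Sum>k<n. (norm (a k))\<^sup>2) / 2"
      by (simp add: sum.Plus cmod_power2 sum.distrib sum_divide_distrib add_divide_distrib)
    ultimately show "centered_gaussian M (\<lambda>\<omega>. \<Sum>k<n. Re (a k * complex_noise \<xi>1 \<xi>2 k \<omega>))
        ((\<Sum>k<n. (norm (a k))\<^sup>2) / 2)" by (simp only:)
  next
    show "AE \<omega> in M. (\<lambda>n. \<Sum>k<n. Re (a k * complex_noise \<xi>1 \<xi>2 k \<omega>)) \<longlonglongrightarrow> X \<omega>"
      using conv by (simp add: sums_def)
    show "(\<lambda>n. (\<Sum>k<n. (norm (a k))\<^sup>2) / 2) \<longlonglongrightarrow> s / 2"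
      using var by (intro tendsto_intros) (simp_all add: sums_def)
  qed
qed

text \<open>For fixed \<open>r\<close> the expectation of the sum is finite, the first moments of the noise being bounded. The radii
\<open>1 - 1 / (n + 2)\<close> serve all \<open>r < 1\<close> at once by monotonicity.\<close>

lemma complex_noise_AE_geometrically_summable:
  assumes noise: "gaussian_noise M \<xi>1 \<xi>2"
  shows "AE \<omega> in M. \<forall>r. 0 < r \<longrightarrow> r < 1 \<longrightarrow> summable (\<lambda>k. norm (complex_noise \<xi>1 \<xi>2 k \<omega>) * r ^ k)"
proof -
  note N = gaussian_noiseD[OF noise]
  interpret prob_space M by (rule N(1))
  let ?\<zeta> = "complex_noise \<xi>1 \<xi>2"
  note [measurable] = N(2,3)[THEN centered_gaussianD(1)] complex_noise_measurable[OF noise]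
  have first_moment: "(\<integral>\<^sup>+\<omega>. ennreal (norm (?\<zeta> k \<omega>)) \<partial>M) \<le> 2" for k
  proof -
    have le: "norm (?\<zeta> k \<omega>) \<le> 1 + (\<xi>1 k \<omega>)\<^sup>2 + (\<xi>2 k \<omega>)\<^sup>2" for \<omega>
    proof -
      have "2 * norm (?\<zeta> k \<omega>) \<le> (norm (?\<zeta> k \<omega>))\<^sup>2 + 1"
        using zero_le_power2[of "norm (?\<zeta> k \<omega>) - 1"] by (simp add: power2_diff)
      then have "norm (?\<zeta> k \<omega>) \<le> 1 + (norm (?\<zeta> k \<omega>))\<^sup>2"
        using norm_ge_zero[of "?\<zeta> k \<omega>"] by linarith
      then show ?thesis by (simp add: cmod_power2 complex_noise_def)
    qed
    have i: "integrable M (\<lambda>\<omega>. 1 + (\<xi>1 k \<omega>)\<^sup>2 + (\<xi>2 k \<omega>)\<^sup>2)"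
      by (intro Bochner_Integration.integrable_add centered_gaussian_variance(1)[OF N(2)]
          centered_gaussian_variance(1)[OF N(3)]) simp
    have "(\<integral>\<^sup>+\<omega>. ennreal (norm (?\<zeta> k \<omega>)) \<partial>M) \<le> (\<integral>\<^sup>+\<omega>. ennreal (1 + (\<xi>1 k \<omega>)\<^sup>2 + (\<xi>2 k \<omega>)\<^sup>2) \<partial>M)"
      by (intro nn_integral_mono ennreal_leI le)
    also have "\<dots> = ennreal (expectation (\<lambda>\<omega>. 1 + (\<xi>1 k \<omega>)\<^sup>2 + (\<xi>2 k \<omega>)\<^sup>2))"
      by (rule nn_integral_eq_integral[OF i]) simp
    also have "expectation (\<lambda>\<omega>. 1 + (\<xi>1 k \<omega>)\<^sup>2 + (\<xi>2 k \<omega>)\<^sup>2) = 2"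
      using centered_gaussian_variance[OF N(2), of k] centered_gaussian_variance[OF N(3), of k]
      by (simp add: prob_space)
    finally show ?thesis by simp
  qed
  have fixed: "AE \<omega> in M. summable (\<lambda>k. norm (?\<zeta> k \<omega>) * r ^ k)" if r: "0 < r" "r < 1" for r
  proof -
    have "(\<integral>\<^sup>+\<omega>. (\<Sum>k. ennreal (norm (?\<zeta> k \<omega>) * r ^ k)) \<partial>M)
        = (\<Sum>k. \<integral>\<^sup>+\<omega>. ennreal (r ^ k) * ennreal (norm (?\<zeta> k \<omega>)) \<partial>M)"
      using r by (subst nn_integral_suminf) (auto simp: ennreal_mult mult.commute)
    also have "\<dots> = (\<Sum>k. ennreal (r ^ k) * (\<integral>\<^sup>+\<omega>. ennreal (norm (?\<zeta> k \<omega>)) \<partial>M))"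
      by (subst nn_integral_cmult) auto
    also have "\<dots> \<le> (\<Sum>k. ennreal (r ^ k * 2))"
      using first_moment r by (intro suminf_le) (auto simp: ennreal_mult intro!: mult_left_mono)
    also have "\<dots> = ennreal (\<Sum>k. r ^ k * 2)"
      using r by (intro suminf_ennreal2 summable_mult2 summable_geometric) auto
    also have "\<dots> < \<infinity>" by simp
    finally have "(\<integral>\<^sup>+\<omega>. (\<Sum>k. ennreal (norm (?\<zeta> k \<omega>) * r ^ k)) \<partial>M) \<noteq> \<infinity>" by simp
    then have "AE \<omega> in M. (\<Sum>k. ennreal (norm (?\<zeta> k \<omega>) * r ^ k)) \<noteq> \<infinity>"
      by (intro nn_integral_PInf_AE) measurable
    then show ?thesis
    proof eventually_elim
      case (elim \<omega>)
      then show ?case using r by (intro summable_suminf_not_top) auto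
    qed
  qed
  have "AE \<omega> in M. \<forall>n::nat. summable (\<lambda>k. norm (?\<zeta> k \<omega>) * (1 - 1 / (real n + 2)) ^ k)"
    unfolding AE_all_countable by (intro allI fixed) (auto simp: field_simps)
  then show ?thesis
  proof eventually_elim
    case (elim \<omega>)
    show ?case
    proof (intro allI impI)
      fix r :: real assume r: "0 < r" "r < 1"
      obtain n where n: "1 / (1 - r) < real n" using reals_Archimedean2 by blast
      have "1 / (real n + 2) \<le> 1 - r"
      proof -
        have "1 < real n * (1 - r)" using n r by (simp add: field_simps)
        also have "\<dots> \<le> (real n + 2) * (1 - r)" using r by (intro mult_right_mono) auto
        finally show ?thesis by (simp add: field_simps)
      qed
      then have "norm (norm (?\<zeta> k \<omega>) * r ^ k) \<le> norm (?\<zeta> k \<omega>) * (1 - 1 / (real n + 2)) ^ k" for k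
        using r by (auto simp: norm_mult norm_power intro!: mult_left_mono power_mono)
      then show "summable (\<lambda>k. norm (?\<zeta> k \<omega>) * r ^ k)"
        by (rule summable_comparison_test'[OF elim[rule_format, of n], of 0])
    qed
  qed
qed

definition Gamma_increment ::
  "real \<Rightarrow> (nat \<Rightarrow> 'a \<Rightarrow> real) \<Rightarrow> (nat \<Rightarrow> 'a \<Rightarrow> real) \<Rightarrow> complex \<Rightarrow> complex \<Rightarrow> 'a \<Rightarrow> complex" where
  "Gamma_increment \<alpha> \<xi>1 \<xi>2 w z \<omega> = (\<Sum>k. f_increment \<alpha> k w z * complex_noise \<xi>1 \<xi>2 k \<omega>)"

lemma Gamma_increment_measurable:
  assumes "gaussian_noise M \<xi>1 \<xi>2"
  shows "Gamma_increment \<alpha> \<xi>1 \<xi>2 w z \<in> borel_measurable M"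
proof -
  note [measurable] = complex_noise_measurable[OF assms]
  show ?thesis unfolding Gamma_increment_def[abs_def] by measurable
qed

lemma Gamma'_AE_primitive:
  assumes \<alpha>: "0 < \<alpha>" "\<alpha> < 1" and noise: "gaussian_noise M \<xi>1 \<xi>2"
  shows "AE \<omega> in M. \<exists>F.
    (\<forall>u\<in>uhp. (F has_field_derivative Gamma'_plus \<alpha> \<xi>1 \<xi>2 u \<omega>) (at u within uhp)) \<and>
    (\<forall>w\<in>uhp. \<forall>z\<in>uhp. (\<lambda>k. f_increment \<alpha> k w z * complex_noise \<xi>1 \<xi>2 k \<omega>) sums (F z - F w))"
  using complex_noise_AE_geometrically_summable[OF noise]
proof eventually_elim
  case (elim \<omega>)
  then obtain F where
    "\<And>u. u \<in> uhp \<Longrightarrow> (F has_field_derivative (\<Sum>k. f_coeff \<alpha> k u * complex_noise \<xi>1 \<xi>2 k \<omega>)) (at u within uhp)"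
    "\<And>w z. w \<in> uhp \<Longrightarrow> z \<in> uhp \<Longrightarrow> (\<lambda>k. f_increment \<alpha> k w z * complex_noise \<xi>1 \<xi>2 k \<omega>) sums (F z - F w)"
    using f_coeff_series_primitive[OF \<alpha>, of "\<lambda>k. complex_noise \<xi>1 \<xi>2 k \<omega>"] by blast
  then show ?case unfolding Gamma'_plus_def complex_noise_def by blast
qed

lemma hol_path_integral_AE_eq_Gamma_increment:
  assumes \<alpha>: "0 < \<alpha>" "\<alpha> < 1" and noise: "gaussian_noise M \<xi>1 \<xi>2"
  shows "AE \<omega> in M. \<forall>p. path p \<and> path_image p \<subseteq> uhp \<longrightarrow>
    hol_path_integral uhp p (\<lambda>u. Gamma'_plus \<alpha> \<xi>1 \<xi>2 u \<omega>)
      = Gamma_increment \<alpha> \<xi>1 \<xi>2 (pathstart p) (pathfinish p) \<omega>"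
  using Gamma'_AE_primitive[OF assms]
proof eventually_elim
  case (elim \<omega>)
  then obtain F where
    F: "\<And>u. u \<in> uhp \<Longrightarrow> (F has_field_derivative Gamma'_plus \<alpha> \<xi>1 \<xi>2 u \<omega>) (at u within uhp)"
    and s: "\<And>w z. w \<in> uhp \<Longrightarrow> z \<in> uhp \<Longrightarrow>
      (\<lambda>k. f_increment \<alpha> k w z * complex_noise \<xi>1 \<xi>2 k \<omega>) sums (F z - F w)" by blast
  show ?case
  proof (intro allI impI, elim conjE)
    fix p assume p: "path p" "path_image p \<subseteq> uhp"
    then have "pathstart p \<in> uhp" "pathfinish p \<in> uhp" by auto
    from sums_unique[OF s[OF this]]
    have "Gamma_increment \<alpha> \<xi>1 \<xi>2 (pathstart p) (pathfinish p) \<omega> = F (pathfinish p) - F (pathstart p)"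
      by (simp add: Gamma_increment_def)
    moreover have "hol_path_integral uhp p (\<lambda>u. Gamma'_plus \<alpha> \<xi>1 \<xi>2 u \<omega>) = F (pathfinish p) - F (pathstart p)"
      by (rule hol_path_integral_eq_primitive[OF convex_uhp p F])
    ultimately show "hol_path_integral uhp p (\<lambda>u. Gamma'_plus \<alpha> \<xi>1 \<xi>2 u \<omega>)
      = Gamma_increment \<alpha> \<xi>1 \<xi>2 (pathstart p) (pathfinish p) \<omega>" by simp
  qed
qed

lemma Gamma_AE_continuous:
  assumes \<alpha>: "0 < \<alpha>" "\<alpha> < 1" and noise: "gaussian_noise M \<xi>1 \<xi>2"
    and \<Gamma>: "is_Gamma_plus M \<alpha> \<xi>1 \<xi>2 \<Gamma>"
  shows "AE \<omega> in M. continuous_on uhp (\<lambda>z. \<Gamma> z \<omega>)"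
proof -
  have "AE \<omega> in M. \<forall>p. path p \<and> path_image p \<subseteq> uhp \<longrightarrow>
        \<Gamma> (pathfinish p) \<omega> - \<Gamma> (pathstart p) \<omega>
          = hol_path_integral uhp p (\<lambda>u. Gamma'_plus \<alpha> \<xi>1 \<xi>2 u \<omega>)"
    using \<Gamma> by (simp add: is_Gamma_plus_def)
  then show ?thesis using Gamma'_AE_primitive[OF \<alpha> noise]
  proof eventually_elim
    case (elim \<omega>)
    then obtain F where
      F: "\<And>u. u \<in> uhp \<Longrightarrow> (F has_field_derivative Gamma'_plus \<alpha> \<xi>1 \<xi>2 u \<omega>) (at u within uhp)" by blast
    have "\<Gamma> z \<omega> = F z + (\<Gamma> \<i> \<omega> - F \<i>)" if z: "z \<in> uhp" for z
    proof -
      have p: "path (linepath \<i> z)" "path_image (linepath \<i> z) \<subseteq> uhp"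
        using closed_segment_subset[OF _ z convex_uhp, of \<i>] by (auto simp: uhp_def)
      then have "\<Gamma> z \<omega> - \<Gamma> \<i> \<omega> = F z - F \<i>"
        using elim(1)[rule_format, of "linepath \<i> z"] hol_path_integral_eq_primitive[OF convex_uhp p F]
        by auto
      then show ?thesis by (simp add: algebra_simps)
    qed
    moreover have "continuous_on uhp F" by (rule DERIV_continuous_on[OF F])
    then have "continuous_on uhp (\<lambda>z. F z + (\<Gamma> \<i> \<omega> - F \<i>))" by (intro continuous_intros)
    ultimately show "continuous_on uhp (\<lambda>z. \<Gamma> z \<omega>)" by (subst continuous_on_cong[OF refl]) auto
  qed
qed

lemma Gamma_L2_path:
  assumes "is_Gamma_plus M \<alpha> \<xi>1 \<xi>2 \<Gamma>" "z \<in> closure uhp"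
  obtains \<gamma> where "path \<gamma>" "pathstart \<gamma> = 0" "pathfinish \<gamma> = z" "\<gamma> ` {0<..<1} \<subseteq> uhp"
    "is_L2_path_integral M uhp \<gamma> (Gamma'_plus \<alpha> \<xi>1 \<xi>2) (\<Gamma> z)"
proof -
  have "\<exists>\<gamma>. path \<gamma> \<and> pathstart \<gamma> = 0 \<and> pathfinish \<gamma> = z \<and> \<gamma> ` {0<..<1} \<subseteq> uhp \<and>
      is_L2_path_integral M uhp \<gamma> (Gamma'_plus \<alpha> \<xi>1 \<xi>2) (\<Gamma> z)"
    using assms unfolding is_Gamma_plus_def by (elim conjE) (erule bspec)
  then show ?thesis by (elim exE conjE) (rule that)
qed

lemma Gamma_measurable:
  assumes "is_Gamma_plus M \<alpha> \<xi>1 \<xi>2 \<Gamma>" "z \<in> closure uhp"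
  shows "\<Gamma> z \<in> borel_measurable M"
  by (rule Gamma_L2_path[OF assms]) (simp add: is_L2_path_integral_def)

text \<open>The \<open>L\<^sup>2\<close> limit over the two-sided filter is sampled along the parameters \<open>1 / (n + 2)\<close> and \<open>1 - 1 / (n + 2)\<close> of
the path that defines \<open>\<Gamma> z\<close>; in this way everything later depends on the end points only, and not on the path.\<close>

lemma Gamma_L2_approximation:
  assumes \<alpha>: "0 < \<alpha>" "\<alpha> < 1" and noise: "gaussian_noise M \<xi>1 \<xi>2"
    and \<Gamma>: "is_Gamma_plus M \<alpha> \<xi>1 \<xi>2 \<Gamma>" and z: "z \<in> closure uhp"
  obtains a b where "\<And>n. a n \<in> uhp" "\<And>n. b n \<in> uhp" "a \<longlonglongrightarrow> 0" "b \<longlonglongrightarrow> z"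
    "(\<lambda>n. \<integral>\<^sup>+\<omega>. ennreal (norm (Gamma_increment \<alpha> \<xi>1 \<xi>2 (a n) (b n) \<omega> - \<Gamma> z \<omega>)) \<partial>M) \<longlonglongrightarrow> 0"
proof -
  interpret prob_space M by (rule gaussian_noiseD(1)[OF noise])
  obtain \<gamma> where \<gamma>: "path \<gamma>" "pathstart \<gamma> = 0" "pathfinish \<gamma> = z" "\<gamma> ` {0<..<1} \<subseteq> uhp"
    and L2: "is_L2_path_integral M uhp \<gamma> (Gamma'_plus \<alpha> \<xi>1 \<xi>2) (\<Gamma> z)"
    by (rule Gamma_L2_path[OF \<Gamma> z])
  let ?a = "\<lambda>n. 1 / (real n + 2)" and ?b = "\<lambda>n. 1 - 1 / (real n + 2)"
  let ?H = "\<lambda>n \<omega>. hol_path_integral uhp (subpath (?a n) (?b n) \<gamma>) (\<lambda>u. Gamma'_plus \<alpha> \<xi>1 \<xi>2 u \<omega>)"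
    and ?D = "\<lambda>n. Gamma_increment \<alpha> \<xi>1 \<xi>2 (\<gamma> (?a n)) (\<gamma> (?b n))"
  have ab: "?a n \<in> {0<..<1}" "?b n \<in> {0<..<1}" for n by (auto simp: field_simps)
  have a0: "?a \<longlonglongrightarrow> 0" by real_asymp
  have b1: "?b \<longlonglongrightarrow> 1" by real_asymp
  have contL: "(\<lambda>n. \<gamma> (c n)) \<longlonglongrightarrow> \<gamma> t" if "c \<longlonglongrightarrow> t" "t \<in> {0..1}" "\<And>n. c n \<in> {0<..<1}" for c t
    using \<gamma>(1) that(1,2) unfolding path_def
    by (rule continuous_on_tendsto_compose) (use that(3) in \<open>auto intro!: always_eventually less_imp_le\<close>)
  have "filterlim (\<lambda>n. (?a n, ?b n)) (at_right 0 \<times>\<^sub>F at_left 1) sequentially"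
  proof (rule filterlim_Pair)
    show "filterlim ?a (at_right 0) sequentially"
      using a0 ab(1) by (auto simp: filterlim_at intro!: always_eventually)
    show "filterlim ?b (at_left 1) sequentially"
      using b1 ab(2) by (auto simp: filterlim_at intro!: always_eventually)
  qed
  from filterlim_compose[OF conjunct2[OF L2[unfolded is_L2_path_integral_def]] this]
  have "(\<lambda>n. \<integral>\<^sup>+\<omega>. ennreal ((norm (?H n \<omega> - \<Gamma> z \<omega>))\<^sup>2) \<partial>M) \<longlonglongrightarrow> 0" by simp
  also have "(\<lambda>n. \<integral>\<^sup>+\<omega>. ennreal ((norm (?H n \<omega> - \<Gamma> z \<omega>))\<^sup>2) \<partial>M)
    = (\<lambda>n. \<integral>\<^sup>+\<omega>. ennreal ((norm (?D n \<omega> - \<Gamma> z \<omega>))\<^sup>2) \<partial>M)"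
  proof (intro ext nn_integral_cong_AE)
    fix n
    let ?p = "subpath (?a n) (?b n) \<gamma>"
    have "path ?p" using \<gamma>(1) ab[of n] by (intro path_subpath) auto
    moreover have "path_image ?p \<subseteq> uhp"
    proof -
      have "closed_segment (?a n) (?b n) \<subseteq> {0<..<1}"
        using ab[of n] by (intro closed_segment_subset) auto
      then show ?thesis using \<gamma>(4) by (auto simp: path_image_subpath_gen)
    qed
    ultimately show "AE \<omega> in M. ennreal ((norm (?H n \<omega> - \<Gamma> z \<omega>))\<^sup>2)
      = ennreal ((norm (?D n \<omega> - \<Gamma> z \<omega>))\<^sup>2)"
      using hol_path_integral_AE_eq_Gamma_increment[OF \<alpha> noise]
      by (auto elim!: eventually_mono)
  qed
  finally have lim2: "(\<lambda>n. \<integral>\<^sup>+\<omega>. ennreal ((norm (?D n \<omega> - \<Gamma> z \<omega>))\<^sup>2) \<partial>M) \<longlonglongrightarrow> 0" .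
  have "\<Gamma> z \<in> borel_measurable M" using L2 by (simp add: is_L2_path_integral_def)
  then have lim1: "(\<lambda>n. \<integral>\<^sup>+\<omega>. ennreal (norm (?D n \<omega> - \<Gamma> z \<omega>)) \<partial>M) \<longlonglongrightarrow> 0"
    by (intro L2_tendsto_0_imp_L1[OF _ lim2] borel_measurable_diff Gamma_increment_measurable[OF noise])
  show ?thesis
  proof (rule that[OF _ _ _ _ lim1])
    show "\<gamma> (?a n) \<in> uhp" "\<gamma> (?b n) \<in> uhp" for n using \<gamma>(4) ab[of n] by blast+
    show "(\<lambda>n. \<gamma> (?a n)) \<longlonglongrightarrow> 0" using contL[OF a0 _ ab(1)] \<gamma>(2) by (simp add: pathstart_def)
    show "(\<lambda>n. \<gamma> (?b n)) \<longlonglongrightarrow> z" using contL[OF b1 _ ab(2)] \<gamma>(3) by (simp add: pathfinish_def)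
  qed
qed

text \<open>The covariance of \<open>2 Re \<Gamma>\<^sub>z\<close> and \<open>2 Re \<Gamma>\<^sub>w\<close>: the second difference of the primitive for increments that start
at 0; the primitive vanishes at \<open>(0, 0)\<close>.\<close>

definition Gamma_cov :: "real \<Rightarrow> complex \<Rightarrow> complex \<Rightarrow> real" where
  "Gamma_cov \<alpha> z w =
     2 * Re (kernel_primitive \<alpha> z w - kernel_primitive \<alpha> z 0 - kernel_primitive \<alpha> 0 w)"

text \<open>The combination is the noise series with coefficients \<open>h\<^sub>k = \<Sum>\<^sub>j 2 c\<^sub>j g\<^sub>k(a\<^sub>j, b\<^sub>j)\<close>, and expanding \<open>|h\<^sub>k|\<^sup>2\<close> turns its
variance into a double sum of second differences of the primitive.\<close>

lemma Gamma_increment_combination_centered_gaussian: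
  fixes c :: "'i \<Rightarrow> real"
  assumes \<alpha>: "0 < \<alpha>" "\<alpha> < 1" and noise: "gaussian_noise M \<xi>1 \<xi>2"
    and I: "finite I" and ab: "\<And>j. j \<in> I \<Longrightarrow> a j \<in> uhp" "\<And>j. j \<in> I \<Longrightarrow> b j \<in> uhp"
  shows "centered_gaussian M (\<lambda>\<omega>. \<Sum>j\<in>I. c j * (2 * Re (Gamma_increment \<alpha> \<xi>1 \<xi>2 (a j) (b j) \<omega>)))
    (\<Sum>j\<in>I. \<Sum>l\<in>I. c j * c l * (2 * Re (kernel_primitive \<alpha> (b j) (b l) - kernel_primitive \<alpha> (b j) (a l)
      - kernel_primitive \<alpha> (a j) (b l) + kernel_primitive \<alpha> (a j) (a l))))"
proof -
  let ?\<zeta> = "complex_noise \<xi>1 \<xi>2" and ?g = "\<lambda>k j. f_increment \<alpha> k (a j) (b j)"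
  let ?K = "\<lambda>j l. kernel_primitive \<alpha> (b j) (b l) - kernel_primitive \<alpha> (b j) (a l)
      - kernel_primitive \<alpha> (a j) (b l) + kernel_primitive \<alpha> (a j) (a l)"
  let ?D = "\<lambda>\<omega>. \<Sum>j\<in>I. c j * (2 * Re (Gamma_increment \<alpha> \<xi>1 \<xi>2 (a j) (b j) \<omega>))"
  have Re_scale: "r * (2 * Re (x * y)) = Re (complex_of_real (2 * r) * x * y)" for r x y
  proof -
    have "complex_of_real (2 * r) * x * y = of_real (2 * r) * (x * y)" by (rule mult.assoc)
    then have "Re (complex_of_real (2 * r) * x * y) = 2 * r * Re (x * y)"
      using Re_complex_of_real[of "2 * r"] Im_complex_of_real[of "2 * r"] by (simp only: times_complex.sel)
    then show ?thesis by simp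
  qed
  have Re_scale': "Re (complex_of_real (2 * r * (2 * q)) * x) / 2 = r * q * (2 * Re x)" for r q x
    by (simp add: times_complex.sel(1)[of "complex_of_real (2 * r * (2 * q))" x] del: of_real_mult)
  define h where "h k = (\<Sum>j\<in>I. of_real (2 * c j) * ?g k j)" for k
  let ?s = "\<Sum>j\<in>I. \<Sum>l\<in>I. of_real (2 * c j * (2 * c l)) * ?K j l"
  have "(\<lambda>k. h k * cnj (h k)) sums ?s"
  proof -
    have "(\<lambda>k. \<Sum>j\<in>I. \<Sum>l\<in>I. of_real (2 * c j * (2 * c l)) * (?g k j * cnj (?g k l))) sums ?s"
      using ab by (intro sums_sum sums_mult f_increment_kernel \<alpha>)
    moreover have "(\<Sum>j\<in>I. \<Sum>l\<in>I. of_real (2 * c j * (2 * c l)) * (?g k j * cnj (?g k l))) = h k * cnj (h k)" for k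
      unfolding h_def cnj_sum sum_product by (intro sum.cong refl) simp
    ultimately show ?thesis by simp
  qed
  then have "(\<lambda>k. Re (h k * cnj (h k))) sums Re ?s" by (rule sums_Re)
  moreover have "Re (h k * cnj (h k)) = (norm (h k))\<^sup>2" for k
    unfolding complex_norm_square[symmetric] by simp
  ultimately have var: "(\<lambda>k. (norm (h k))\<^sup>2) sums Re ?s" by simp
  have main: "centered_gaussian M ?D
      (Re ?s / 2)"
  proof (rule noise_series_centered_gaussian[OF noise _ _ var])
    note [measurable] = Gamma_increment_measurable[OF noise]
    show "?D \<in> borel_measurable M"
      by measurable
    show "AE \<omega> in M. (\<lambda>k. Re (h k * ?\<zeta> k \<omega>)) sums
        ?D \<omega>"
      using Gamma'_AE_primitive[OF \<alpha>(1,2) noise]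
    proof eventually_elim
      case (elim \<omega>)
      then obtain F where "\<And>w z. w \<in> uhp \<Longrightarrow> z \<in> uhp \<Longrightarrow>
          (\<lambda>k. f_increment \<alpha> k w z * ?\<zeta> k \<omega>) sums (F z - F w)" by blast
      then have S: "(\<lambda>k. ?g k j * ?\<zeta> k \<omega>) sums Gamma_increment \<alpha> \<xi>1 \<xi>2 (a j) (b j) \<omega>" if "j \<in> I" for j
        using ab[OF that] unfolding Gamma_increment_def by (intro summable_sums) (rule sums_summable)
      have eq: "Re (h k * ?\<zeta> k \<omega>) = (\<Sum>j\<in>I. c j * (2 * Re (?g k j * ?\<zeta> k \<omega>)))" for k
        unfolding h_def sum_distrib_right Re_sum
        by (rule sum.cong[OF refl], rule Re_scale[symmetric])
      show ?case unfolding eq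
        by (rule sums_sum, rule sums_mult, rule sums_mult, rule sums_Re, rule S)
    qed
  qed
  have eq: "Re ?s / 2 = (\<Sum>j\<in>I. \<Sum>l\<in>I. c j * c l * (2 * Re (?K j l)))"
    unfolding Re_sum sum_divide_distrib
    by (rule sum.cong[OF refl], rule sum.cong[OF refl], rule Re_scale')
  show ?thesis using main unfolding eq .
qed

text \<open>Limit of the previous lemma: the starting points tend to 0 and the end points to the points of \<open>I\<close>, the
variances converge because the primitive is continuous on the closed half-plane, and the combinations
converge in \<open>L\<^sup>1\<close>.\<close>

lemma Gamma_combination_centered_gaussian:
  assumes \<alpha>: "0 < \<alpha>" "\<alpha> < 1" and noise: "gaussian_noise M \<xi>1 \<xi>2"
    and \<Gamma>: "is_Gamma_plus M \<alpha> \<xi>1 \<xi>2 \<Gamma>" and I: "finite I" "I \<subseteq> closure uhp"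
  shows "centered_gaussian M (\<lambda>\<omega>. \<Sum>z\<in>I. c z * (2 * Re (\<Gamma> z \<omega>)))
    (\<Sum>z\<in>I. \<Sum>w\<in>I. c z * c w * Gamma_cov \<alpha> z w)"
proof -
  interpret prob_space M by (rule gaussian_noiseD(1)[OF noise])
  let ?P = "kernel_primitive \<alpha>"
  have "\<forall>z\<in>I. \<exists>a b. (\<forall>n. a n \<in> uhp) \<and> (\<forall>n. b n \<in> uhp) \<and> a \<longlonglongrightarrow> 0 \<and> b \<longlonglongrightarrow> z \<and>
    (\<lambda>n. \<integral>\<^sup>+\<omega>. ennreal (norm (Gamma_increment \<alpha> \<xi>1 \<xi>2 (a n) (b n) \<omega> - \<Gamma> z \<omega>)) \<partial>M) \<longlonglongrightarrow> 0"
    (is "\<forall>z\<in>I. ?E z")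
  proof
    fix z assume "z \<in> I"
    then have "z \<in> closure uhp" using I(2) by blast
    then show "?E z" by (rule Gamma_L2_approximation[OF \<alpha>(1,2) noise \<Gamma>]) blast
  qed
  then obtain a b where ab: "\<And>z n. z \<in> I \<Longrightarrow> a z n \<in> uhp" "\<And>z n. z \<in> I \<Longrightarrow> b z n \<in> uhp"
    and a0: "\<And>z. z \<in> I \<Longrightarrow> a z \<longlonglongrightarrow> 0" and bz: "\<And>z. z \<in> I \<Longrightarrow> b z \<longlonglongrightarrow> z"
    and L1: "\<And>z. z \<in> I \<Longrightarrow> (\<lambda>n. \<integral>\<^sup>+\<omega>. ennreal (norm (Gamma_increment \<alpha> \<xi>1 \<xi>2 (a z n) (b z n) \<omega> - \<Gamma> z \<omega>)) \<partial>M) \<longlonglongrightarrow> 0"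
    unfolding bchoice_iff by blast
  let ?G = "\<lambda>z n. Gamma_increment \<alpha> \<xi>1 \<xi>2 (a z n) (b z n)"
  let ?K = "\<lambda>z w n. ?P (b z n) (b w n) - ?P (b z n) (a w n) - ?P (a z n) (b w n) + ?P (a z n) (a w n)"
  let ?X = "\<lambda>n \<omega>. \<Sum>z\<in>I. c z * (2 * Re (?G z n \<omega>))" and ?Y = "\<lambda>\<omega>. \<Sum>z\<in>I. c z * (2 * Re (\<Gamma> z \<omega>))"
  let ?A = "\<lambda>n. \<integral>\<^sup>+\<omega>. ennreal \<bar>?X n \<omega> - ?Y \<omega>\<bar> \<partial>M"
    and ?U = "\<lambda>n. \<Sum>z\<in>I. ennreal (\<bar>c z\<bar> * 2) * (\<integral>\<^sup>+\<omega>. ennreal (norm (?G z n \<omega> - \<Gamma> z \<omega>)) \<partial>M)"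
  have \<Gamma>_meas: "\<Gamma> z \<in> borel_measurable M" if "z \<in> I" for z
    using Gamma_measurable[OF \<Gamma>] that I(2) by blast
  note [measurable] = Gamma_increment_measurable[OF noise]
  show ?thesis
  proof (rule centered_gaussian_LIMSEQ_L1)
    show "centered_gaussian M (\<lambda>\<omega>. \<Sum>z\<in>I. c z * (2 * Re (?G z n \<omega>)))
        (\<Sum>z\<in>I. \<Sum>w\<in>I. c z * c w * (2 * Re (?K z w n)))" for n
      by (rule Gamma_increment_combination_centered_gaussian[OF \<alpha> noise I(1)]) (use ab in auto)
    show "(\<lambda>\<omega>. \<Sum>z\<in>I. c z * (2 * Re (\<Gamma> z \<omega>))) \<in> borel_measurable M"
      by (intro borel_measurable_sum borel_measurable_times borel_measurable_const
          measurable_compose[OF \<Gamma>_meas borel_measurable_Re])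
    show "(\<lambda>n. \<Sum>z\<in>I. \<Sum>w\<in>I. c z * c w * (2 * Re (?K z w n)))
        \<longlonglongrightarrow> (\<Sum>z\<in>I. \<Sum>w\<in>I. c z * c w * Gamma_cov \<alpha> z w)"
    proof (intro tendsto_sum tendsto_mult tendsto_const)
      fix z w assume zw: "z \<in> I" "w \<in> I"
      have cl: "0 \<in> closure uhp" "z \<in> closure uhp" "w \<in> closure uhp"
        using zw I(2) by (auto simp: closure_uhp)
      note T = tendsto_kernel_primitive[OF \<alpha>(1) _ _ _ _ always_eventually always_eventually]
      have "(\<lambda>n. 2 * Re (?K z w n)) \<longlonglongrightarrow> 2 * Re (?P z w - ?P z 0 - ?P 0 w + ?P 0 0)"
        by (intro tendsto_intros T allI ab bz a0 cl zw)
      moreover have "?P 0 0 = 0" by (simp add: kernel_primitive_def)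
      ultimately show "(\<lambda>n. 2 * Re (?K z w n)) \<longlonglongrightarrow> Gamma_cov \<alpha> z w"
        by (simp add: Gamma_cov_def)
    qed
    have "(\<lambda>n. ?U n)
        \<longlonglongrightarrow> (\<Sum>z\<in>I. ennreal (\<bar>c z\<bar> * 2) * 0)"
      by (intro tendsto_sum ennreal_tendsto_cmult L1) auto
    then have upper: "(\<lambda>n. ?U n)
        \<longlonglongrightarrow> 0" by simp
    show "(\<lambda>n. ?A n)
        \<longlonglongrightarrow> 0"
    proof (rule tendsto_sandwich[OF _ _ tendsto_const upper])
      show "\<forall>\<^sub>F n in sequentially.
        ?A n
        \<le> ?U n"
      proof (intro always_eventually allI)
        fix n
        have "?A n
            \<le> (\<integral>\<^sup>+\<omega>. (\<Sum>z\<in>I. ennreal (\<bar>c z\<bar> * 2) * ennreal (norm (?G z n \<omega> - \<Gamma> z \<omega>))) \<partial>M)"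
        proof (rule nn_integral_mono)
          fix \<omega>
          have "\<bar>?X n \<omega> - ?Y \<omega>\<bar>
              = \<bar>\<Sum>z\<in>I. (c z * 2) * Re (?G z n \<omega> - \<Gamma> z \<omega>)\<bar>"
            by (simp add: sum_subtractf[symmetric] algebra_simps)
          also have "\<dots> \<le> (\<Sum>z\<in>I. (\<bar>c z\<bar> * 2) * norm (?G z n \<omega> - \<Gamma> z \<omega>))"
            by (rule order_trans[OF sum_abs]) 
              (auto simp: abs_mult simp del: minus_complex.simps intro!: sum_mono mult_left_mono abs_Re_le_cmod)
          finally show "ennreal \<bar>?X n \<omega> - ?Y \<omega>\<bar>
              \<le> (\<Sum>z\<in>I. ennreal (\<bar>c z\<bar> * 2) * ennreal (norm (?G z n \<omega> - \<Gamma> z \<omega>)))"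
            by (simp add: ennreal_leI sum_ennreal flip: ennreal_mult)
        qed
        also have "\<dots> = ?U n"
          using \<Gamma>_meas by (subst nn_integral_sum) (auto intro!: sum.cong nn_integral_cmult)
        finally show "?A n
            \<le> ?U n" .
      qed
    qed simp
  qed
qed

section \<open>Finite-dimensional laws are determined by characteristic functions\<close>

lemma (in prob_space) integrable_bounded_mult_cos:
  fixes T f :: "'a \<Rightarrow> real"
  assumes "T \<in> borel_measurable M" "f \<in> borel_measurable M" "\<And>\<omega>. \<bar>T \<omega>\<bar> \<le> B"
  shows "integrable M (\<lambda>\<omega>. T \<omega> * cos (f \<omega>))"
proof (rule integrable_const_bound[of _ B])
  have "\<bar>T \<omega>\<bar> * \<bar>cos (f \<omega>)\<bar> \<le> B * 1" for \<omega>
    using assms(3)[of \<omega>] by (intro mult_mono) auto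
  then show "AE \<omega> in M. norm (T \<omega> * cos (f \<omega>)) \<le> B" by (simp add: abs_mult)
qed (use assms in measurable)

lemma (in prob_space) char_distr_density:
  fixes X T :: "'a \<Rightarrow> real"
  assumes X: "X \<in> borel_measurable M" and T: "T \<in> borel_measurable M" "\<And>\<omega>. 0 \<le> T \<omega>" "\<And>\<omega>. T \<omega> \<le> B"
  shows "char (distr (density M T) borel X) \<theta>
    = complex_of_real (\<integral>\<omega>. T \<omega> * cos (\<theta> * X \<omega> + 0) \<partial>M) + \<i> * complex_of_real (\<integral>\<omega>. T \<omega> * cos (\<theta> * X \<omega> + - pi / 2) \<partial>M)"
proof -
  let ?c = "\<lambda>\<omega>. T \<omega> * cos (\<theta> * X \<omega> + 0)" and ?s = "\<lambda>\<omega>. T \<omega> * cos (\<theta> * X \<omega> + - pi / 2)"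
  note [measurable] = X T(1)
  have "\<bar>T \<omega>\<bar> \<le> B" for \<omega> using T(2,3)[of \<omega>] by simp
  note I = integrable_bounded_mult_cos[OF T(1) _ this]
  have "char (distr (density M T) borel X) \<theta> = (\<integral>\<omega>. iexp (\<theta> * X \<omega>) \<partial>density M T)"
    by (rule char_distr_eq) measurable
  also have "\<dots> = (\<integral>\<omega>. T \<omega> *\<^sub>R iexp (\<theta> * X \<omega>) \<partial>M)"
    using T(2) by (intro integral_density) auto
  also have "\<dots> = (\<integral>\<omega>. complex_of_real (?c \<omega>) + \<i> * complex_of_real (?s \<omega>) \<partial>M)"
    by (intro Bochner_Integration.integral_cong refl)
      (simp add: complex_eq_iff Re_exp Im_exp cos_diff)
  also have "\<dots> = (\<integral>\<omega>. complex_of_real (?c \<omega>) \<partial>M) + (\<integral>\<omega>. \<i> * complex_of_real (?s \<omega>) \<partial>M)"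
    by (intro Bochner_Integration.integral_add integrable_mult_right integrable_of_real I) measurable
  finally show ?thesis by (simp only: integral_mult_right_zero integral_complex_of_real)
qed

text \<open>The integrals against cosines with all phases contain the characteristic function of \<open>X\<close> under the measure with
density \<open>T\<close>. Unless its mass is 0, this measure becomes a probability measure after division by the mass, and
Levy's uniqueness theorem applies.\<close>

lemma weighted_cos_integrals_determine_law:
  fixes X :: "'a \<Rightarrow> real" and Y :: "'b \<Rightarrow> real"
  assumes M: "prob_space M" and N: "prob_space N"
    and X: "X \<in> borel_measurable M" and Y: "Y \<in> borel_measurable N"
    and T: "T \<in> borel_measurable M" "\<And>\<omega>. 0 \<le> T \<omega>" "\<And>\<omega>. T \<omega> \<le> (B::real)"
    and S: "S \<in> borel_measurable N" "\<And>\<omega>. 0 \<le> S \<omega>" "\<And>\<omega>. S \<omega> \<le> (B::real)"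
    and eq: "\<And>\<theta> \<psi>. (\<integral>\<omega>. T \<omega> * cos (\<theta> * X \<omega> + \<psi>) \<partial>M) = (\<integral>\<omega>. S \<omega> * cos (\<theta> * Y \<omega> + \<psi>) \<partial>N)"
    and A: "A \<in> sets borel"
  shows "(\<integral>\<omega>. T \<omega> * indicator A (X \<omega>) \<partial>M) = (\<integral>\<omega>. S \<omega> * indicator A (Y \<omega>) \<partial>N)"
proof -
  interpret M: prob_space M by (rule M)
  interpret N: prob_space N by (rule N)
  note [measurable] = X Y T(1) S(1) A
  have intT: "integrable M T"
    using T by (intro M.integrable_const_bound[of _ B]) auto
  have intS: "integrable N S"
    using S by (intro N.integrable_const_bound[of _ B]) auto
  define m where "m = (\<integral>\<omega>. T \<omega> \<partial>M)"
  have m: "m = (\<integral>\<omega>. S \<omega> \<partial>N)" using eq[of 0 0] by (simp add: m_def)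
  have B: "0 \<le> B" using T(2,3) order_trans by blast
  have "m \<ge> 0" unfolding m_def using T(2) by (intro integral_nonneg_AE) auto
  show ?thesis
  proof (cases "m = 0")
    case True
    have "AE \<omega> in M. T \<omega> = 0" using integral_nonneg_eq_0_iff_AE[OF intT] T(2) True m_def by simp
    then have "(\<integral>\<omega>. T \<omega> * indicator A (X \<omega>) \<partial>M) = (\<integral>\<omega>. 0 \<partial>M)"
      by (intro integral_cong_AE) auto
    moreover have "AE \<omega> in N. S \<omega> = 0" using integral_nonneg_eq_0_iff_AE[OF intS] S(2) True m by simp
    then have "(\<integral>\<omega>. S \<omega> * indicator A (Y \<omega>) \<partial>N) = (\<integral>\<omega>. 0 \<partial>N)"
      by (intro integral_cong_AE) auto
    ultimately show ?thesis by simp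
  next
    case False
    with \<open>m \<ge> 0\<close> have m0: "m > 0" by simp
    have normalised: "real_distribution (distr (density L (\<lambda>\<omega>. R \<omega> / m)) borel Z)
        \<and> measure (distr (density L (\<lambda>\<omega>. R \<omega> / m)) borel Z) A = (\<integral>\<omega>. R \<omega> * indicator A (Z \<omega>) \<partial>L) / m"
      if L: "prob_space L" and R: "integrable L R" "\<And>\<omega>. 0 \<le> R \<omega>" "(\<integral>\<omega>. R \<omega> \<partial>L) = m"
        and Z: "Z \<in> borel_measurable L" for L :: "'c measure" and R Z
    proof -
      interpret L: prob_space L by (rule L)
      note [measurable] = Z borel_measurable_integrable[OF R(1)]
      let ?D = "density L (\<lambda>\<omega>. R \<omega> / m)"
      have em: "emeasure ?D E = ennreal ((\<integral>\<omega>. R \<omega> * indicator E \<omega> \<partial>L) / m)" if E: "E \<in> sets L" for E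
      proof -
        have iE: "integrable L (\<lambda>\<omega>. R \<omega> * indicator E \<omega>)"
          using integrable_mult_indicator[OF E R(1)] by (simp add: mult.commute)
        have "emeasure ?D E = (\<integral>\<^sup>+\<omega>. ennreal (R \<omega> * indicator E \<omega> / m) \<partial>L)"
          using E by (subst emeasure_density) (auto intro!: nn_integral_cong split: split_indicator)
        also have "\<dots> = ennreal (\<integral>\<omega>. R \<omega> * indicator E \<omega> / m \<partial>L)"
          using R(2) m0 iE by (intro nn_integral_eq_integral) auto
        finally show ?thesis by simp
      qed
      have "emeasure ?D (space ?D) = ennreal ((\<integral>\<omega>. R \<omega> * indicator (space L) \<omega> \<partial>L) / m)"
        using em[OF sets.top] by simp
      also have "(\<integral>\<omega>. R \<omega> * indicator (space L) \<omega> \<partial>L) = m"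
        unfolding R(3)[symmetric] by (intro Bochner_Integration.integral_cong) auto
      finally have "prob_space ?D" using m0 by (intro prob_spaceI) simp
      then have "real_distribution (distr ?D borel Z)"
        by (intro prob_space.real_distribution_distr) auto
      moreover have "measure (distr ?D borel Z) A = (\<integral>\<omega>. R \<omega> * indicator A (Z \<omega>) \<partial>L) / m"
      proof -
        have "measure (distr ?D borel Z) A = measure ?D (Z -` A \<inter> space L)"
          by (subst measure_distr) auto
        also have "\<dots> = (\<integral>\<omega>. R \<omega> * indicator (Z -` A \<inter> space L) \<omega> \<partial>L) / m"
          using R(2) m0 unfolding measure_def
          by (subst em) (auto intro!: enn2real_ennreal divide_nonneg_pos integral_nonneg_AE)
        also have "(\<integral>\<omega>. R \<omega> * indicator (Z -` A \<inter> space L) \<omega> \<partial>L) = (\<integral>\<omega>. R \<omega> * indicator A (Z \<omega>) \<partial>L)"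
          by (intro Bochner_Integration.integral_cong) (auto split: split_indicator)
        finally show ?thesis .
      qed
      ultimately show ?thesis by blast
    qed
    note nM = normalised[OF M intT T(2) m_def[symmetric] X]
    note nN = normalised[OF N intS S(2) m[symmetric] Y]
    have "distr (density M (\<lambda>\<omega>. T \<omega> / m)) borel X = distr (density N (\<lambda>\<omega>. S \<omega> / m)) borel Y"
    proof (rule Levy_uniqueness[OF conjunct1[OF nM] conjunct1[OF nN]], rule ext)
      fix \<theta>
      have E: "(\<integral>\<omega>. T \<omega> / m * cos (\<theta> * X \<omega> + \<psi>) \<partial>M) = (\<integral>\<omega>. S \<omega> / m * cos (\<theta> * Y \<omega> + \<psi>) \<partial>N)" for \<psi>
        using eq[of \<theta> \<psi>] by simp
      have bT: "0 \<le> T \<omega> / m" "T \<omega> / m \<le> B / m" for \<omega> using T m0 by (auto simp: divide_right_mono)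
      have bS: "0 \<le> S \<omega> / m" "S \<omega> / m \<le> B / m" for \<omega> using S m0 by (auto simp: divide_right_mono)
      have mT: "(\<lambda>\<omega>. T \<omega> / m) \<in> borel_measurable M" and mS: "(\<lambda>\<omega>. S \<omega> / m) \<in> borel_measurable N"
        by measurable
      show "char (distr (density M (\<lambda>\<omega>. T \<omega> / m)) borel X) \<theta>
          = char (distr (density N (\<lambda>\<omega>. S \<omega> / m)) borel Y) \<theta>"
        unfolding M.char_distr_density[OF X mT bT] N.char_distr_density[OF Y mS bS] E ..
    qed
    then have "(\<integral>\<omega>. T \<omega> * indicator A (X \<omega>) \<partial>M) / m = (\<integral>\<omega>. S \<omega> * indicator A (Y \<omega>) \<partial>N) / m"
      using conjunct2[OF nM] conjunct2[OF nN] by (simp only:)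
    then show ?thesis using m0 by simp
  qed
qed

text \<open>A uniqueness theorem in several variables from the one in a single variable. Fix the phase
\<open>s = \<Sum>\<^sub>j u\<^sub>j X\<^sub>j + \<phi>\<close> of all variables but \<open>X\<^sub>i\<close>. The tilted weight \<open>W (1 + cos s)\<close> is nonnegative, and by the formula
for the product of cosines its integrals against \<open>cos (\<theta> X\<^sub>i + \<psi>)\<close> are known; hence so are those against
indicators of \<open>X\<^sub>i\<close>. Subtracting the untilted case leaves the cosine integrals of the remaining variables
under the new weight \<open>W 1\<^sub>A(X\<^sub>i)\<close>. The induction therefore runs over all bounded weights.\<close>

lemma cos_integrals_determine_joint_law:
  fixes X :: "'t \<Rightarrow> 'a \<Rightarrow> real" and Y :: "'t \<Rightarrow> 'b \<Rightarrow> real" and W :: "'a \<Rightarrow> real" and V :: "'b \<Rightarrow> real"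
  assumes M: "prob_space M" and N: "prob_space N"
    and X: "\<And>j. X j \<in> borel_measurable M" and Y: "\<And>j. Y j \<in> borel_measurable N"
    and A: "\<And>j. A j \<in> sets borel" and J: "finite J"
    and W: "W \<in> borel_measurable M" "\<And>\<omega>. 0 \<le> W \<omega>" "\<And>\<omega>. W \<omega> \<le> B"
    and V: "V \<in> borel_measurable N" "\<And>\<omega>. 0 \<le> V \<omega>" "\<And>\<omega>. V \<omega> \<le> B"
    and eq: "\<And>u \<phi>. (\<integral>\<omega>. W \<omega> * cos ((\<Sum>j\<in>J. u j * X j \<omega>) + \<phi>) \<partial>M)
                   = (\<integral>\<omega>. V \<omega> * cos ((\<Sum>j\<in>J. u j * Y j \<omega>) + \<phi>) \<partial>N)"
  shows "(\<integral>\<omega>. W \<omega> * (\<Prod>j\<in>J. indicator (A j) (X j \<omega>)) \<partial>M)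
       = (\<integral>\<omega>. V \<omega> * (\<Prod>j\<in>J. indicator (A j) (Y j \<omega>)) \<partial>N)"
  using J W V eq
proof (induction J arbitrary: W V rule: finite_induct)
  case empty
  from empty(7)[of _ 0] show ?case by simp
next
  case (insert i J)
  interpret M: prob_space M by (rule M)
  interpret N: prob_space N by (rule N)
  note [measurable] = X Y A insert.prems(1) insert.prems(4)
  let ?x = "\<lambda>u \<omega>. \<Sum>j\<in>J. u j * X j \<omega>" and ?y = "\<lambda>u \<omega>. \<Sum>j\<in>J. u j * Y j \<omega>"
  have B: "0 \<le> B" using insert.prems(2,3) order_trans by blast
  have absW: "\<bar>W \<omega>\<bar> \<le> B" and absV: "\<bar>V \<omega>'\<bar> \<le> B" for \<omega> \<omega>'
    using insert.prems(2,3)[of \<omega>] insert.prems(5,6)[of \<omega>'] by auto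
  note IW = M.integrable_bounded_mult_cos[OF insert.prems(1) _ absW]
  note IV = N.integrable_bounded_mult_cos[OF insert.prems(4) _ absV]
  have eq: "(\<integral>\<omega>. W \<omega> * cos (?x u \<omega> + \<theta> * X i \<omega> + \<phi>) \<partial>M)
      = (\<integral>\<omega>. V \<omega> * cos (?y u \<omega> + \<theta> * Y i \<omega> + \<phi>) \<partial>N)" for u \<theta> \<phi>
  proof -
    have "(\<Sum>j\<in>insert i J. (u(i := \<theta>)) j * Z j) = (\<Sum>j\<in>J. u j * Z j) + \<theta> * Z i" for Z :: "'t \<Rightarrow> real"
    proof -
      have "(\<Sum>j\<in>J. (u(i := \<theta>)) j * Z j) = (\<Sum>j\<in>J. u j * Z j)"
        using insert.hyps(2) by (intro sum.cong) auto
      then show ?thesis using insert.hyps by (simp add: add.commute)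
    qed
    then show ?thesis using insert.prems(7)[of "u(i := \<theta>)" \<phi>] by simp
  qed
  have product_to_sum: "w * (1 + cos (s + \<phi>)) * cos (t + \<psi>)
      = w * cos (t + \<psi>) + (w * cos (s + t + (\<phi> + \<psi>)) / 2 + w * cos (s + - t + (\<phi> - \<psi>)) / 2)"
    for w s t \<phi> \<psi> :: real
  proof -
    have e: "s + t + (\<phi> + \<psi>) = (s + \<phi>) + (t + \<psi>)" "s + - t + (\<phi> - \<psi>) = (s + \<phi>) - (t + \<psi>)"
      by simp_all
    show ?thesis unfolding e cos_add[of "s + \<phi>"] cos_diff[of "s + \<phi>"] by (simp add: field_simps)
  qed
  have tilted: "(\<integral>\<omega>. W \<omega> * (1 + cos (?x u \<omega> + \<phi>)) * indicator (A i) (X i \<omega>) \<partial>M)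
      = (\<integral>\<omega>. V \<omega> * (1 + cos (?y u \<omega> + \<phi>)) * indicator (A i) (Y i \<omega>) \<partial>N)" for u \<phi>
  proof (rule weighted_cos_integrals_determine_law[OF M N X Y _ _ _ _ _ _ _ A, where B = "B * 2"])
    fix \<theta> \<psi>
    have *: "(\<integral>\<omega>. U \<omega> * (1 + cos (z \<omega> + \<phi>)) * cos (\<theta> * Z \<omega> + \<psi>) \<partial>L)
        = (\<integral>\<omega>. U \<omega> * cos (\<theta> * Z \<omega> + \<psi>) \<partial>L) + ((\<integral>\<omega>. U \<omega> * cos (z \<omega> + \<theta> * Z \<omega> + (\<phi> + \<psi>)) \<partial>L) / 2
          + (\<integral>\<omega>. U \<omega> * cos (z \<omega> + (- \<theta>) * Z \<omega> + (\<phi> - \<psi>)) \<partial>L) / 2)"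
      if I: "\<And>f. f \<in> borel_measurable L \<Longrightarrow> integrable L (\<lambda>\<omega>. U \<omega> * cos (f \<omega>))"
        and [measurable]: "z \<in> borel_measurable L" "Z \<in> borel_measurable L"
      for L :: "'c measure" and U z Z
      unfolding product_to_sum
      by (subst Bochner_Integration.integral_add Bochner_Integration.integral_divide_zero
          | (intro I Bochner_Integration.integrable_add integrable_divide; measurable) | simp)+
    show "(\<integral>\<omega>. W \<omega> * (1 + cos (?x u \<omega> + \<phi>)) * cos (\<theta> * X i \<omega> + \<psi>) \<partial>M)
        = (\<integral>\<omega>. V \<omega> * (1 + cos (?y u \<omega> + \<phi>)) * cos (\<theta> * Y i \<omega> + \<psi>) \<partial>N)"
      using eq[of "\<lambda>_. 0" \<theta> \<psi>] eq[of u \<theta> "\<phi> + \<psi>"] eq[of u "- \<theta>" "\<phi> - \<psi>"]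
      by (subst (1 2) *) (auto intro: IW IV)
  next
    have cos_plus_1: "0 \<le> 1 + cos x" for x :: real using cos_ge_minus_one[of x] by linarith
    have "W \<omega> * (1 + cos (?x u \<omega> + \<phi>)) \<le> B * 2" for \<omega>
      using insert.prems(2,3)[of \<omega>] B by (intro mult_mono) (auto simp: cos_plus_1)
    moreover have "V \<omega> * (1 + cos (?y u \<omega> + \<phi>)) \<le> B * 2" for \<omega>
      using insert.prems(5,6)[of \<omega>] B by (intro mult_mono) (auto simp: cos_plus_1)
    moreover have "0 \<le> W \<omega> * (1 + cos (?x u \<omega> + \<phi>))" for \<omega>
      by (intro mult_nonneg_nonneg insert.prems cos_plus_1)
    moreover have "0 \<le> V \<omega> * (1 + cos (?y u \<omega> + \<phi>))" for \<omega>
      by (intro mult_nonneg_nonneg insert.prems cos_plus_1)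
    ultimately show "\<And>\<omega>. W \<omega> * (1 + cos (?x u \<omega> + \<phi>)) \<le> B * 2"
      "\<And>\<omega>. V \<omega> * (1 + cos (?y u \<omega> + \<phi>)) \<le> B * 2"
      "\<And>\<omega>. 0 \<le> W \<omega> * (1 + cos (?x u \<omega> + \<phi>))" "\<And>\<omega>. 0 \<le> V \<omega> * (1 + cos (?y u \<omega> + \<phi>))" by blast+
  qed measurable
  let ?W = "\<lambda>\<omega>. W \<omega> * indicator (A i) (X i \<omega>)" and ?V = "\<lambda>\<omega>. V \<omega> * indicator (A i) (Y i \<omega>)"
  have boundW: "0 \<le> ?W \<omega>" "?W \<omega> \<le> B" "\<bar>?W \<omega>\<bar> \<le> B" for \<omega>
    using insert.prems(2,3)[of \<omega>] B by (auto split: split_indicator)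
  have boundV: "0 \<le> ?V \<omega>" "?V \<omega> \<le> B" "\<bar>?V \<omega>\<bar> \<le> B" for \<omega>
    using insert.prems(5,6)[of \<omega>] B by (auto split: split_indicator)
  have "(\<integral>\<omega>. ?W \<omega> * (\<Prod>j\<in>J. indicator (A j) (X j \<omega>)) \<partial>M) = (\<integral>\<omega>. ?V \<omega> * (\<Prod>j\<in>J. indicator (A j) (Y j \<omega>)) \<partial>N)"
  proof (rule insert.IH)
    fix u \<phi>
    \<comment> \<open>The phase \<open>pi / 2\<close> with zero coefficients makes the cosine vanish: the untilted case.\<close>
    have mass: "(\<integral>\<omega>. ?W \<omega> \<partial>M) = (\<integral>\<omega>. ?V \<omega> \<partial>N)" using tilted[of "\<lambda>_. 0" "pi / 2"] by simp
    have iW: "integrable M ?W" "integrable M (\<lambda>\<omega>. ?W \<omega> * cos (?x u \<omega> + \<phi>))"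
      by (rule M.integrable_const_bound[of _ B], use boundW in simp, simp)
        (rule M.integrable_bounded_mult_cos[OF _ _ boundW(3)]; measurable)
    have iV: "integrable N ?V" "integrable N (\<lambda>\<omega>. ?V \<omega> * cos (?y u \<omega> + \<phi>))"
      by (rule N.integrable_const_bound[of _ B], use boundV in simp, simp)
        (rule N.integrable_bounded_mult_cos[OF _ _ boundV(3)]; measurable)
    have "(\<integral>\<omega>. W \<omega> * (1 + cos (?x u \<omega> + \<phi>)) * indicator (A i) (X i \<omega>) \<partial>M)
        = (\<integral>\<omega>. ?W \<omega> \<partial>M) + (\<integral>\<omega>. ?W \<omega> * cos (?x u \<omega> + \<phi>) \<partial>M)"
      by (subst Bochner_Integration.integral_add[OF iW, symmetric])
        (auto intro!: Bochner_Integration.integral_cong simp: algebra_simps)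
    moreover have "(\<integral>\<omega>. V \<omega> * (1 + cos (?y u \<omega> + \<phi>)) * indicator (A i) (Y i \<omega>) \<partial>N)
        = (\<integral>\<omega>. ?V \<omega> \<partial>N) + (\<integral>\<omega>. ?V \<omega> * cos (?y u \<omega> + \<phi>) \<partial>N)"
      by (subst Bochner_Integration.integral_add[OF iV, symmetric])
        (auto intro!: Bochner_Integration.integral_cong simp: algebra_simps)
    ultimately show "(\<integral>\<omega>. ?W \<omega> * cos (?x u \<omega> + \<phi>) \<partial>M) = (\<integral>\<omega>. ?V \<omega> * cos (?y u \<omega> + \<phi>) \<partial>N)"
      using tilted[of u \<phi>] mass by simp
  qed (use boundW boundV in auto)
  then show ?case using insert.hyps by (simp add: mult_ac)
qed

lemma process_law_eqI:
  fixes X :: "'t \<Rightarrow> 'a \<Rightarrow> real" and Y :: "'t \<Rightarrow> 'b \<Rightarrow> real"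
  assumes M: "prob_space M" and N: "prob_space N"
    and X: "\<And>j. X j \<in> borel_measurable M" and Y: "\<And>j. Y j \<in> borel_measurable N"
    and eq: "\<And>J u. finite J \<Longrightarrow> (\<integral>\<omega>. iexp (\<Sum>j\<in>J. u j * X j \<omega>) \<partial>M) = (\<integral>\<omega>. iexp (\<Sum>j\<in>J. u j * Y j \<omega>) \<partial>N)"
  shows "process_law M X = process_law N Y"
proof -
  interpret M: prob_space M by (rule M)
  interpret N: prob_space N by (rule N)
  let ?P = "PiM UNIV (\<lambda>_. borel) :: ('t \<Rightarrow> real) measure"
  have meas: "(\<lambda>\<omega> t. Z t \<omega>) \<in> measurable L ?P" if "\<And>j. Z j \<in> borel_measurable L" for L :: "'c measure" and Z
    using that by (intro measurable_PiM_single') auto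
  have emb: "emeasure (process_law L Z) (prod_emb UNIV (\<lambda>_. borel) J (Pi\<^sub>E J A))
      = ennreal (\<integral>\<omega>. (1::real) * (\<Prod>j\<in>J. indicator (A j) (Z j \<omega>)) \<partial>L)"
    if L: "prob_space L" and Z[measurable]: "\<And>j. Z j \<in> borel_measurable L" and J: "finite J" and A[measurable]: "\<And>j. A j \<in> sets borel"
    for L :: "'c measure" and Z :: "'t \<Rightarrow> 'c \<Rightarrow> real" and J A
  proof -
    interpret L: prob_space L by (rule L)
    let ?S = "{\<omega> \<in> space L. \<forall>j\<in>J. Z j \<omega> \<in> A j}"
    have S: "?S \<in> sets L" using J by measurable
    have "emeasure (process_law L Z) (prod_emb UNIV (\<lambda>_. borel) J (Pi\<^sub>E J A))
        = emeasure L ((\<lambda>\<omega> t. Z t \<omega>) -` prod_emb UNIV (\<lambda>_. borel) J (Pi\<^sub>E J A) \<inter> space L)"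
      unfolding process_law_def by (rule emeasure_distr[OF meas[OF Z]]) (use J A in \<open>auto intro!: sets_PiM_I\<close>)
    also have "(\<lambda>\<omega> t. Z t \<omega>) -` prod_emb UNIV (\<lambda>_. borel) J (Pi\<^sub>E J A) \<inter> space L = ?S"
      by (auto simp: prod_emb_def PiE_def Pi_def)
    also have "emeasure L ?S = ennreal (measure L ?S)" by (rule L.emeasure_eq_measure)
    also have "measure L ?S = (\<integral>\<omega>. (indicator ?S \<omega> :: real) \<partial>L)" using S by simp
    also have "(\<integral>\<omega>. (indicator ?S \<omega> :: real) \<partial>L) = (\<integral>\<omega>. 1 * (\<Prod>j\<in>J. indicator (A j) (Z j \<omega>)) \<partial>L)"
    proof (rule Bochner_Integration.integral_cong[OF refl])
      fix \<omega> assume \<omega>: "\<omega> \<in> space L"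
      show "indicator ?S \<omega> = (1::real) * (\<Prod>j\<in>J. indicator (A j) (Z j \<omega>))"
      proof (cases "\<forall>j\<in>J. Z j \<omega> \<in> A j")
        case True
        then have "(\<Prod>j\<in>J. indicator (A j) (Z j \<omega>)) = (\<Prod>j\<in>J. (1::real))" by (intro prod.cong) auto
        with True \<omega> show ?thesis by simp
      next
        case False
        then show ?thesis using J by (auto simp: indicator_def prod_zero_iff)
      qed
    qed
    finally show ?thesis .
  qed
  show ?thesis
  proof (rule measure_eqI_PiM_infinite[where I = UNIV and M = "\<lambda>_. borel"])
    show "sets (process_law M X) = sets ?P" "sets (process_law N Y) = sets ?P"
      by (auto simp: process_law_def)
    show "finite_measure (process_law M X)"
      unfolding process_law_def using M.prob_space_distr[OF meas[OF X]] by (simp add: prob_space_def)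
    fix A' and J :: "'t set" assume J: "finite J" "J \<subseteq> UNIV" and A': "\<And>j. j \<in> J \<Longrightarrow> A' j \<in> sets (borel :: real measure)"
    define A where "A j = (if j \<in> J then A' j else {})" for j
    have A: "A j \<in> sets borel" for j using A' by (simp add: A_def)
    have PiE: "Pi\<^sub>E J A' = Pi\<^sub>E J A" by (intro PiE_cong) (simp add: A_def)
    have "(\<integral>\<omega>. (1::real) * (\<Prod>j\<in>J. indicator (A j) (X j \<omega>)) \<partial>M) = (\<integral>\<omega>. 1 * (\<Prod>j\<in>J. indicator (A j) (Y j \<omega>)) \<partial>N)"
    proof (rule cos_integrals_determine_joint_law[OF M N X Y A J(1), where B = 1])
      fix u \<phi>
      have cos_Re: "(\<integral>\<omega>. 1 * cos (z \<omega> + \<phi>) \<partial>L) = Re (iexp \<phi> * (\<integral>\<omega>. iexp (z \<omega>) \<partial>L))"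
        if L: "prob_space L" and z[measurable]: "z \<in> borel_measurable L" for L :: "'c measure" and z
      proof -
        have i: "integrable L (\<lambda>\<omega>. iexp (z \<omega>))" using z by (intro prob_space.integrable_iexp[OF L]) auto
        have "iexp \<phi> * (\<integral>\<omega>. iexp (z \<omega>) \<partial>L) = (\<integral>\<omega>. iexp \<phi> * iexp (z \<omega>) \<partial>L)" by simp
        also have "Re \<dots> = (\<integral>\<omega>. Re (iexp \<phi> * iexp (z \<omega>)) \<partial>L)"
          by (rule integral_Re[symmetric]) (use i in simp)
        finally show ?thesis by (simp add: Re_exp Im_exp cos_add mult.commute)
      qed
      show "(\<integral>\<omega>. 1 * cos ((\<Sum>j\<in>J. u j * X j \<omega>) + \<phi>) \<partial>M) = (\<integral>\<omega>. 1 * cos ((\<Sum>j\<in>J. u j * Y j \<omega>) + \<phi>) \<partial>N)"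
        using X Y by (subst cos_Re[OF M], simp, subst cos_Re[OF N], simp) (simp only: eq[OF J(1)])
    qed auto
    then show "emeasure (process_law M X) (prod_emb UNIV (\<lambda>_. borel) J (Pi\<^sub>E J A'))
        = emeasure (process_law N Y) (prod_emb UNIV (\<lambda>_. borel) J (Pi\<^sub>E J A'))"
      unfolding PiE emb[OF M X J(1) A] emb[OF N Y J(1) A] by simp
  qed
qed

section \<open>The Kolmogorov-Chentsov criterion in the plane\<close>

definition grid_point :: "nat \<Rightarrow> int \<Rightarrow> int \<Rightarrow> complex" where
  "grid_point n i j = Complex (of_int i / 2 ^ n) (of_int j / 2 ^ n)"

definition dyadic_floor :: "nat \<Rightarrow> complex \<Rightarrow> complex" where
  "dyadic_floor n z = grid_point n \<lfloor>2 ^ n * Re z\<rfloor> \<lfloor>2 ^ n * Im z\<rfloor>"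

lemma grid_point_neighbour_dist:
  assumes "\<bar>d\<bar> \<le> 1" "\<bar>e\<bar> \<le> 1"
  shows "norm (grid_point n i j - grid_point n (i + d) (j + e)) \<le> 2 * (1/2) ^ n"
proof -
  have "norm (grid_point n i j - grid_point n (i + d) (j + e)) \<le> \<bar>of_int d / 2 ^ n\<bar> + \<bar>of_int e / 2 ^ n\<bar>"
    by (rule order_trans[OF cmod_le]) (simp add: grid_point_def add_divide_distrib)
  also have "\<dots> \<le> 1 / 2 ^ n + 1 / 2 ^ n"
    using assms by (intro add_mono) (auto simp: abs_divide divide_le_cancel simp flip: of_int_abs)
  finally show ?thesis by (simp add: power_divide)
qed

lemma dyadic_floor_dist: "norm (dyadic_floor n z - z) \<le> 2 * (1/2) ^ n"
proof -
  have *: "\<bar>of_int \<lfloor>2 ^ n * x\<rfloor> / 2 ^ n - x\<bar> \<le> (1/2) ^ n" for x :: real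
  proof -
    have "\<bar>of_int \<lfloor>2 ^ n * x\<rfloor> - 2 ^ n * x\<bar> \<le> 1" by linarith
    then have "\<bar>of_int \<lfloor>2 ^ n * x\<rfloor> - 2 ^ n * x\<bar> / 2 ^ n \<le> 1 / 2 ^ n" by (intro divide_right_mono) auto
    moreover have "of_int \<lfloor>2 ^ n * x\<rfloor> / 2 ^ n - x = (of_int \<lfloor>2 ^ n * x\<rfloor> - 2 ^ n * x) / 2 ^ n"
      by (simp add: field_simps)
    moreover have "\<bar>(of_int \<lfloor>2 ^ n * x\<rfloor> - 2 ^ n * x) / 2 ^ n\<bar> = \<bar>of_int \<lfloor>2 ^ n * x\<rfloor> - 2 ^ n * x\<bar> / 2 ^ n"
      by (simp only: abs_divide power_abs abs_numeral)
    moreover have "(1/2::real) ^ n = 1 / 2 ^ n" by (simp add: power_divide)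
    ultimately show ?thesis by (simp only:)
  qed
  show ?thesis
    using cmod_le[of "dyadic_floor n z - z"] *[of "Re z"] *[of "Im z"]
    by (simp add: dyadic_floor_def grid_point_def)
qed

lemma floor_double:
  fixes x :: real
  shows "\<lfloor>2 * x\<rfloor> = 2 * \<lfloor>x\<rfloor> \<or> \<lfloor>2 * x\<rfloor> = 2 * \<lfloor>x\<rfloor> + 1"
proof (cases "2 * x < 2 * of_int \<lfloor>x\<rfloor> + 1")
  case True
  then have "\<lfloor>2 * x\<rfloor> = 2 * \<lfloor>x\<rfloor>" by (intro floor_unique) auto
  then show ?thesis ..
next
  case False
  have "2 * x < 2 * (of_int \<lfloor>x\<rfloor> + 1)" 
    by (intro mult_strict_left_mono real_of_int_floor_add_one_gt) auto
  with False have "\<lfloor>2 * x\<rfloor> = 2 * \<lfloor>x\<rfloor> + 1" by (intro floor_unique) auto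
  then show ?thesis ..
qed

lemma dyadic_power_scale:
  assumes "0 < \<delta>" "\<delta> \<le> (1::real)"
  obtains n where "\<delta> \<le> (1/2) ^ n" "(1/2) ^ Suc n < \<delta>"
proof -
  have ex: "\<exists>n. (1/2::real) ^ n < \<delta>" using real_arch_pow_inv[of \<delta> "1/2"] assms by simp
  define m where "m = (LEAST n. (1/2::real) ^ n < \<delta>)"
  have m: "(1/2) ^ m < \<delta>" unfolding m_def by (rule LeastI_ex[OF ex])
  then obtain n where n: "m = Suc n" using assms by (cases m) auto
  have "\<not> (1/2) ^ n < \<delta>" using not_less_Least[of n "\<lambda>n. (1/2::real) ^ n < \<delta>"] n m_def by auto
  then show ?thesis using that[of n] m n by auto
qed

text \<open>Chaining: \<open>dyadic_floor n z\<close> and \<open>dyadic_floor (n + 1) z\<close> are neighbours in the grid of level \<open>n + 1\<close>, so the values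
there form a Cauchy sequence with geometric tail; and two points at distance at most \<open>2\<^sup>-\<^sup>n\<close> have neighbouring
grid points at level \<open>n\<close>. Defining the limit by rounding down avoids a separate extension by continuity.
Points at distance more than 1 are handled by boundedness, which on a bounded set follows from finitely
many values at level 0.\<close>

lemma dyadic_increments_imp_hoelder:
  fixes h :: "complex \<Rightarrow> real"
  assumes \<beta>: "\<beta> > 0"
    and inc: "\<And>R. \<exists>K\<ge>0. \<forall>n i j d e. \<bar>i\<bar> \<le> int R * 2 ^ n \<longrightarrow> \<bar>j\<bar> \<le> int R * 2 ^ n \<longrightarrow> \<bar>d\<bar> \<le> 1 \<longrightarrow> \<bar>e\<bar> \<le> 1 \<longrightarrow>
      \<bar>h (grid_point n i j) - h (grid_point n (i + d) (j + e))\<bar> \<le> K * (2 powr - \<beta>) ^ n"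
  shows "hoelder_on UNIV \<beta> (\<lambda>z. lim (\<lambda>n. h (dyadic_floor n z)))"
  unfolding hoelder_on_def
proof
  fix R :: real
  let ?g = "\<lambda>z. lim (\<lambda>n. h (dyadic_floor n z))"
  define r where "r = 2 powr - \<beta>"
  have r: "0 < r" "r < 1" using \<beta> by (auto simp: r_def powr_less_one)
  \<comment> \<open>The extra 1 keeps the indices \<open>\<lfloor>2 ^ n * x\<rfloor>\<close> in the box also for negative \<open>x\<close>.\<close>
  define R' where "R' = nat \<lceil>R\<rceil> + 1"
  obtain K where K: "K \<ge> 0" "\<And>n i j d e. \<bar>i\<bar> \<le> int R' * 2 ^ n \<Longrightarrow> \<bar>j\<bar> \<le> int R' * 2 ^ n \<Longrightarrow> \<bar>d\<bar> \<le> 1 \<Longrightarrow> \<bar>e\<bar> \<le> 1 \<Longrightarrow>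
      \<bar>h (grid_point n i j) - h (grid_point n (i + d) (j + e))\<bar> \<le> K * r ^ n"
    using inc[of R'] unfolding r_def by blast
  have box: "\<bar>\<lfloor>2 ^ n * x\<rfloor>\<bar> \<le> int R' * 2 ^ n" if "\<bar>x\<bar> \<le> R" for x n
  proof -
    have "real R' = real (nat \<lceil>R\<rceil>) + 1" by (simp add: R'_def)
    then have x: "\<bar>x\<bar> \<le> real R' - 1" using that real_nat_ceiling_ge[of R] by linarith
    have "2 ^ n * \<bar>x\<bar> \<le> 2 ^ n * (real R' - 1)" using x by (intro mult_left_mono) auto
    moreover have "(1::real) \<le> 2 ^ n" by simp
    moreover have "2 ^ n * (real R' - 1) = real R' * 2 ^ n - 2 ^ n" by (simp add: algebra_simps)
    ultimately have "2 ^ n * \<bar>x\<bar> + 1 \<le> real R' * 2 ^ n" by linarith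
    moreover have "\<bar>2 ^ n * x\<bar> = 2 ^ n * \<bar>x\<bar>" by (simp add: abs_mult)
    ultimately have "\<bar>real_of_int \<lfloor>2 ^ n * x\<rfloor>\<bar> \<le> real_of_int (int R' * 2 ^ n)"
      by simp linarith
    then show ?thesis by linarith
  qed
  have coord: "\<bar>Re z\<bar> \<le> R" "\<bar>Im z\<bar> \<le> R" if "norm z \<le> R" for z
    using that abs_Re_le_cmod[of z] abs_Im_le_cmod[of z] by auto
  have refine: "\<bar>h (dyadic_floor (Suc n) z) - h (dyadic_floor n z)\<bar> \<le> K * r ^ Suc n" if z: "norm z \<le> R" for n z
  proof -
    let ?i = "\<lfloor>2 ^ n * Re z\<rfloor>" and ?j = "\<lfloor>2 ^ n * Im z\<rfloor>"
    let ?i' = "\<lfloor>2 ^ Suc n * Re z\<rfloor>" and ?j' = "\<lfloor>2 ^ Suc n * Im z\<rfloor>"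
    have "\<bar>2 * ?i - ?i'\<bar> \<le> 1" "\<bar>2 * ?j - ?j'\<bar> \<le> 1"
      using floor_double[of "2 ^ n * Re z"] floor_double[of "2 ^ n * Im z"] by (auto simp: mult.assoc)
    from K(2)[OF box[OF coord(1)[OF z], of "Suc n"] box[OF coord(2)[OF z], of "Suc n"] this]
    have "\<bar>h (dyadic_floor (Suc n) z) - h (grid_point (Suc n) (2 * ?i) (2 * ?j))\<bar> \<le> K * r ^ Suc n"
      by (simp add: dyadic_floor_def)
    moreover have "grid_point (Suc n) (2 * ?i) (2 * ?j) = dyadic_floor n z"
      by (simp add: dyadic_floor_def grid_point_def)
    ultimately show ?thesis by simp
  qed
  define K' where "K' = K / (1 - r)"
  have K': "K' \<ge> 0" using K r by (simp add: K'_def)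
  have conv: "(\<lambda>n. h (dyadic_floor n z)) \<longlonglongrightarrow> ?g z" if z: "norm z \<le> R" for z
  proof -
    have "summable (\<lambda>n. h (dyadic_floor (Suc n) z) - h (dyadic_floor n z))"
    proof (rule summable_comparison_test')
      show "summable (\<lambda>n. K * r ^ Suc n)"
        using r by (intro summable_mult summable_Suc_iff[THEN iffD2] summable_geometric) auto
      show "norm (h (dyadic_floor (Suc n) z) - h (dyadic_floor n z)) \<le> K * r ^ Suc n" for n
        using refine[OF z] by simp
    qed
    then have "convergent (\<lambda>n. \<Sum>k<n. h (dyadic_floor (Suc k) z) - h (dyadic_floor k z))"
      by (simp add: summable_iff_convergent)
    then have "convergent (\<lambda>n. h (dyadic_floor n z) - h (dyadic_floor 0 z))"
      unfolding sum_lessThan_telescope[of "\<lambda>n. h (dyadic_floor n z)"] .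
    then have "convergent (\<lambda>n. h (dyadic_floor n z))" by (simp add: convergent_diff_const_right_iff)
    then show ?thesis by (rule convergent_LIMSEQ_iff[THEN iffD1])
  qed
  have tail: "\<bar>?g z - h (dyadic_floor n z)\<bar> \<le> K' * r ^ n" if z: "norm z \<le> R" for n z
  proof -
    have "\<bar>h (dyadic_floor (n + k) z) - h (dyadic_floor n z)\<bar> \<le> K' * (r ^ n - r ^ (n + k))" for k
    proof (induction k)
      case (Suc k)
      have "K * r ^ Suc (n + k) \<le> K * r ^ (n + k)"
        using K r by (intro mult_left_mono power_decreasing) auto
      also have "\<dots> = K' * (r ^ (n + k) - r ^ Suc (n + k))"
        using r by (simp add: K'_def field_simps)
      finally have "K * r ^ Suc (n + k) \<le> K' * (r ^ (n + k) - r ^ Suc (n + k))" .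
      then show ?case using Suc refine[OF z, of "n + k"] by (simp add: algebra_simps)
    qed simp
    moreover have "K' * (r ^ n - r ^ (n + k)) \<le> K' * r ^ n" for k
      using K' r by (intro mult_left_mono) auto
    ultimately have b: "\<bar>h (dyadic_floor (n + k) z) - h (dyadic_floor n z)\<bar> \<le> K' * r ^ n" for k
      by (rule order_trans)
    have "(\<lambda>k. h (dyadic_floor (n + k) z)) \<longlonglongrightarrow> ?g z"
      using LIMSEQ_ignore_initial_segment[OF conv[OF z], of n] by (simp add: add.commute)
    then have "(\<lambda>k. \<bar>h (dyadic_floor (n + k) z) - h (dyadic_floor n z)\<bar>) \<longlonglongrightarrow> \<bar>?g z - h (dyadic_floor n z)\<bar>"
      by (intro tendsto_intros)
    then show ?thesis by (rule LIMSEQ_le_const2) (use b in auto)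
  qed
  have close: "\<bar>?g z - ?g w\<bar> \<le> (2 * K' + K) * r ^ n"
    if z: "norm z \<le> R" and w: "norm w \<le> R" and zw: "norm (z - w) \<le> (1/2) ^ n" for z w n
  proof -
    have floors: "\<bar>\<lfloor>2 ^ n * y\<rfloor> - \<lfloor>2 ^ n * x\<rfloor>\<bar> \<le> 1" if "\<bar>x - y\<bar> \<le> (1/2) ^ n" for x y :: real
    proof -
      have "2 ^ n * \<bar>x - y\<bar> \<le> 2 ^ n * (1/2) ^ n" using that by (intro mult_left_mono) auto
      moreover have "2 ^ n * (1/2::real) ^ n = 1" by (simp flip: power_mult_distrib)
      moreover have "2 ^ n * \<bar>x - y\<bar> = \<bar>2 ^ n * x - 2 ^ n * y\<bar>" by (simp add: abs_mult flip: right_diff_distrib)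
      ultimately show ?thesis by linarith
    qed
    have "\<bar>Re z - Re w\<bar> \<le> (1/2) ^ n" "\<bar>Im z - Im w\<bar> \<le> (1/2) ^ n"
      using zw abs_Re_le_cmod[of "z - w"] abs_Im_le_cmod[of "z - w"] by auto
    from K(2)[OF box[OF coord(1)[OF z], of n] box[OF coord(2)[OF z], of n] floors[OF this(1)] floors[OF this(2)]]
    have "\<bar>h (dyadic_floor n z) - h (dyadic_floor n w)\<bar> \<le> K * r ^ n" by (simp add: dyadic_floor_def)
    then show ?thesis using tail[OF z, of n] tail[OF w, of n] by (simp add: algebra_simps)
  qed
  define B where "B = (\<Sum>(i, j)\<in>{- int R'..int R'} \<times> {- int R'..int R'}. \<bar>h (grid_point 0 i j)\<bar>)"
  have bounded: "\<bar>?g z\<bar> \<le> B + K'" if z: "norm z \<le> R" for z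
  proof -
    have "(\<lfloor>2 ^ 0 * Re z\<rfloor>, \<lfloor>2 ^ 0 * Im z\<rfloor>) \<in> {- int R'..int R'} \<times> {- int R'..int R'}"
      using box[OF coord(1)[OF z], of 0] box[OF coord(2)[OF z], of 0] by auto
    from member_le_sum[OF this, of "\<lambda>(i, j). \<bar>h (grid_point 0 i j)\<bar>"]
    have "\<bar>h (dyadic_floor 0 z)\<bar> \<le> B" by (auto simp: B_def dyadic_floor_def)
    then show ?thesis using tail[OF z, of 0] by simp
  qed
  define L where "L = max ((2 * K' + K) * 2 powr \<beta>) (2 * (B + K'))"
  show "\<exists>L. \<forall>z\<in>UNIV. \<forall>w\<in>UNIV. norm z \<le> R \<and> norm w \<le> R \<longrightarrow> \<bar>?g z - ?g w\<bar> \<le> L * norm (z - w) powr \<beta>"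
  proof (intro exI[of _ L] ballI impI, elim conjE)
    fix z w :: complex assume z: "norm z \<le> R" and w: "norm w \<le> R"
    show "\<bar>?g z - ?g w\<bar> \<le> L * norm (z - w) powr \<beta>"
    proof (cases "z = w")
      case False
      let ?\<delta> = "norm (z - w)"
      have \<delta>: "?\<delta> > 0" using False by simp
      show ?thesis
      proof (cases "?\<delta> \<le> 1")
        case True
        obtain n where n: "?\<delta> \<le> (1/2) ^ n" "(1/2) ^ Suc n < ?\<delta>" using dyadic_power_scale[OF \<delta> True] .
        have "r ^ n = 2 powr \<beta> * r ^ Suc n" by (simp add: r_def flip: powr_add)
        also have "r ^ Suc n = ((1/2) ^ Suc n) powr \<beta>"
        proof -
          have "r ^ Suc n = 2 powr (- \<beta> * real (Suc n))" 
            unfolding r_def by (subst powr_realpow[symmetric]) (simp_all add: powr_powr algebra_simps)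
          also have "\<dots> = (2 powr - real (Suc n)) powr \<beta>" by (simp add: powr_powr algebra_simps)
          also have "2 powr - real (Suc n) = (1/2) ^ Suc n"
            by (simp only: powr_minus powr_realpow[of 2, simplified]) (simp add: power_divide inverse_eq_divide)
          finally show ?thesis .
        qed
        also have "2 powr \<beta> * ((1/2) ^ Suc n) powr \<beta> \<le> 2 powr \<beta> * ?\<delta> powr \<beta>"
          using n \<beta> by (intro mult_left_mono powr_mono2) auto
        finally have "(2 * K' + K) * r ^ n \<le> (2 * K' + K) * (2 powr \<beta> * ?\<delta> powr \<beta>)"
          using K K' by (intro mult_left_mono) auto
        with close[OF z w n(1)] have "\<bar>?g z - ?g w\<bar> \<le> ((2 * K' + K) * 2 powr \<beta>) * ?\<delta> powr \<beta>" by simp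
        also have "\<dots> \<le> L * ?\<delta> powr \<beta>" unfolding L_def by (intro mult_right_mono) auto
        finally show ?thesis .
      next
        case far: False
        have "1 \<le> ?\<delta> powr \<beta>" using far \<beta> by (intro ge_one_powr_ge_zero) auto
        moreover have "0 \<le> L" using K K' unfolding L_def by (intro max.coboundedI1 mult_nonneg_nonneg) auto
        ultimately have "L * 1 \<le> L * ?\<delta> powr \<beta>" by (intro mult_left_mono)
        moreover have "\<bar>?g z - ?g w\<bar> \<le> 2 * (B + K')" using bounded[OF z] bounded[OF w] unfolding distrib_left by linarith
        moreover have "2 * (B + K') \<le> L" by (simp add: L_def)
        ultimately show ?thesis by linarith
      qed
    qed simp
  qed
qed

lemma AE_suminf_finite:
  assumes f[measurable]: "\<And>n. f n \<in> borel_measurable M"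
    and b: "\<And>n. (\<integral>\<^sup>+\<omega>. f n \<omega> \<partial>M) \<le> ennreal (c * \<rho> ^ n)" and "0 \<le> c" and \<rho>: "0 \<le> \<rho>" "\<rho> < 1"
  shows "AE \<omega> in M. (\<Sum>n. f n \<omega>) \<noteq> \<infinity>"
proof (rule nn_integral_PInf_AE)
  have "(\<integral>\<^sup>+\<omega>. (\<Sum>n. f n \<omega>) \<partial>M) = (\<Sum>n. \<integral>\<^sup>+\<omega>. f n \<omega> \<partial>M)" by (rule nn_integral_suminf) measurable
  also have "\<dots> \<le> (\<Sum>n. ennreal (c * \<rho> ^ n))" by (intro suminf_le b) auto
  also have "\<dots> = ennreal (\<Sum>n. c * \<rho> ^ n)"
    using assms by (intro suminf_ennreal2 summable_mult summable_geometric) auto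
  also have "\<dots> < \<infinity>" by simp
  finally show "(\<integral>\<^sup>+\<omega>. (\<Sum>n. f n \<omega>) \<partial>M) \<noteq> \<infinity>" by simp
qed measurable

text \<open>There are of the order of \<open>4\<^sup>n\<close> pairs of neighbours of level \<open>n\<close> in a bounded set. The random variable \<open>S R n\<close> sums
the \<open>p\<close>-th powers of their increments, weighted with \<open>2\<^sup>n\<^sup>\<beta>\<^sup>p\<close>; its expectation is at most a constant times
\<open>2\<^sup>n\<^sup>(\<^sup>\<beta>\<^sup>p\<^sup>+\<^sup>2\<^sup>-\<^sup>q\<^sup>)\<close>, and this is summable. Wherever the total is finite it bounds every single increment by a
multiple of \<open>2\<^sup>-\<^sup>n\<^sup>\<beta>\<close>, and the chaining lemma applies.\<close>

lemma (in prob_space) kolmogorov_chentsov_plane: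
  fixes X :: "complex \<Rightarrow> 'a \<Rightarrow> real" and p :: nat
  assumes X[measurable]: "\<And>z. X z \<in> borel_measurable M" and p: "p \<ge> 1" and C: "C \<ge> 0"
    and moment: "\<And>z w. (\<integral>\<^sup>+\<omega>. ennreal (\<bar>X z \<omega> - X w \<omega>\<bar> ^ p) \<partial>M) \<le> ennreal (C * norm (z - w) powr q)"
    and \<beta>: "\<beta> > 0" and q: "q > 2 + \<beta> * real p"
  shows "\<exists>Y. (\<forall>z. Y z \<in> borel_measurable M \<and> (AE \<omega> in M. Y z \<omega> = X z \<omega>)) \<and>
             (\<forall>\<omega>\<in>space M. hoelder_on UNIV \<beta> (\<lambda>z. Y z \<omega>))"
proof -
  have q0: "q > 0" using q \<beta> mult_nonneg_nonneg[of \<beta> "real p"] by linarith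
  have dyadic: "(2 * (1/2) ^ n) powr q = 2 powr q * (2 powr - q) ^ n" for n :: nat
  proof -
    have "(1/2::real) ^ n = 2 powr - real n"
      by (simp add: powr_minus powr_realpow power_divide inverse_eq_divide)
    then have "(2 * (1/2) ^ n) powr q = 2 powr q * 2 powr (- real n * q)"
      by (simp add: powr_mult powr_powr)
    also have "2 powr (- real n * q) = (2 powr - q) powr real n" by (simp add: powr_powr mult.commute)
    also have "\<dots> = (2 powr - q) ^ n" by (simp add: powr_realpow)
    finally show ?thesis .
  qed
  let ?N = "\<lambda>R n. (int R + 1) * 2 ^ n"
  let ?I = "\<lambda>R n. {- ?N R n..?N R n} \<times> {- ?N R n..?N R n} \<times> {-1..1::int} \<times> {-1..1::int}"
  let ?inc = "\<lambda>n i j d e \<omega>. \<bar>X (grid_point n i j) \<omega> - X (grid_point n (i + d) (j + e)) \<omega>\<bar>"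
  define S where "S R n \<omega> = ennreal ((2 powr (\<beta> * real p)) ^ n) * (\<Sum>(i, j, d, e)\<in>?I R n.
      ennreal (?inc n i j d e \<omega> ^ p))" for R n \<omega>
  have S_meas[measurable]: "S R n \<in> borel_measurable M" for R n
    unfolding S_def[abs_def] case_prod_unfold by measurable
  define \<rho> where "\<rho> = 2 powr (\<beta> * real p) * 4 * 2 powr - q"
  have \<rho>: "0 \<le> \<rho>" "\<rho> < 1"
  proof -
    have "(4::real) = 2 powr 2" by simp
    then have "\<rho> = 2 powr (\<beta> * real p + 2 + - q)" by (simp only: \<rho>_def powr_add)
    also have "\<dots> < 2 powr 0" using q by (intro powr_less_mono) (auto simp: mult.commute)
    finally show "\<rho> < 1" by simp
  qed (simp add: \<rho>_def)
  have S_int: "(\<integral>\<^sup>+\<omega>. S R n \<omega> \<partial>M) \<le> ennreal (81 * (real R + 1)\<^sup>2 * C * 2 powr q * \<rho> ^ n)" for R n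
  proof -
    let ?c = "C * (2 powr q * (2 powr - q) ^ n)"
    have c0: "0 \<le> ?c" using C by simp
    have "(\<integral>\<^sup>+\<omega>. S R n \<omega> \<partial>M) = ennreal ((2 powr (\<beta> * real p)) ^ n) * (\<Sum>(i, j, d, e)\<in>?I R n.
        \<integral>\<^sup>+\<omega>. ennreal (?inc n i j d e \<omega> ^ p) \<partial>M)"
      unfolding S_def case_prod_unfold by (subst nn_integral_cmult, measurable, subst nn_integral_sum, measurable)
    also have "\<dots> \<le> ennreal ((2 powr (\<beta> * real p)) ^ n) * (\<Sum>(i, j, d, e)\<in>?I R n. ennreal ?c)"
    proof (intro mult_left_mono sum_mono)
      fix x assume x: "x \<in> ?I R n"
      obtain i j d e where ijde: "x = (i, j, d, e)" by (cases x) auto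
      have de: "\<bar>d\<bar> \<le> 1" "\<bar>e\<bar> \<le> 1" using x ijde by auto
      have "(\<integral>\<^sup>+\<omega>. ennreal (?inc n i j d e \<omega> ^ p) \<partial>M)
          \<le> ennreal (C * norm (grid_point n i j - grid_point n (i + d) (j + e)) powr q)" by (rule moment)
      also have "\<dots> \<le> ennreal (C * (2 * (1/2) ^ n) powr q)"
        using grid_point_neighbour_dist[OF de, of n i j] C q0
        by (intro ennreal_leI mult_left_mono powr_mono2) auto
      finally show "(case x of (i, j, d, e) \<Rightarrow>
          \<integral>\<^sup>+\<omega>. ennreal (?inc n i j d e \<omega> ^ p) \<partial>M)
          \<le> (case x of (i, j, d, e) \<Rightarrow> ennreal ?c)" unfolding ijde dyadic by simp
    qed simp
    also have "(\<Sum>(i, j, d, e)\<in>?I R n. ennreal ?c) = ennreal (real (card (?I R n)) * ?c)"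
      using c0 C by (simp add: case_prod_unfold ennreal_mult ennreal_of_nat_eq_real_of_nat del: card_atLeastAtMost_int)
    also have "ennreal ((2 powr (\<beta> * real p)) ^ n) * ennreal (real (card (?I R n)) * ?c)
        = ennreal ((2 powr (\<beta> * real p)) ^ n * (real (card (?I R n)) * ?c))"
      using c0 by (intro ennreal_mult[symmetric] mult_nonneg_nonneg[OF _ c0]) auto
    also have "\<dots> \<le> ennreal ((2 powr (\<beta> * real p)) ^ n * ((81 * (real R + 1)\<^sup>2 * 4 ^ n) * ?c))"
    proof (intro ennreal_leI mult_left_mono mult_right_mono)
      have N1: "1 \<le> ?N R n" using mult_mono[of 1 "int R + 1" 1 "2 ^ n"] by simp
      have "real (card {- k..k}) = 2 * real_of_int k + 1" if "1 \<le> k" for k :: int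
        using that by simp
      from this[OF N1] have "real (card (?I R n)) = (2 * real_of_int (?N R n) + 1)\<^sup>2 * 9"
        by (simp only: card_cartesian_product of_nat_mult power2_eq_square) simp
      also have "\<dots> \<le> (3 * real_of_int (?N R n))\<^sup>2 * 9"
        using N1 by (intro mult_right_mono power_mono) (simp_all del: of_int_mult)
      also have "\<dots> = 81 * (real R + 1)\<^sup>2 * (2 ^ n)\<^sup>2" by (simp add: power_mult_distrib)
      also have "((2::real) ^ n)\<^sup>2 = 4 ^ n" by (simp add: power2_eq_square flip: power_mult_distrib)
      finally show "real (card (?I R n)) \<le> 81 * (real R + 1)\<^sup>2 * 4 ^ n" .
    qed (use c0 in auto)
    also have "(2 powr (\<beta> * real p)) ^ n * ((81 * (real R + 1)\<^sup>2 * 4 ^ n) * ?c)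
        = 81 * (real R + 1)\<^sup>2 * C * 2 powr q * \<rho> ^ n"
      unfolding \<rho>_def power_mult_distrib by (simp only: mult_ac)
    finally show ?thesis .
  qed
  define G where "G = {\<omega> \<in> space M. \<forall>R. (\<Sum>n. S R n \<omega>) \<noteq> \<infinity>}"
  have G[measurable]: "G \<in> sets M" unfolding G_def by measurable
  have AE_G: "AE \<omega> in M. \<omega> \<in> G"
  proof -
    have "AE \<omega> in M. (\<Sum>n. S R n \<omega>) \<noteq> \<infinity>" for R
      using C \<rho> by (intro AE_suminf_finite[OF S_meas S_int]) auto
    then have "AE \<omega> in M. \<forall>R. (\<Sum>n. S R n \<omega>) \<noteq> \<infinity>" unfolding AE_all_countable ..
    then show ?thesis using AE_space by eventually_elim (simp add: G_def)
  qed
  define Y where "Y z \<omega> = (if \<omega> \<in> G then lim (\<lambda>n. X (dyadic_floor n z) \<omega>) else 0)" for z \<omega>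
  have Y_meas: "Y z \<in> borel_measurable M" for z
    unfolding Y_def[abs_def] by (intro measurable_If_set borel_measurable_lim_metric) (auto simp: G)
  have Y_AE: "AE \<omega> in M. Y z \<omega> = X z \<omega>" for z
  proof -
    have "AE \<omega> in M. (\<Sum>n. ennreal (\<bar>X (dyadic_floor n z) \<omega> - X z \<omega>\<bar> ^ p)) \<noteq> \<infinity>"
    proof (rule AE_suminf_finite)
      fix n
      have "(\<integral>\<^sup>+\<omega>. ennreal (\<bar>X (dyadic_floor n z) \<omega> - X z \<omega>\<bar> ^ p) \<partial>M)
          \<le> ennreal (C * norm (dyadic_floor n z - z) powr q)" by (rule moment)
      also have "\<dots> \<le> ennreal (C * (2 * (1/2) ^ n) powr q)"
        using dyadic_floor_dist[of n z] C q0 by (intro ennreal_leI mult_left_mono powr_mono2) auto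
      finally show "(\<integral>\<^sup>+\<omega>. ennreal (\<bar>X (dyadic_floor n z) \<omega> - X z \<omega>\<bar> ^ p) \<partial>M)
          \<le> ennreal (C * 2 powr q * (2 powr - q) ^ n)" unfolding dyadic by (simp add: mult.assoc)
    qed (use C q0 in \<open>auto simp: powr_less_one\<close>)
    then show ?thesis using AE_G
    proof eventually_elim
      case (elim \<omega>)
      have "summable (\<lambda>n. \<bar>X (dyadic_floor n z) \<omega> - X z \<omega>\<bar> ^ p)"
        using elim(1) by (intro summable_suminf_not_top) auto
      then have "(\<lambda>n. \<bar>X (dyadic_floor n z) \<omega> - X z \<omega>\<bar> ^ p) \<longlonglongrightarrow> 0" by (rule summable_LIMSEQ_zero)
      then have "(\<lambda>n. root p (\<bar>X (dyadic_floor n z) \<omega> - X z \<omega>\<bar> ^ p)) \<longlonglongrightarrow> root p 0"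
        by (rule tendsto_real_root)
      then have "(\<lambda>n. \<bar>X (dyadic_floor n z) \<omega> - X z \<omega>\<bar>) \<longlonglongrightarrow> 0"
        using p by (simp add: real_root_power_cancel)
      then have "(\<lambda>n. X (dyadic_floor n z) \<omega>) \<longlonglongrightarrow> X z \<omega>"
        by (simp add: tendsto_rabs_zero_iff LIM_zero_iff)
      then show ?case using elim(2) by (simp add: Y_def limI)
    qed
  qed
  have hoelder: "hoelder_on UNIV \<beta> (\<lambda>z. Y z \<omega>)" if \<omega>: "\<omega> \<in> space M" for \<omega>
  proof (cases "\<omega> \<in> G")
    case True
    have "hoelder_on UNIV \<beta> (\<lambda>z. lim (\<lambda>n. X (dyadic_floor n z) \<omega>))"
    proof (rule dyadic_increments_imp_hoelder[OF \<beta>])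
      fix R :: nat
      have fin: "(\<Sum>n. S R n \<omega>) \<noteq> \<infinity>" using True by (simp add: G_def)
      define s where "s = enn2real (\<Sum>n. S R n \<omega>)"
      have s: "(\<Sum>n. S R n \<omega>) = ennreal s" using fin by (simp add: s_def less_top)
      have s0: "0 \<le> s" by (simp add: s_def)
      have "?inc n i j d e \<omega> \<le> max 1 s * (2 powr - \<beta>) ^ n"
        if ij: "\<bar>i\<bar> \<le> int R * 2 ^ n" "\<bar>j\<bar> \<le> int R * 2 ^ n" and de: "\<bar>d\<bar> \<le> 1" "\<bar>e\<bar> \<le> 1" for n i j d e
      proof -
        let ?D = "?inc n i j d e \<omega>"
        let ?x = "(2 powr \<beta>) ^ n * ?D"
        have "int R * 2 ^ n \<le> ?N R n" by (simp add: algebra_simps)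
        then have "\<bar>i\<bar> \<le> ?N R n" "\<bar>j\<bar> \<le> ?N R n" using ij by linarith+
        then have mem: "(i, j, d, e) \<in> ?I R n" using de by (simp add: abs_le_iff)
        have "ennreal (?x ^ p) = ennreal ((2 powr (\<beta> * real p)) ^ n) * ennreal (?D ^ p)"
        proof -
          have "((2 powr \<beta>) ^ n) ^ p = ((2 powr \<beta>) powr real p) ^ n"
            by (simp add: powr_realpow mult.commute flip: power_mult)
          then show ?thesis by (simp add: power_mult_distrib powr_powr ennreal_mult)
        qed
        also have "\<dots> \<le> S R n \<omega>"
          unfolding S_def
          using member_le_sum[OF mem, of "\<lambda>(i, j, d, e). ennreal (?inc n i j d e \<omega> ^ p)"]
          by (intro mult_left_mono) auto
        also have "\<dots> \<le> (\<Sum>n. S R n \<omega>)" using sum_le_suminf[of "\<lambda>n. S R n \<omega>" "{n}"] by simp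
        finally have xp: "?x ^ p \<le> s" unfolding s using s0 by simp
        \<comment> \<open>The maximum with 1 spares taking a \<open>p\<close>-th root.\<close>
        have "?x \<le> max 1 s"
        proof (cases "?x \<le> 1")
          case False
          then have "?x \<le> ?x ^ p" using p by (intro self_le_power) auto
          with xp show ?thesis by simp
        qed simp
        then have "?x * (2 powr - \<beta>) ^ n \<le> max 1 s * (2 powr - \<beta>) ^ n" by (intro mult_right_mono) auto
        moreover have "(2 powr \<beta>) ^ n * (2 powr - \<beta>) ^ n = 1" by (simp flip: power_mult_distrib powr_add)
        then have "?x * (2 powr - \<beta>) ^ n = ?D" by (simp add: mult_ac)
        ultimately show ?thesis by simp
      qed
      then show "\<exists>K\<ge>0. \<forall>n i j d e. \<bar>i\<bar> \<le> int R * 2 ^ n \<longrightarrow> \<bar>j\<bar> \<le> int R * 2 ^ n \<longrightarrow> \<bar>d\<bar> \<le> 1 \<longrightarrow> \<bar>e\<bar> \<le> 1 \<longrightarrow>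
        ?inc n i j d e \<omega> \<le> K * (2 powr - \<beta>) ^ n"
        by (intro exI[of _ "max 1 s"] conjI) auto
    qed
    then show ?thesis using True by (simp add: Y_def)
  next
    case False
    then show ?thesis by (auto simp: Y_def hoelder_on_def intro: exI[of _ 0])
  qed
  show ?thesis using Y_meas Y_AE hoelder by blast
qed

section \<open>Covariance on the real line, regularity and the theorem\<close>

lemma cos_pi_nonzero:
  assumes "0 < \<alpha>" "\<alpha> < 1" "\<alpha> \<noteq> 1/2"
  shows "cos (pi * \<alpha>) \<noteq> 0"
proof
  assume c: "cos (pi * \<alpha>) = 0"
  have "0 \<le> pi * \<alpha>" "pi * \<alpha> \<le> pi" using assms by (auto intro: mult_left_le)
  then have "pi * \<alpha> = pi * (1/2)"
    using c cos_inj_pi[of "pi * \<alpha>" "pi / 2"] by simp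
  then show False using assms by simp
qed

text \<open>On the real line the base of the power lies on the imaginary axis, with argument \<open>\<plusminus>\<pi>/2\<close>; for the exponent \<open>2\<alpha>\<close>
this produces the factor \<open>cos \<pi>\<alpha>\<close> that cancels the one in \<^const>\<open>kernel_primitive\<close>.\<close>

lemma Re_neg_ii_times_real_powr: "Re ((- \<i> * of_real x) powr of_real p) = \<bar>x\<bar> powr p * cos (pi * (p / 2))"
proof -
  have unit: "Re (u powr of_real p) = cos (pi * (p / 2))" if "u = \<i> \<or> u = - \<i>" for u
    using that by (auto simp: powr_def Re_exp Ln_ii Ln_minus_ii mult.commute)
  define u where "u = (if x \<ge> 0 then - \<i> else \<i>)"
  have "(- \<i> * of_real x) powr complex_of_real p = (of_real \<bar>x\<bar> * u) powr of_real p"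
    by (simp add: u_def mult.commute)
  also have "\<dots> = of_real \<bar>x\<bar> powr of_real p * u powr of_real p"
    by (rule powr_times_real_left) auto
  also have "complex_of_real \<bar>x\<bar> powr of_real p = of_real (\<bar>x\<bar> powr p)" by (rule powr_of_real) auto
  finally show ?thesis using unit[of u] by (simp add: u_def)
qed

lemma Gamma_cov_real:
  assumes \<alpha>: "0 < \<alpha>" "\<alpha> < 1" "\<alpha> \<noteq> 1/2"
  shows "Gamma_cov \<alpha> (of_real s) (of_real t)
    = (\<bar>s\<bar> powr (2 * \<alpha>) + \<bar>t\<bar> powr (2 * \<alpha>) - \<bar>t - s\<bar> powr (2 * \<alpha>)) / 2"
proof -
  have P: "Re (kernel_primitive \<alpha> (of_real a) (of_real b)) = - (\<bar>b - a\<bar> powr (2 * \<alpha>) / 4)" for a b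
  proof -
    have "Re (kernel_primitive \<alpha> (of_real a) (of_real b))
        = - 1 / (4 * cos (pi * \<alpha>)) * Re ((- \<i> * of_real (a - b)) powr of_real (2 * \<alpha>))"
      by (simp add: kernel_primitive_def)
    also have "\<dots> = - (\<bar>b - a\<bar> powr (2 * \<alpha>) / 4)"
      unfolding Re_neg_ii_times_real_powr using cos_pi_nonzero[OF \<alpha>] by (simp add: abs_minus_commute)
    finally show ?thesis .
  qed
  show ?thesis using P[of s t] P[of s 0] P[of 0 t] by (simp add: Gamma_cov_def)
qed

text \<open>In the variance of the difference the terms of \<^const>\<open>Gamma_cov\<close> with an argument 0 cancel, and a second difference
of the primitive remains.\<close>

lemma Gamma_increment_variance:
  assumes \<alpha>: "0 < \<alpha>" "\<alpha> < 1" and noise: "gaussian_noise M \<xi>1 \<xi>2"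
    and \<Gamma>: "is_Gamma_plus M \<alpha> \<xi>1 \<xi>2 \<Gamma>" and zw: "z \<in> closure uhp" "w \<in> closure uhp"
  obtains v where "centered_gaussian M (\<lambda>\<omega>. 2 * Re (\<Gamma> z \<omega>) - 2 * Re (\<Gamma> w \<omega>)) v"
    "v \<le> 20 / (4 * \<bar>cos (pi * \<alpha>)\<bar>) * norm (z - w) powr (2 * \<alpha>)"
proof (cases "z = w")
  case True
  interpret prob_space M by (rule gaussian_noiseD(1)[OF noise])
  have "centered_gaussian M (\<lambda>_. 0) 0" by (simp add: centered_gaussian_def prob_space)
  with True show ?thesis by (intro that[of 0]) auto
next
  case False
  let ?P = "kernel_primitive \<alpha>"
  define c :: "complex \<Rightarrow> real" where "c x = (if x = z then 1 else - 1)" for x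
  define v where "v = (\<Sum>x\<in>{z, w}. \<Sum>y\<in>{z, w}. c x * c y * Gamma_cov \<alpha> x y)"
  have "centered_gaussian M (\<lambda>\<omega>. \<Sum>x\<in>{z, w}. c x * (2 * Re (\<Gamma> x \<omega>))) v"
    unfolding v_def using zw by (intro Gamma_combination_centered_gaussian[OF \<alpha> noise \<Gamma>]) auto
  moreover have "(\<Sum>x\<in>{z, w}. c x * (2 * Re (\<Gamma> x \<omega>))) = 2 * Re (\<Gamma> z \<omega>) - 2 * Re (\<Gamma> w \<omega>)" for \<omega>
    using False by (simp add: c_def)
  ultimately have "centered_gaussian M (\<lambda>\<omega>. 2 * Re (\<Gamma> z \<omega>) - 2 * Re (\<Gamma> w \<omega>)) v" by simp
  moreover have "v = 2 * Re (?P z z + ?P w w - ?P z w - ?P w z)"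
    using False by (simp add: v_def c_def Gamma_cov_def)
  then have "v \<le> 2 * norm (?P z z + ?P w w - ?P z w - ?P w z)"
    using complex_Re_le_cmod[of "?P z z + ?P w w - ?P z w - ?P w z"] by linarith
  then have "v \<le> 20 / (4 * \<bar>cos (pi * \<alpha>)\<bar>) * norm (z - w) powr (2 * \<alpha>)"
    using kernel_primitive_increment_bound[OF \<alpha>(1,2) zw] by simp
  ultimately show ?thesis by (rule that)
qed

lemma Gamma_real_combination_centered_gaussian:
  assumes \<alpha>: "0 < \<alpha>" "\<alpha> < 1" "\<alpha> \<noteq> 1/2" and noise: "gaussian_noise M \<xi>1 \<xi>2"
    and \<Gamma>: "is_Gamma_plus M \<alpha> \<xi>1 \<xi>2 \<Gamma>" and I: "finite I"
  shows "centered_gaussian M (\<lambda>\<omega>. \<Sum>t\<in>I. c t * Gamma_real \<Gamma> t \<omega>)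
    (\<Sum>s\<in>I. \<Sum>t\<in>I. c s * c t * ((\<bar>s\<bar> powr (2 * \<alpha>) + \<bar>t\<bar> powr (2 * \<alpha>) - \<bar>t - s\<bar> powr (2 * \<alpha>)) / 2))"
proof -
  have inj: "inj_on complex_of_real I" by (auto simp: inj_on_def)
  have "centered_gaussian M (\<lambda>\<omega>. \<Sum>z\<in>of_real ` I. c (Re z) * (2 * Re (\<Gamma> z \<omega>)))
      (\<Sum>z\<in>of_real ` I. \<Sum>w\<in>of_real ` I. c (Re z) * c (Re w) * Gamma_cov \<alpha> z w)"
    using I by (intro Gamma_combination_centered_gaussian[OF \<alpha>(1,2) noise \<Gamma>]) (auto simp: closure_uhp)
  then show ?thesis by (simp add: sum.reindex[OF inj] Gamma_real_def Gamma_cov_real[OF \<alpha>])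
qed

text \<open>Expectations are total functions, so the moment conditions in \<^const>\<open>fractional_brownian_motion\<close> do not by
themselves give integrability; it comes from Gaussianity.\<close>

lemma (in prob_space) gaussian_process_product_integrable:
  assumes X: "gaussian_process M X" and E: "\<And>t. expectation (X t) = 0"
  shows "integrable M (X t)" "integrable M (\<lambda>\<omega>. X s \<omega> * X t \<omega>)"
proof -
  have comb: "gaussian_rv M (\<lambda>\<omega>. \<Sum>t\<in>I. c t * X t \<omega>)" if "finite I" for I c
    using X that by (simp add: gaussian_process_def)
  have G: "gaussian_rv M (X t)" for t using comb[of "{t}" "\<lambda>_. 1"] by simp
  have [measurable]: "X t \<in> borel_measurable M" for t using G by (simp add: gaussian_rv_def)
  have sq: "integrable M (\<lambda>\<omega>. (X t \<omega>)\<^sup>2)" for t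
    using gaussian_rv_imp_centered_gaussian[OF G E] by (rule centered_gaussian_variance(1))
  show "integrable M (X t)" by (rule square_integrable_imp_integrable[OF _ sq]) measurable
  show "integrable M (\<lambda>\<omega>. X s \<omega> * X t \<omega>)"
  proof (rule Bochner_Integration.integrable_bound)
    show "integrable M (\<lambda>\<omega>. (X s \<omega>)\<^sup>2 + (X t \<omega>)\<^sup>2)" by (intro Bochner_Integration.integrable_add sq)
    have "\<bar>x * y\<bar> \<le> x\<^sup>2 + y\<^sup>2" for x y :: real
    proof -
      have "2 * (\<bar>x\<bar> * \<bar>y\<bar>) \<le> x\<^sup>2 + y\<^sup>2"
        using zero_le_power2[of "\<bar>x\<bar> - \<bar>y\<bar>"] by (simp add: power2_diff)
      moreover have "0 \<le> \<bar>x\<bar> * \<bar>y\<bar>" by simp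
      ultimately show ?thesis unfolding abs_mult by linarith
    qed
    then show "AE \<omega> in M. norm (X s \<omega> * X t \<omega>) \<le> norm ((X s \<omega>)\<^sup>2 + (X t \<omega>)\<^sup>2)" by simp
  qed measurable
qed

lemma centered_gaussian_process_char:
  assumes X: "gaussian_process M X" and E: "\<And>t. prob_space.expectation M (X t) = 0" and J: "finite J"
  shows "(\<integral>\<omega>. iexp (\<Sum>t\<in>J. u t * X t \<omega>) \<partial>M)
    = complex_of_real (exp (- (\<Sum>s\<in>J. \<Sum>t\<in>J. u s * u t * prob_space.expectation M (\<lambda>\<omega>. X s \<omega> * X t \<omega>)) / 2))"
proof -
  interpret prob_space M using X by (simp add: gaussian_process_def)
  note I = gaussian_process_product_integrable[OF X E]
  let ?Z = "\<lambda>\<omega>. \<Sum>t\<in>J. u t * X t \<omega>"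
  have "gaussian_rv M ?Z" using X J by (simp add: gaussian_process_def)
  moreover have "expectation ?Z = 0" using I(1) E by (subst Bochner_Integration.integral_sum) auto
  ultimately have G: "centered_gaussian M ?Z (expectation (\<lambda>\<omega>. (?Z \<omega>)\<^sup>2))"
    by (rule gaussian_rv_imp_centered_gaussian)
  have "expectation (\<lambda>\<omega>. (?Z \<omega>)\<^sup>2) = expectation (\<lambda>\<omega>. \<Sum>s\<in>J. \<Sum>t\<in>J. u s * u t * (X s \<omega> * X t \<omega>))"
    by (simp add: power2_eq_square sum_product mult_ac)
  also have "\<dots> = (\<Sum>s\<in>J. \<Sum>t\<in>J. u s * u t * expectation (\<lambda>\<omega>. X s \<omega> * X t \<omega>))"
    using I(2) by (subst Bochner_Integration.integral_sum, force)+ simp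
  finally show ?thesis using centered_gaussianD(2)[OF G, of 1] by simp
qed

lemma fractional_brownian_motion_law_unique:
  assumes X: "fractional_brownian_motion M \<alpha> X" and Y: "fractional_brownian_motion N \<alpha> Y"
  shows "process_law M X = process_law N Y"
proof (rule process_law_eqI)
  have meas: "Z t \<in> borel_measurable L" if "gaussian_process L Z" for L :: "'c measure" and Z :: "real \<Rightarrow> 'c \<Rightarrow> real" and t
  proof -
    have "gaussian_rv L (\<lambda>\<omega>. \<Sum>s\<in>{t}. 1 * Z s \<omega>)"
      using that[unfolded gaussian_process_def, THEN conjunct2, rule_format, of "{t}" "\<lambda>_. 1"] by simp
    then show ?thesis by (simp add: gaussian_rv_def)
  qed
  note X' = X[unfolded fractional_brownian_motion_def, THEN conjunct1]
    X[unfolded fractional_brownian_motion_def, THEN conjunct2, THEN conjunct1, rule_format]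
    X[unfolded fractional_brownian_motion_def, THEN conjunct2, THEN conjunct2, rule_format]
  note Y' = Y[unfolded fractional_brownian_motion_def, THEN conjunct1]
    Y[unfolded fractional_brownian_motion_def, THEN conjunct2, THEN conjunct1, rule_format]
    Y[unfolded fractional_brownian_motion_def, THEN conjunct2, THEN conjunct2, rule_format]
  show "prob_space M" "prob_space N" using X'(1) Y'(1) by (simp_all add: gaussian_process_def)
  show "X t \<in> borel_measurable M" "Y t \<in> borel_measurable N" for t
    by (rule meas[OF X'(1)], rule meas[OF Y'(1)])
  fix J :: "real set" and u assume J: "finite J"
  show "(\<integral>\<omega>. iexp (\<Sum>j\<in>J. u j * X j \<omega>) \<partial>M) = (\<integral>\<omega>. iexp (\<Sum>j\<in>J. u j * Y j \<omega>) \<partial>N)"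
    unfolding centered_gaussian_process_char[OF X'(1,2) J] centered_gaussian_process_char[OF Y'(1,2) J]
      X'(3) Y'(3) ..
qed

lemma Gamma_real_fractional_brownian_motion:
  assumes \<alpha>: "0 < \<alpha>" "\<alpha> < 1" "\<alpha> \<noteq> 1/2" and noise: "gaussian_noise M \<xi>1 \<xi>2"
    and \<Gamma>: "is_Gamma_plus M \<alpha> \<xi>1 \<xi>2 \<Gamma>"
  shows "fractional_brownian_motion M \<alpha> (Gamma_real \<Gamma>)"
proof -
  interpret prob_space M by (rule gaussian_noiseD(1)[OF noise])
  let ?B = "Gamma_real \<Gamma>"
  let ?R = "\<lambda>s t. (\<bar>s\<bar> powr (2 * \<alpha>) + \<bar>t\<bar> powr (2 * \<alpha>) - \<bar>t - s\<bar> powr (2 * \<alpha>)) / 2"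
  note comb = Gamma_real_combination_centered_gaussian[OF \<alpha> noise \<Gamma>]
  have single: "centered_gaussian M (?B t) (?R t t)" for t
    using comb[of "{t}" "\<lambda>_. 1"] by simp
  have E: "expectation (?B t) = 0" for t by (rule centered_gaussian_expectation[OF single])
  have gp: "gaussian_process M ?B"
    unfolding gaussian_process_def
    using prob_space_axioms centered_gaussian_imp_gaussian_rv[OF comb] by blast
  have R_sym: "?R s t = ?R t s" for s t by (simp add: abs_minus_commute)
  have "expectation (\<lambda>\<omega>. ?B s \<omega> * ?B t \<omega>) = ?R s t" for s t
  proof (cases "s = t")
    case True
    then show ?thesis using centered_gaussian_variance(2)[OF single[of t]] by (simp add: power2_eq_square)
  next
    case False
    have "centered_gaussian M (\<lambda>\<omega>. ?B s \<omega> + ?B t \<omega>) (?R s s + ?R s t + (?R t s + ?R t t))"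
      using comb[of "{s, t}" "\<lambda>_. 1"] False by (simp del: add_divide_distrib)
    from centered_gaussian_variance(2)[OF this]
    have "expectation (\<lambda>\<omega>. (?B s \<omega> + ?B t \<omega>)\<^sup>2) = ?R s s + 2 * ?R s t + ?R t t"
      unfolding R_sym[of t s] by simp
    moreover have "expectation (\<lambda>\<omega>. (?B s \<omega> + ?B t \<omega>)\<^sup>2)
        = expectation (\<lambda>\<omega>. (?B s \<omega>)\<^sup>2) + expectation (\<lambda>\<omega>. (?B t \<omega>)\<^sup>2) + 2 * expectation (\<lambda>\<omega>. ?B s \<omega> * ?B t \<omega>)"
      using gaussian_process_product_integrable(2)[OF gp E, of s t]
        centered_gaussian_variance(1)[OF single[of s]] centered_gaussian_variance(1)[OF single[of t]]
      by (simp add: power2_sum mult.assoc)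
    ultimately show ?thesis
      using centered_gaussian_variance(2)[OF single[of s]] centered_gaussian_variance(2)[OF single[of t]] by simp
  qed
  with E gp show ?thesis unfolding fractional_brownian_motion_def by blast
qed

lemma hoelder_on_weaken:
  assumes h: "hoelder_on S \<beta> h" and S: "S' \<subseteq> S" and \<beta>: "\<beta>' \<le> \<beta>"
  shows "hoelder_on S' \<beta>' h"
  unfolding hoelder_on_def
proof
  fix R
  obtain K where K: "\<And>z w. z \<in> S \<Longrightarrow> w \<in> S \<Longrightarrow> norm z \<le> R \<Longrightarrow> norm w \<le> R \<Longrightarrow> \<bar>h z - h w\<bar> \<le> K * norm (z - w) powr \<beta>"
    using h unfolding hoelder_on_def by meson
  have "\<bar>h z - h w\<bar> \<le> (\<bar>K\<bar> * (2 * R) powr (\<beta> - \<beta>')) * norm (z - w) powr \<beta>'"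
    if zw: "z \<in> S'" "w \<in> S'" "norm z \<le> R" "norm w \<le> R" for z w
  proof -
    have "norm (z - w) \<le> 2 * R" using zw norm_triangle_ineq4[of z w] by simp
    then have le: "norm (z - w) powr (\<beta> - \<beta>') \<le> (2 * R) powr (\<beta> - \<beta>')" using \<beta> by (intro powr_mono2) auto
    have "\<bar>h z - h w\<bar> \<le> K * norm (z - w) powr \<beta>" using K zw S by blast
    also have "\<dots> \<le> \<bar>K\<bar> * norm (z - w) powr \<beta>" by (intro mult_right_mono) auto
    also have "norm (z - w) powr \<beta> = norm (z - w) powr (\<beta> - \<beta>') * norm (z - w) powr \<beta>'"
      by (simp flip: powr_add)
    also have "\<bar>K\<bar> * \<dots> \<le> \<bar>K\<bar> * ((2 * R) powr (\<beta> - \<beta>') * norm (z - w) powr \<beta>')"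
      using le by (intro mult_left_mono mult_right_mono) auto
    finally show ?thesis by (simp add: mult.assoc)
  qed
  then show "\<exists>K. \<forall>z\<in>S'. \<forall>w\<in>S'. norm z \<le> R \<and> norm w \<le> R \<longrightarrow> \<bar>h z - h w\<bar> \<le> K * norm (z - w) powr \<beta>'" by blast
qed

lemma hoelder_on_imp_continuous_on:
  assumes h: "hoelder_on S \<beta> h" and \<beta>: "\<beta> > 0"
  shows "continuous_on S h"
  unfolding continuous_on_def
proof
  fix z assume z: "z \<in> S"
  obtain K where "\<forall>x\<in>S. \<forall>w\<in>S. norm x \<le> norm z + 1 \<and> norm w \<le> norm z + 1 \<longrightarrow> \<bar>h x - h w\<bar> \<le> K * norm (x - w) powr \<beta>"
    using h unfolding hoelder_on_def by meson
  then have K: "\<bar>h w - h z\<bar> \<le> K * norm (w - z) powr \<beta>" if "w \<in> S" "norm w \<le> norm z + 1" for w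
    using that z by simp
  have near: "\<forall>\<^sub>F w in at z within S. w \<in> S \<and> dist w z < 1"
    unfolding eventually_at by (intro exI[of _ 1]) auto
  have "((\<lambda>w. h w - h z) \<longlongrightarrow> 0) (at z within S)"
  proof (rule Lim_null_comparison)
    show "\<forall>\<^sub>F w in at z within S. norm (h w - h z) \<le> K * norm (w - z) powr \<beta>"
      using near
    proof eventually_elim
      case (elim w)
      then have "norm w \<le> norm z + 1" using norm_triangle_ineq2[of w z] by (simp add: dist_norm)
      then show ?case using K elim by simp
    qed
    have "((\<lambda>w. norm (w - z)) \<longlongrightarrow> 0) (at z within S)"
      by (intro tendsto_norm_zero LIM_zero tendsto_ident_at)
    then have "((\<lambda>w. norm (w - z) powr \<beta>) \<longlongrightarrow> 0) (at z within S)"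
      by (rule tendsto_zero_powrI[OF _ tendsto_const _ \<beta>]) simp
    then show "((\<lambda>w. K * norm (w - z) powr \<beta>) \<longlongrightarrow> 0) (at z within S)" by (rule tendsto_mult_right_zero)
  qed
  then show "(h \<longlongrightarrow> h z) (at z within S)" by (simp add: LIM_zero_iff)
qed

text \<open>The criterion is stated for processes indexed by the whole plane, so the lower half-plane is reflected onto the
upper one by the contraction \<open>r\<close>. The moment of order \<open>2m\<close> is bounded by \<open>C |z - w|\<^sup>2\<^sup>m\<^sup>\<alpha>\<close>, and \<open>m\<close> is chosen with
\<open>m (\<alpha> - \<beta>) > 1\<close>, which leaves room for the dimension 2.\<close>

lemma Gamma_hoelder_version:
  assumes \<alpha>: "0 < \<alpha>" "\<alpha> < 1" and noise: "gaussian_noise M \<xi>1 \<xi>2"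
    and \<Gamma>: "is_Gamma_plus M \<alpha> \<xi>1 \<xi>2 \<Gamma>" and \<beta>: "0 < \<beta>" "\<beta> < \<alpha>"
  shows "\<exists>Y. is_version_on M (closure uhp) Y (\<lambda>z \<omega>. 2 * Re (\<Gamma> z \<omega>)) \<and>
    (\<forall>\<omega>\<in>space M. hoelder_on (closure uhp) \<beta> (\<lambda>z. Y z \<omega>))"
proof -
  interpret prob_space M by (rule gaussian_noiseD(1)[OF noise])
  define D where "D = 20 / (4 * \<bar>cos (pi * \<alpha>)\<bar>)"
  have D: "D \<ge> 0" by (simp add: D_def)
  define r where "r z = Complex (Re z) \<bar>Im z\<bar>" for z
  have r_cl: "r z \<in> closure uhp" for z by (simp add: r_def closure_uhp)
  have r_id: "r z = z" if "z \<in> closure uhp" for z using that by (simp add: r_def closure_uhp complex_eq_iff)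
  have r_dist: "norm (r z - r w) \<le> norm (z - w)" for z w
  proof -
    have "\<bar>\<bar>Im z\<bar> - \<bar>Im w\<bar>\<bar> \<le> \<bar>Im z - Im w\<bar>" by linarith
    then have "(\<bar>Im z\<bar> - \<bar>Im w\<bar>)\<^sup>2 \<le> (Im z - Im w)\<^sup>2" by (simp only: abs_le_square_iff)
    then show ?thesis by (simp add: r_def cmod_def)
  qed
  define X where "X z \<omega> = 2 * Re (\<Gamma> (r z) \<omega>)" for z \<omega>
  have X_meas: "X z \<in> borel_measurable M" for z
    unfolding X_def[abs_def] using Gamma_measurable[OF \<Gamma> r_cl] by (intro borel_measurable_times measurable_compose[OF _ borel_measurable_Re]) auto
  obtain m :: nat where m: "1 / (\<alpha> - \<beta>) < real m" using reals_Archimedean2 by blast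
  have "0 < 1 / (\<alpha> - \<beta>)" using \<beta> by simp
  with m have m1: "m \<ge> 1" by (cases m) auto
  let ?c = "fact (2 * m) / (2 ^ m * fact m) :: real"
  have moment: "(\<integral>\<^sup>+\<omega>. ennreal (\<bar>X z \<omega> - X w \<omega>\<bar> ^ (2 * m)) \<partial>M)
      \<le> ennreal (?c * D ^ m * norm (z - w) powr (2 * real m * \<alpha>))" for z w
  proof -
    obtain v where v: "centered_gaussian M (\<lambda>\<omega>. X z \<omega> - X w \<omega>) v" "v \<le> D * norm (r z - r w) powr (2 * \<alpha>)"
      using Gamma_increment_variance[OF \<alpha> noise \<Gamma> r_cl r_cl, of z w] unfolding X_def D_def by blast
    have v0: "0 \<le> v" by (rule centered_gaussian_nonneg[OF v(1)])
    have "(\<integral>\<^sup>+\<omega>. ennreal (\<bar>X z \<omega> - X w \<omega>\<bar> ^ (2 * m)) \<partial>M) = (\<integral>\<^sup>+\<omega>. ennreal ((X z \<omega> - X w \<omega>) ^ (2 * m)) \<partial>M)"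
      by (simp add: power_even_abs)
    also have "\<dots> = ennreal (v ^ m * ?c)"
      using centered_gaussian_even_moment[OF v(1), of m] by (subst nn_integral_eq_integral) auto
    also have "\<dots> \<le> ennreal ((D * norm (z - w) powr (2 * \<alpha>)) ^ m * ?c)"
    proof (intro ennreal_leI mult_right_mono power_mono v0)
      have "D * norm (r z - r w) powr (2 * \<alpha>) \<le> D * norm (z - w) powr (2 * \<alpha>)"
        using D r_dist \<alpha> by (intro mult_left_mono powr_mono2) auto
      with v(2) show "v \<le> D * norm (z - w) powr (2 * \<alpha>)" by simp
    qed simp
    also have "(norm (z - w) powr (2 * \<alpha>)) ^ m = norm (z - w) powr (2 * real m * \<alpha>)"
      using m1 by (cases "z = w") (simp_all add: powr_powr mult_ac flip: powr_realpow)
    then have "(D * norm (z - w) powr (2 * \<alpha>)) ^ m * ?c = ?c * D ^ m * norm (z - w) powr (2 * real m * \<alpha>)"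
      by (simp add: power_mult_distrib)
    finally show ?thesis .
  qed
  have "1 < real m * (\<alpha> - \<beta>)" using m \<beta> by (simp add: field_simps)
  then have q: "2 * real m * \<alpha> > 2 + \<beta> * real (2 * m)" by (simp add: algebra_simps)
  have "\<exists>Y. (\<forall>z. Y z \<in> borel_measurable M \<and> (AE \<omega> in M. Y z \<omega> = X z \<omega>)) \<and>
      (\<forall>\<omega>\<in>space M. hoelder_on UNIV \<beta> (\<lambda>z. Y z \<omega>))"
    by (rule kolmogorov_chentsov_plane[OF X_meas _ _ moment \<beta>(1) q]) (use m1 D in auto)
  then obtain Y where Y: "\<And>z. Y z \<in> borel_measurable M" "\<And>z. AE \<omega> in M. Y z \<omega> = X z \<omega>"
    "\<And>\<omega>. \<omega> \<in> space M \<Longrightarrow> hoelder_on UNIV \<beta> (\<lambda>z. Y z \<omega>)" by blast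
  show ?thesis
  proof (intro exI[of _ Y] conjI ballI)
    show "is_version_on M (closure uhp) Y (\<lambda>z \<omega>. 2 * Re (\<Gamma> z \<omega>))"
      unfolding is_version_on_def
    proof (intro ballI conjI)
      fix z assume z: "z \<in> closure uhp"
      show "Y z \<in> borel_measurable M" by (rule Y(1))
      show "AE \<omega> in M. Y z \<omega> = 2 * Re (\<Gamma> z \<omega>)" using Y(2)[of z] unfolding X_def r_id[OF z] .
    qed
    show "hoelder_on (closure uhp) \<beta> (\<lambda>z. Y z \<omega>)" if "\<omega> \<in> space M" for \<omega>
      by (rule hoelder_on_weaken[OF Y(3)[OF that]]) auto
  qed
qed

text \<open>Almost surely the version agrees with the process at the countably many grid points. Both are continuous in the
open half-plane, so there they agree everywhere, and the continuity of the version up to the boundary gives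
the limit.\<close>

lemma Gamma_boundary_limit:
  assumes \<alpha>: "0 < \<alpha>" "\<alpha> < 1" and noise: "gaussian_noise M \<xi>1 \<xi>2"
    and \<Gamma>: "is_Gamma_plus M \<alpha> \<xi>1 \<xi>2 \<Gamma>"
  shows "AE \<omega> in M. ((\<lambda>z. 2 * Re (\<Gamma> z \<omega>)) \<longlongrightarrow> Gamma_real \<Gamma> t \<omega>) (at (complex_of_real t) within uhp)"
proof -
  obtain Y where Y: "\<And>z. z \<in> closure uhp \<Longrightarrow> AE \<omega> in M. Y z \<omega> = 2 * Re (\<Gamma> z \<omega>)"
    "\<And>\<omega>. \<omega> \<in> space M \<Longrightarrow> hoelder_on (closure uhp) (\<alpha> / 2) (\<lambda>z. Y z \<omega>)"
    using Gamma_hoelder_version[OF \<alpha> noise \<Gamma>, of "\<alpha> / 2"] \<alpha> unfolding is_version_on_def by auto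
  have t: "complex_of_real t \<in> closure uhp" by (simp add: closure_uhp)
  have grid: "AE \<omega> in M. \<forall>n i j. grid_point n i j \<in> uhp \<longrightarrow> Y (grid_point n i j) \<omega> = 2 * Re (\<Gamma> (grid_point n i j) \<omega>)"
    unfolding AE_all_countable
  proof (intro allI)
    fix n i j
    show "AE \<omega> in M. grid_point n i j \<in> uhp \<longrightarrow> Y (grid_point n i j) \<omega> = 2 * Re (\<Gamma> (grid_point n i j) \<omega>)"
      using Y(1)[of "grid_point n i j"] closure_subset[of uhp] by (cases "grid_point n i j \<in> uhp") auto
  qed
  show ?thesis using Gamma_AE_continuous[OF \<alpha>(1,2) noise \<Gamma>] grid Y(1)[OF t] AE_space
  proof eventually_elim
    case (elim \<omega>)
    have contY: "continuous_on (closure uhp) (\<lambda>z. Y z \<omega>)"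
      using hoelder_on_imp_continuous_on[OF Y(2)[OF elim(4)]] \<alpha> by simp
    have eq: "2 * Re (\<Gamma> z \<omega>) = Y z \<omega>" if z: "z \<in> uhp" for z
    proof -
      have lim: "(\<lambda>n. dyadic_floor n z) \<longlonglongrightarrow> z"
      proof (rule LIM_zero_cancel, rule Lim_null_comparison)
        show "\<forall>\<^sub>F n in sequentially. norm (dyadic_floor n z - z) \<le> 2 * (1/2) ^ n"
          by (intro always_eventually allI dyadic_floor_dist)
        show "(\<lambda>n. 2 * (1/2::real) ^ n) \<longlonglongrightarrow> 0" by (intro tendsto_mult_right_zero LIMSEQ_realpow_zero) auto
      qed
      then have ev: "\<forall>\<^sub>F n in sequentially. dyadic_floor n z \<in> uhp" using open_uhp z by (rule topological_tendstoD)
      have lim\<Gamma>: "(\<lambda>n. 2 * Re (\<Gamma> (dyadic_floor n z) \<omega>)) \<longlonglongrightarrow> 2 * Re (\<Gamma> z \<omega>)"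
        by (intro tendsto_intros continuous_on_tendsto_compose[OF elim(1) lim z ev])
      have limY: "(\<lambda>n. Y (dyadic_floor n z) \<omega>) \<longlonglongrightarrow> Y z \<omega>"
      proof (rule continuous_on_tendsto_compose[OF contY lim])
        show "z \<in> closure uhp" using z closure_subset by blast
        show "\<forall>\<^sub>F n in sequentially. dyadic_floor n z \<in> closure uhp"
          using ev by eventually_elim (use closure_subset in blast)
      qed
      have "\<forall>\<^sub>F n in sequentially. 2 * Re (\<Gamma> (dyadic_floor n z) \<omega>) = Y (dyadic_floor n z) \<omega>"
        using ev by eventually_elim (use elim(2) in \<open>simp add: dyadic_floor_def\<close>)
      from Lim_transform_eventually[OF lim\<Gamma> this] show ?thesis using limY by (rule LIMSEQ_unique)
    qed
    have limY: "((\<lambda>z. Y z \<omega>) \<longlongrightarrow> Y (of_real t) \<omega>) (at (complex_of_real t) within uhp)"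
      by (rule tendsto_within_subset[OF contY[unfolded continuous_on_def, rule_format, OF t] closure_subset])
    have "\<forall>\<^sub>F z in at (complex_of_real t) within uhp. Y z \<omega> = 2 * Re (\<Gamma> z \<omega>)"
      unfolding eventually_at_topological using eq by (intro exI[of _ UNIV]) auto
    from Lim_transform_eventually[OF limY this]
    show "((\<lambda>z. 2 * Re (\<Gamma> z \<omega>)) \<longlongrightarrow> Gamma_real \<Gamma> t \<omega>) (at (complex_of_real t) within uhp)"
      using elim(3) by (simp add: Gamma_real_def)
  qed
qed

theorem corollary1p7:
  fixes \<alpha> :: real
    and M :: "'a measure"
    and \<xi>1 \<xi>2 :: "nat \<Rightarrow> 'a \<Rightarrow> real"
    and \<Gamma> :: "complex \<Rightarrow> 'a \<Rightarrow> complex"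
  assumes "\<alpha> \<in> {0<..<1} - {1 / (2 * real n) | n. n \<ge> 1}"
    and "gaussian_noise M \<xi>1 \<xi>2"
    and "is_Gamma_plus M \<alpha> \<xi>1 \<xi>2 \<Gamma>"
  shows
    "(\<forall>z\<in>closure uhp. \<forall>\<omega>. complex_of_real (2 * Re (\<Gamma> z \<omega>)) = \<Gamma> z \<omega> + Gamma_minus \<Gamma> (cnj z) \<omega>)
     \<and> fractional_brownian_motion M \<alpha> (Gamma_real \<Gamma>)
     \<and> (\<forall>(N :: 'b measure) B. fractional_brownian_motion N \<alpha> B \<longrightarrow>
          process_law M (Gamma_real \<Gamma>) = process_law N B)
     \<and> (\<forall>t. AE \<omega> in M.
          ((\<lambda>z. 2 * Re (\<Gamma> z \<omega>)) \<longlongrightarrow> Gamma_real \<Gamma> t \<omega>) (at (complex_of_real t) within uhp))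
     \<and> (\<exists>C. \<forall>t. \<forall>z\<in>closure uhp.
          integrable M (\<lambda>\<omega>. \<bar>2 * Re (\<Gamma> z \<omega>) - Gamma_real \<Gamma> t \<omega>\<bar>\<^sup>2) \<and>
          prob_space.expectation M (\<lambda>\<omega>. \<bar>2 * Re (\<Gamma> z \<omega>) - Gamma_real \<Gamma> t \<omega>\<bar>\<^sup>2)
            \<le> C * norm (z - complex_of_real t) powr (2 * \<alpha>))
     \<and> (\<forall>\<epsilon>>0. \<exists>Y. is_version_on M (closure uhp) Y (\<lambda>z \<omega>. 2 * Re (\<Gamma> z \<omega>)) \<and>
          (\<forall>\<omega>\<in>space M. hoelder_on (closure uhp) (\<alpha> - \<epsilon>) (\<lambda>z. Y z \<omega>)))"
proof -
  have "\<alpha> \<notin> {1 / (2 * real n) | n. n \<ge> 1}" using assms(1) by blast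
  then have "\<alpha> \<noteq> 1 / (2 * real 1)" by blast
  then have \<alpha>: "0 < \<alpha>" "\<alpha> < 1" "\<alpha> \<noteq> 1/2" using assms(1) by auto
  note noise = assms(2) and \<Gamma> = assms(3)
  interpret prob_space M by (rule gaussian_noiseD(1)[OF noise])
  note fbm = Gamma_real_fractional_brownian_motion[OF \<alpha> noise \<Gamma>]
  let ?sq = "\<lambda>z t \<omega>. \<bar>2 * Re (\<Gamma> z \<omega>) - Gamma_real \<Gamma> t \<omega>\<bar>\<^sup>2"
  show ?thesis
  proof (intro conjI allI ballI impI)
    fix z \<omega>
    show "complex_of_real (2 * Re (\<Gamma> z \<omega>)) = \<Gamma> z \<omega> + Gamma_minus \<Gamma> (cnj z) \<omega>"
      by (simp add: Gamma_minus_def complex_add_cnj)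
  next
    show "fractional_brownian_motion M \<alpha> (Gamma_real \<Gamma>)" by (rule fbm)
  next
    fix N :: "'b measure" and B
    assume "fractional_brownian_motion N \<alpha> B"
    with fbm show "process_law M (Gamma_real \<Gamma>) = process_law N B"
      by (rule fractional_brownian_motion_law_unique)
  next
    fix t
    show "AE \<omega> in M. ((\<lambda>z. 2 * Re (\<Gamma> z \<omega>)) \<longlongrightarrow> Gamma_real \<Gamma> t \<omega>) (at (complex_of_real t) within uhp)"
      by (rule Gamma_boundary_limit[OF \<alpha>(1,2) noise \<Gamma>])
  next
    show "\<exists>C. \<forall>t. \<forall>z\<in>closure uhp.
        integrable M (?sq z t) \<and> expectation (?sq z t) \<le> C * norm (z - complex_of_real t) powr (2 * \<alpha>)"
    proof (intro exI[of _ "20 / (4 * \<bar>cos (pi * \<alpha>)\<bar>)"] allI ballI)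
      fix t z assume z: "z \<in> closure uhp"
      have t: "complex_of_real t \<in> closure uhp" by (simp add: closure_uhp)
      obtain v where v: "centered_gaussian M (\<lambda>\<omega>. 2 * Re (\<Gamma> z \<omega>) - Gamma_real \<Gamma> t \<omega>) v"
        "v \<le> 20 / (4 * \<bar>cos (pi * \<alpha>)\<bar>) * norm (z - complex_of_real t) powr (2 * \<alpha>)"
        using Gamma_increment_variance[OF \<alpha>(1,2) noise \<Gamma> z t] unfolding Gamma_real_def by blast
      show "integrable M (?sq z t) \<and> expectation (?sq z t) \<le> 20 / (4 * \<bar>cos (pi * \<alpha>)\<bar>) * norm (z - complex_of_real t) powr (2 * \<alpha>)"
        using centered_gaussian_variance[OF v(1)] v(2) unfolding power2_abs by simp
    qed
  next
    fix \<epsilon> :: real assume \<epsilon>: "\<epsilon> > 0"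
    let ?\<beta> = "max (\<alpha> - \<epsilon>) (\<alpha> / 2)"
    obtain Y where Y: "is_version_on M (closure uhp) Y (\<lambda>z \<omega>. 2 * Re (\<Gamma> z \<omega>))"
      "\<And>\<omega>. \<omega> \<in> space M \<Longrightarrow> hoelder_on (closure uhp) ?\<beta> (\<lambda>z. Y z \<omega>)"
      using Gamma_hoelder_version[OF \<alpha>(1,2) noise \<Gamma>, of ?\<beta>] \<epsilon> \<alpha> by (auto simp: less_max_iff_disj)
    have "hoelder_on (closure uhp) (\<alpha> - \<epsilon>) (\<lambda>z. Y z \<omega>)" if "\<omega> \<in> space M" for \<omega>
      by (rule hoelder_on_weaken[OF Y(2)[OF that]]) auto
    with Y(1) show "\<exists>Y. is_version_on M (closure uhp) Y (\<lambda>z \<omega>. 2 * Re (\<Gamma> z \<omega>)) \<and>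
        (\<forall>\<omega>\<in>space M. hoelder_on (closure uhp) (\<alpha> - \<epsilon>) (\<lambda>z. Y z \<omega>))" by blast
  qed
qed

end
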